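(* Assume the Standard setup below, that $\tau$ is in the limit circle case at $a$ and $b$, and that for a fixed $\beta'\in(0,\pi]$ one has $T_{\pi,\beta'}\ge\varepsilon I$ for some $\varepsilon>0$. Let $T_{min,\beta'}$ be the restriction of $T_{max}$ to $\{g\in\mathrm{dom}(T_{max}):\tilde g(a)=\tilde g'(a)=0,\ \tilde g(b)\cos\beta'-\tilde g'(b)\sin\beta'=0\}$, and put $$Q_{\beta'}=\frac{\cos(\beta')\tilde{\hat u}_a(b)-\sin(\beta')\tilde{\hat u}_a'(b)}{\cos(\beta')\tilde u_a(b)-\sin(\beta')\tilde u_a'(b)}$$ (the denominator is nonzero). Then the nonnegative self-adjoint extensions of $T_{min,\beta'}$ are exactly the operators $T_{\alpha,\beta'}$ with $$\alpha\in\big[\cot^{-1}(Q_{\beta'}),\pi\big],$$ where $\cot^{-1}:\mathbb R\to(0,\pi)$. Moreover, for $\alpha_1,\alpha_2\in(0,\pi]$: $\cot^{-1}(Q_{\beta'})\le\alpha_1\le\alpha_2$ if and only if $0\le T_{\alpha_1,\beta'}\le T_{\alpha_2,\beta'}$.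
   Context: Standard setup. Let $-\infty\le a<b\le\infty$ and let $p,q,r$ be real-valued measurable functions on $(a,b)$ with $p>0$, $r>0$ a.e., and $1/p,q,r\in L^1_{loc}((a,b))$. Let $\tau=\frac1r\big[-\frac{d}{dx}p\frac{d}{dx}+q\big]$, $y^{[1]}=py'$, $W(f,g)=fg^{[1]}-f^{[1]}g$. The maximal operator $T_{max}$ in $L^2((a,b);r\,dx)$ acts as $\tau$ on $\{g\in L^2((a,b);rdx): g,g^{[1]}\in AC_{loc}((a,b)),\ \tau g\in L^2((a,b);rdx)\}$; the minimal operator $T_{min}$ is the closure of the restriction of $T_{max}$ to compactly supported elements. $\tau$ is limit circle at an endpoint if for every $z\in\mathbb C$ all solutions of $\tau u=zu$ are in $L^2(rdx)$ near that endpoint. Principal solution of $\tau u=0$ at $a$: a real solution $u$ nonvanishing near $a$ with $\int_a^c p^{-1}u^{-2}dx=\infty$; nonprincipal: a real solution linearly independent of it; analogously at $b$. Here $u_a,\hat u_a$ are principal and nonprincipal solutions of $\tau u=0$ at $a$ (solutions on all of $(a,b)$) with $W(\hat u_a,u_a)=1$, and $u_b,\hat u_b$ a fixed normalized principal/nonprincipal pair at $b$. Generalized boundary values of $g$ (in $\mathrm{dom}(T_{max})$, or any solution): $\tilde g(a)=-\lim_{x\downarrow a}W(u_a,g)(x)$, $\tilde g'(a)=\lim_{x\downarrow a}W(\hat u_a,g)(x)$, $\tilde g(b)=-\lim_{x\uparrow b}W(u_b,g)(x)$, $\tilde g'(b)=\lim_{x\uparrow b}W(\hat u_b,g)(x)$.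 For $\alpha,\beta\in(0,\pi]$, $T_{\alpha,\beta}$ is the restriction of $T_{max}$ to $\{g:\tilde g(a)\cos\alpha+\tilde g'(a)\sin\alpha=0,\ \tilde g(b)\cos\beta-\tilde g'(b)\sin\beta=0\}$. For nonnegative self-adjoint $A,B$: $A\le B$ means $\mathrm{dom}(B^{1/2})\subseteq\mathrm{dom}(A^{1/2})$ and $\|A^{1/2}f\|\le\|B^{1/2}f\|$ for $f\in\mathrm{dom}(B^{1/2})$. *)

theory Defs
  imports "HOL-Analysis.Analysis"
begin

text \<open>Sturm--Liouville setting on the interval (a,b) with a,b extended reals.
Functions are complex valued on the real line; only values on (a,b) matter.
Operators (possibly given by representatives) are graphs: sets of pairs (f, Tf).\<close>

type_synonym fn = "real \<Rightarrow> complex"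
type_synonym graph = "(fn \<times> fn) set"

definition Ioo_e :: "ereal \<Rightarrow> ereal \<Rightarrow> real set" where
  "Ioo_e a b = {x. a < ereal x \<and> ereal x < b}"

definition at_left_end :: "ereal \<Rightarrow> real filter" where
  "at_left_end a = (case a of ereal x \<Rightarrow> at_right x | MInfty \<Rightarrow> at_bot | PInfty \<Rightarrow> bot)"

definition at_right_end :: "ereal \<Rightarrow> real filter" where
  "at_right_end b = (case b of ereal x \<Rightarrow> at_left x | PInfty \<Rightarrow> at_top | MInfty \<Rightarrow> bot)"

definition abs_cont_on :: "real \<Rightarrow> real \<Rightarrow> fn \<Rightarrow> bool" where
  "abs_cont_on c d f \<longleftrightarrow> (\<forall>e>0. \<exists>\<delta>>0. \<forall>(n::nat) (xs::nat \<Rightarrow> real) ys.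
      (\<forall>i<n. c \<le> xs i \<and> xs i \<le> ys i \<and> ys i \<le> d) \<and>
      (\<forall>i<n. \<forall>j<n. i \<noteq> j \<longrightarrow> ys i \<le> xs j \<or> ys j \<le> xs i) \<and>
      (\<Sum>i<n. ys i - xs i) < \<delta> \<longrightarrow> (\<Sum>i<n. cmod (f (ys i) - f (xs i))) < e)"

definition AC_loc :: "ereal \<Rightarrow> ereal \<Rightarrow> fn \<Rightarrow> bool" where
  "AC_loc a b f \<longleftrightarrow> (\<forall>c d. {c..d} \<subseteq> Ioo_e a b \<longrightarrow> abs_cont_on c d f)"

definition loc_int :: "ereal \<Rightarrow> ereal \<Rightarrow> (real \<Rightarrow> real) \<Rightarrow> bool" where
  "loc_int a b f \<longleftrightarrow> (\<forall>c d. {c..d} \<subseteq> Ioo_e a b \<longrightarrow> set_integrable lebesgue {c..d} f)"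

definition SL_setup :: "ereal \<Rightarrow> ereal \<Rightarrow> (real \<Rightarrow> real) \<Rightarrow> (real \<Rightarrow> real) \<Rightarrow> (real \<Rightarrow> real) \<Rightarrow> bool" where
  "SL_setup a b p q r \<longleftrightarrow> a < b \<and>
     set_borel_measurable lebesgue (Ioo_e a b) p \<and>
     set_borel_measurable lebesgue (Ioo_e a b) q \<and>
     set_borel_measurable lebesgue (Ioo_e a b) r \<and>
     (AE x in lebesgue. x \<in> Ioo_e a b \<longrightarrow> 0 < p x) \<and>
     (AE x in lebesgue. x \<in> Ioo_e a b \<longrightarrow> 0 < r x) \<and>
     loc_int a b (\<lambda>x. 1 / p x) \<and> loc_int a b q \<and> loc_int a b r"

definition L2 :: "ereal \<Rightarrow> ereal \<Rightarrow> (real \<Rightarrow> real) \<Rightarrow> fn \<Rightarrow> bool" where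
  "L2 a b r f \<longleftrightarrow> set_borel_measurable lebesgue (Ioo_e a b) f \<and>
     set_integrable lebesgue (Ioo_e a b) (\<lambda>x. (cmod (f x))\<^sup>2 * r x)"

definition inner_L2 :: "ereal \<Rightarrow> ereal \<Rightarrow> (real \<Rightarrow> real) \<Rightarrow> fn \<Rightarrow> fn \<Rightarrow> complex" where
  "inner_L2 a b r f g = set_lebesgue_integral lebesgue (Ioo_e a b)
     (\<lambda>x. f x * cnj (g x) * complex_of_real (r x))"

definition norm_L2 :: "ereal \<Rightarrow> ereal \<Rightarrow> (real \<Rightarrow> real) \<Rightarrow> fn \<Rightarrow> real" where
  "norm_L2 a b r f = sqrt (Re (inner_L2 a b r f f))"

definition ae_eq :: "ereal \<Rightarrow> ereal \<Rightarrow> fn \<Rightarrow> fn \<Rightarrow> bool" where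
  "ae_eq a b f g \<longleftrightarrow> (AE x in lebesgue. x \<in> Ioo_e a b \<longrightarrow> f x = g x)"

definition L2_pairs :: "ereal \<Rightarrow> ereal \<Rightarrow> (real \<Rightarrow> real) \<Rightarrow> graph" where
  "L2_pairs a b r = {(f, g). L2 a b r f \<and> L2 a b r g}"

definition sat :: "ereal \<Rightarrow> ereal \<Rightarrow> (real \<Rightarrow> real) \<Rightarrow> graph \<Rightarrow> graph" where
  "sat a b r G = {(u, v). L2 a b r u \<and> L2 a b r v \<and>
      (\<exists>(f, g)\<in>G. ae_eq a b u f \<and> ae_eq a b v g)}"

definition adjoint :: "ereal \<Rightarrow> ereal \<Rightarrow> (real \<Rightarrow> real) \<Rightarrow> graph \<Rightarrow> graph" where
  "adjoint a b r G = {(u, v). L2 a b r u \<and> L2 a b r v \<and>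
      (\<forall>(f, g)\<in>G. inner_L2 a b r g u = inner_L2 a b r f v)}"

definition single_valued_op :: "ereal \<Rightarrow> ereal \<Rightarrow> (real \<Rightarrow> real) \<Rightarrow> graph \<Rightarrow> bool" where
  "single_valued_op a b r G \<longleftrightarrow> G \<subseteq> L2_pairs a b r \<and>
     (\<forall>(f1, g1)\<in>G. \<forall>(f2, g2)\<in>G. ae_eq a b f1 f2 \<longrightarrow> ae_eq a b g1 g2)"

definition self_adjoint_op :: "ereal \<Rightarrow> ereal \<Rightarrow> (real \<Rightarrow> real) \<Rightarrow> graph \<Rightarrow> bool" where
  "self_adjoint_op a b r G \<longleftrightarrow> single_valued_op a b r G \<and> sat a b r G = adjoint a b r G"

definition nonneg_op :: "ereal \<Rightarrow> ereal \<Rightarrow> (real \<Rightarrow> real) \<Rightarrow> graph \<Rightarrow> bool" where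
  "nonneg_op a b r G \<longleftrightarrow> (\<forall>(f, g)\<in>G. inner_L2 a b r g f \<in> \<real> \<and> 0 \<le> Re (inner_L2 a b r g f))"

definition nonneg_sa :: "ereal \<Rightarrow> ereal \<Rightarrow> (real \<Rightarrow> real) \<Rightarrow> graph \<Rightarrow> bool" where
  "nonneg_sa a b r G \<longleftrightarrow> self_adjoint_op a b r G \<and> nonneg_op a b r G"

text \<open>The nonnegative self-adjoint square root (taken in saturated form, which makes it unique).\<close>
definition sqrt_op :: "ereal \<Rightarrow> ereal \<Rightarrow> (real \<Rightarrow> real) \<Rightarrow> graph \<Rightarrow> graph" where
  "sqrt_op a b r A = (THE S. S = adjoint a b r S \<and> single_valued_op a b r S \<and> nonneg_op a b r S \<and>
      sat a b r (S O S) = sat a b r A)"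

definition op_le :: "ereal \<Rightarrow> ereal \<Rightarrow> (real \<Rightarrow> real) \<Rightarrow> graph \<Rightarrow> graph \<Rightarrow> bool" where
  "op_le a b r A B \<longleftrightarrow> nonneg_sa a b r A \<and> nonneg_sa a b r B \<and>
     fst ` sqrt_op a b r B \<subseteq> fst ` sqrt_op a b r A \<and>
     (\<forall>f gA gB. (f, gA) \<in> sqrt_op a b r A \<longrightarrow> (f, gB) \<in> sqrt_op a b r B \<longrightarrow>
        norm_L2 a b r gA \<le> norm_L2 a b r gB)"

definition eps_op :: "ereal \<Rightarrow> ereal \<Rightarrow> (real \<Rightarrow> real) \<Rightarrow> real \<Rightarrow> graph" where
  "eps_op a b r e = {(f, \<lambda>x. complex_of_real e * f x) | f. L2 a b r f}"

definition qd :: "ereal \<Rightarrow> ereal \<Rightarrow> (real \<Rightarrow> real) \<Rightarrow> fn \<Rightarrow> fn" where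
  "qd a b p y = (THE y1. AC_loc a b y1 \<and> (\<forall>x. x \<notin> Ioo_e a b \<longrightarrow> y1 x = 0) \<and>
      (AE x in lebesgue. x \<in> Ioo_e a b \<longrightarrow>
         (y has_vector_derivative (y1 x / complex_of_real (p x))) (at x)))"

definition Wr :: "ereal \<Rightarrow> ereal \<Rightarrow> (real \<Rightarrow> real) \<Rightarrow> fn \<Rightarrow> fn \<Rightarrow> real \<Rightarrow> complex" where
  "Wr a b p f g x = f x * qd a b p g x - qd a b p f x * g x"

definition is_sol :: "ereal \<Rightarrow> ereal \<Rightarrow> (real \<Rightarrow> real) \<Rightarrow> (real \<Rightarrow> real) \<Rightarrow> (real \<Rightarrow> real) \<Rightarrow> complex \<Rightarrow> fn \<Rightarrow> bool" where
  "is_sol a b p q r z u \<longleftrightarrow> AC_loc a b u \<and> AC_loc a b (qd a b p u) \<and>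
     (AE x in lebesgue. x \<in> Ioo_e a b \<longrightarrow>
        (u has_vector_derivative (qd a b p u x / complex_of_real (p x))) (at x) \<and>
        (qd a b p u has_vector_derivative ((complex_of_real (q x) - z * complex_of_real (r x)) * u x)) (at x))"

definition limit_circle_a :: "ereal \<Rightarrow> ereal \<Rightarrow> (real \<Rightarrow> real) \<Rightarrow> (real \<Rightarrow> real) \<Rightarrow> (real \<Rightarrow> real) \<Rightarrow> bool" where
  "limit_circle_a a b p q r \<longleftrightarrow> (\<forall>z u. is_sol a b p q r z u \<longrightarrow>
     (\<exists>c\<in>Ioo_e a b. set_integrable lebesgue {x \<in> Ioo_e a b. x < c} (\<lambda>x. (cmod (u x))\<^sup>2 * r x)))"

definition limit_circle_b :: "ereal \<Rightarrow> ereal \<Rightarrow> (real \<Rightarrow> real) \<Rightarrow> (real \<Rightarrow> real) \<Rightarrow> (real \<Rightarrow> real) \<Rightarrow> bool" where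
  "limit_circle_b a b p q r \<longleftrightarrow> (\<forall>z u. is_sol a b p q r z u \<longrightarrow>
     (\<exists>c\<in>Ioo_e a b. set_integrable lebesgue {x \<in> Ioo_e a b. c < x} (\<lambda>x. (cmod (u x))\<^sup>2 * r x)))"

definition real_sol :: "ereal \<Rightarrow> ereal \<Rightarrow> (real \<Rightarrow> real) \<Rightarrow> (real \<Rightarrow> real) \<Rightarrow> (real \<Rightarrow> real) \<Rightarrow> fn \<Rightarrow> bool" where
  "real_sol a b p q r u \<longleftrightarrow> is_sol a b p q r 0 u \<and> (\<forall>x\<in>Ioo_e a b. u x \<in> \<real>)"

definition principal_a :: "ereal \<Rightarrow> ereal \<Rightarrow> (real \<Rightarrow> real) \<Rightarrow> (real \<Rightarrow> real) \<Rightarrow> (real \<Rightarrow> real) \<Rightarrow> fn \<Rightarrow> bool" where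
  "principal_a a b p q r u \<longleftrightarrow> real_sol a b p q r u \<and>
     (\<exists>c\<in>Ioo_e a b. (\<forall>x\<in>Ioo_e a b. x \<le> c \<longrightarrow> u x \<noteq> 0) \<and>
        (\<integral>\<^sup>+ x. indicator {x \<in> Ioo_e a b. x < c} x * ennreal (1 / (p x * (Re (u x))\<^sup>2)) \<partial>lebesgue) = \<infinity>)"

definition principal_b :: "ereal \<Rightarrow> ereal \<Rightarrow> (real \<Rightarrow> real) \<Rightarrow> (real \<Rightarrow> real) \<Rightarrow> (real \<Rightarrow> real) \<Rightarrow> fn \<Rightarrow> bool" where
  "principal_b a b p q r u \<longleftrightarrow> real_sol a b p q r u \<and>
     (\<exists>c\<in>Ioo_e a b. (\<forall>x\<in>Ioo_e a b. c \<le> x \<longrightarrow> u x \<noteq> 0) \<and>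
        (\<integral>\<^sup>+ x. indicator {x \<in> Ioo_e a b. c < x} x * ennreal (1 / (p x * (Re (u x))\<^sup>2)) \<partial>lebesgue) = \<infinity>)"

definition lin_indep :: "ereal \<Rightarrow> ereal \<Rightarrow> fn \<Rightarrow> fn \<Rightarrow> bool" where
  "lin_indep a b u v \<longleftrightarrow> \<not> (\<exists>c1 c2. (c1, c2) \<noteq> (0, 0) \<and> (\<forall>x\<in>Ioo_e a b. c1 * u x + c2 * v x = 0))"

definition T_max :: "ereal \<Rightarrow> ereal \<Rightarrow> (real \<Rightarrow> real) \<Rightarrow> (real \<Rightarrow> real) \<Rightarrow> (real \<Rightarrow> real) \<Rightarrow> graph" where
  "T_max a b p q r = {(g, h). L2 a b r g \<and> L2 a b r h \<and> AC_loc a b g \<and> AC_loc a b (qd a b p g) \<and>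
     (AE x in lebesgue. x \<in> Ioo_e a b \<longrightarrow>
        (g has_vector_derivative (qd a b p g x / complex_of_real (p x))) (at x) \<and>
        (qd a b p g has_vector_derivative
            (complex_of_real (q x) * g x - complex_of_real (r x) * h x)) (at x))}"

definition bv_a :: "ereal \<Rightarrow> ereal \<Rightarrow> (real \<Rightarrow> real) \<Rightarrow> fn \<Rightarrow> fn \<Rightarrow> complex" where
  "bv_a a b p ua g = - Lim (at_left_end a) (Wr a b p ua g)"
definition bvd_a :: "ereal \<Rightarrow> ereal \<Rightarrow> (real \<Rightarrow> real) \<Rightarrow> fn \<Rightarrow> fn \<Rightarrow> complex" where
  "bvd_a a b p uah g = Lim (at_left_end a) (Wr a b p uah g)"
definition bv_b :: "ereal \<Rightarrow> ereal \<Rightarrow> (real \<Rightarrow> real) \<Rightarrow> fn \<Rightarrow> fn \<Rightarrow> complex" where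
  "bv_b a b p ub g = - Lim (at_right_end b) (Wr a b p ub g)"
definition bvd_b :: "ereal \<Rightarrow> ereal \<Rightarrow> (real \<Rightarrow> real) \<Rightarrow> fn \<Rightarrow> fn \<Rightarrow> complex" where
  "bvd_b a b p ubh g = Lim (at_right_end b) (Wr a b p ubh g)"

definition T_ab :: "ereal \<Rightarrow> ereal \<Rightarrow> (real \<Rightarrow> real) \<Rightarrow> (real \<Rightarrow> real) \<Rightarrow> (real \<Rightarrow> real) \<Rightarrow>
    fn \<Rightarrow> fn \<Rightarrow> fn \<Rightarrow> fn \<Rightarrow> real \<Rightarrow> real \<Rightarrow> graph" where
  "T_ab a b p q r ua uah ub ubh \<alpha> \<beta> = {(g, h) \<in> T_max a b p q r.
     bv_a a b p ua g * cos \<alpha> + bvd_a a b p uah g * sin \<alpha> = 0 \<and>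
     bv_b a b p ub g * cos \<beta> - bvd_b a b p ubh g * sin \<beta> = 0}"

definition T_min_b :: "ereal \<Rightarrow> ereal \<Rightarrow> (real \<Rightarrow> real) \<Rightarrow> (real \<Rightarrow> real) \<Rightarrow> (real \<Rightarrow> real) \<Rightarrow>
    fn \<Rightarrow> fn \<Rightarrow> fn \<Rightarrow> fn \<Rightarrow> real \<Rightarrow> graph" where
  "T_min_b a b p q r ua uah ub ubh \<beta> = {(g, h) \<in> T_max a b p q r.
     bv_a a b p ua g = 0 \<and> bvd_a a b p uah g = 0 \<and>
     bv_b a b p ub g * cos \<beta> - bvd_b a b p ubh g * sin \<beta> = 0}"

definition Q_num :: "ereal \<Rightarrow> ereal \<Rightarrow> (real \<Rightarrow> real) \<Rightarrow> fn \<Rightarrow> fn \<Rightarrow> fn \<Rightarrow> real \<Rightarrow> complex" where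
  "Q_num a b p uah ub ubh \<beta> = cos \<beta> * bv_b a b p ub uah - sin \<beta> * bvd_b a b p ubh uah"
definition Q_den :: "ereal \<Rightarrow> ereal \<Rightarrow> (real \<Rightarrow> real) \<Rightarrow> fn \<Rightarrow> fn \<Rightarrow> fn \<Rightarrow> real \<Rightarrow> complex" where
  "Q_den a b p ua ub ubh \<beta> = cos \<beta> * bv_b a b p ub ua - sin \<beta> * bvd_b a b p ubh ua"

definition arccot :: "real \<Rightarrow> real" where
  "arccot x = pi / 2 - arctan x"

end

theory Submission
  imports Defs
begin

text \<open>
  Let $\psi$ be the solution of $\tau u = 0$ that satisfies the boundary condition at $b$ and has
  $\tilde\psi(a) = 1$. Every $g$ in the maximal domain satisfying the condition at $b$ is $f + c\psi$ with
  $f \in \mathrm{dom}(T_{\pi,\beta'})$, and Green's formula turns the condition at $a$ into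
  $\langle \tau g, \psi\rangle = c\theta$ with $\theta = Q_{\beta'} - \cot\alpha$. The self-adjoint extensions
  are therefore parametrised by $\theta \in \mathbb R \cup \{\infty\}$, with quadratic form
  $\langle T_{\pi,\beta'} f, f\rangle + \theta |c|^2$. Since $u_a$ is principal, $\psi$ does not lie in the
  form domain of $T_{\pi,\beta'}$: there are $f$ with $\langle T_{\pi,\beta'} f, \psi\rangle = 1$ and
  $\langle T_{\pi,\beta'} f, f\rangle$ arbitrarily small, so nonnegativity means $\theta \ge 0$.

  The order is compared through the criterion that $f \in \mathrm{dom}(A^{1/2})$ with
  $\|A^{1/2} f\|^2 \le M$ holds if and only if $|\langle f, A g\rangle|^2 \le M \langle A g, g\rangle$ for all
  $g \in \mathrm{dom}(A)$. It is monotone in $\theta$, and $f = \psi$, $M = \theta$ separates different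
  parameters.
\<close>

section \<open>Square roots of nonnegative self-adjoint relations\<close>

text \<open>The order of operators is stated through a definite description of square roots, so
  existence and uniqueness of the root precede every comparison. The spectral theorem is bypassed:
  the bounded resolvent (1 + A)^{-1} carries all information, and roots of bounded positive
  operators are norm limits of polynomials, hence commute with whatever commutes with the operator.
  The abstract part lives in a real Hilbert space; complex identities are recovered by testing with
  f and i f, and complex linearity of the root follows from its uniqueness, because conjugation by i
  yields another root. The lower bound on T_{pi,beta'} enters as surjectivity: every square
  integrable h is T_{pi,beta'} f for some f. Extensions can then be described by right-hand sides h.
  The minimal operator keeps those orthogonal to psi; a larger extension couples the coefficient c
  linearly to the pairing of h with psi. Symmetry against a single element with nonzero c forces the
  ratio to be real and common to all elements, so one real parameter suffices, and different
  parameters are compared on the same pairs of T_{pi,beta'}.\<close>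

lemma nonneg_quadratic_discriminant:
  fixes a b c :: real
  assumes "\<And>t. 0 \<le> a + 2 * b * t + c * t\<^sup>2"
  shows "b\<^sup>2 \<le> a * c"
proof (cases "c = 0")
  case True
  have "b = 0"
  proof (rule ccontr)
    assume "b \<noteq> 0"
    with assms[of "- (a + 1) / (2 * b)"] True show False by simp
  qed
  with True show ?thesis by simp
next
  case False
  have "c > 0"
  proof (rule ccontr)
    assume "\<not> c > 0"
    with False have c: "c < 0" by simp
    \<comment> \<open>Adding the values at t and -t removes the linear term. For negative
      \<open>c\<close> the choice t^2 = (a + 1) / -c then produces the value -1.\<close>
    have *: "0 \<le> a + c * t\<^sup>2" for t using assms[of t] assms[of "-t"] by simp
    have "0 \<le> a" using *[of 0] by simp
    have "c * (sqrt ((a + 1) / - c))\<^sup>2 = - (a + 1)" using c \<open>0 \<le> a\<close>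
      by (simp add: real_sqrt_pow2 divide_nonneg_neg)
    with *[of "sqrt ((a + 1) / - c)"] show False by simp
  qed
  moreover have "a + 2 * b * (- b / c) + c * (- b / c)\<^sup>2 = (a * c - b\<^sup>2) / c"
    using False by (simp add: field_simps power2_eq_square)
  ultimately show ?thesis using assms[of "- b / c"] by (simp add: zero_le_divide_iff)
qed

section \<open>Projection and Riesz representation in a real Hilbert space\<close>

lemma subspace_closure:
  fixes V :: "'h::real_normed_vector set"
  assumes V: "subspace V"
  shows "subspace (closure V)"
  unfolding subspace_def
proof (intro conjI ballI allI)
  show "0 \<in> closure V" using subspace_0[OF V] closure_subset by blast
next
  fix x y assume "x \<in> closure V" "y \<in> closure V"
  then obtain f g where "\<forall>n. f n \<in> V" "f \<longlonglongrightarrow> x" "\<forall>n. g n \<in> V" "g \<longlonglongrightarrow> y"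
    unfolding closure_sequential by blast
  then show "x + y \<in> closure V" unfolding closure_sequential
    by (intro exI[of _ "\<lambda>n. f n + g n"]) (auto intro: tendsto_add subspace_add[OF V])
next
  fix c x assume "x \<in> closure V"
  then obtain f where "\<forall>n. f n \<in> V" "f \<longlonglongrightarrow> x" unfolding closure_sequential by blast
  then show "c *\<^sub>R x \<in> closure V" unfolding closure_sequential
    by (intro exI[of _ "\<lambda>n. c *\<^sub>R f n"]) (auto intro: tendsto_intros subspace_scale[OF V])
qed

text \<open>A minimising sequence is Cauchy by the parallelogram law, completeness provides a
  nearest point, and the first variation at that point gives orthogonality.\<close>

lemma closed_subspace_projection:
  fixes V :: "'h::{real_inner,banach} set"
  assumes V: "subspace V" "closed V"
  obtains m where "m \<in> V" "\<And>y. y \<in> V \<Longrightarrow> (v - m) \<bullet> y = 0"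
proof -
  define D where "D = (\<lambda>y. (norm (v - y))\<^sup>2) ` V"
  define d where "d = Inf D"
  have V0: "0 \<in> V" using V(1) by (rule subspace_0)
  have Dne: "D \<noteq> {}" and Dbdd: "bdd_below D" unfolding D_def using V0 by (auto intro: bdd_belowI2[of _ 0])
  have dle: "d \<le> (norm (v - y))\<^sup>2" if "y \<in> V" for y
    unfolding d_def using that Dbdd by (intro cInf_lower) (auto simp: D_def)
  have "\<exists>y\<in>V. (norm (v - y))\<^sup>2 < d + 1 / real (Suc n)" for n
    using cInf_lessD[OF Dne, of "d + 1 / real (Suc n)"] unfolding d_def[symmetric] by (auto simp: D_def)
  then obtain m where mV: "\<And>n. m n \<in> V" and m: "\<And>n. (norm (v - m n))\<^sup>2 < d + 1 / real (Suc n)" by metis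
  \<comment> \<open>The midpoint of \<open>m n\<close> and \<open>m k\<close> lies in
    \<open>V\<close>, so its squared distance to \<open>v\<close> is at least \<open>d\<close>; in
    the parallelogram law only the two excesses over \<open>d\<close> survive.\<close>
  have par: "(norm (m n - m k))\<^sup>2 \<le> 2 / real (Suc n) + 2 / real (Suc k)" for n k
  proof -
    have "(1/2) *\<^sub>R (m n + m k) \<in> V" using V(1) mV by (intro subspace_scale subspace_add) auto
    from dle[OF this] have "d \<le> (norm (v - (1/2) *\<^sub>R (m n + m k)))\<^sup>2" .
    moreover have "(norm (m n - m k))\<^sup>2 = 2 * (norm (v - m n))\<^sup>2 + 2 * (norm (v - m k))\<^sup>2
        - 4 * (norm (v - (1/2) *\<^sub>R (m n + m k)))\<^sup>2"
      unfolding power2_norm_eq_inner by (simp add: inner_simps inner_commute field_simps)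
    ultimately show ?thesis using m[of n] m[of k] by simp
  qed
  have "Cauchy m"
  proof (rule metric_CauchyI)
    fix e :: real assume e: "0 < e"
    obtain N where N: "4 / e\<^sup>2 < real N" using reals_Archimedean2 by blast
    show "\<exists>M. \<forall>i\<ge>M. \<forall>j\<ge>M. dist (m i) (m j) < e"
    proof (intro exI allI impI)
      fix i j assume ij: "N \<le> i" "N \<le> j"
      have N0: "0 < real N" using N e by (smt (verit) divide_nonneg_nonneg zero_le_power2)
      have "2 / real (Suc i) \<le> 2 / real N" "2 / real (Suc j) \<le> 2 / real N"
        using ij N0 by (auto intro!: divide_left_mono)
      then have "(norm (m i - m j))\<^sup>2 \<le> 4 / real N" using par[of i j] by simp
      also have "\<dots> < e\<^sup>2" using N N0 e by (simp add: field_simps)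
      finally have "norm (m i - m j) < e" using e by (simp add: power2_less_imp_less)
      then show "dist (m i) (m j) < e" by (simp add: dist_norm)
    qed
  qed
  then obtain l where l: "m \<longlonglongrightarrow> l" by (auto simp: Cauchy_convergent_iff convergent_def)
  have lV: "l \<in> V" using closed_sequentially[OF V(2)] mV l by blast
  have ld: "(norm (v - l))\<^sup>2 \<le> d"
  proof (rule LIMSEQ_le)
    show "(\<lambda>n. (norm (v - m n))\<^sup>2) \<longlonglongrightarrow> (norm (v - l))\<^sup>2" by (intro tendsto_intros l)
    have "(\<lambda>n. 1 / real (Suc n)) \<longlonglongrightarrow> 0" by (simp add: LIMSEQ_inverse_real_of_nat inverse_eq_divide[symmetric] del: of_nat_Suc)
    from tendsto_add[OF tendsto_const[of d] this] show "(\<lambda>n. d + 1 / real (Suc n)) \<longlonglongrightarrow> d" by simp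
    show "\<exists>N. \<forall>n\<ge>N. (norm (v - m n))\<^sup>2 \<le> d + 1 / real (Suc n)" using m less_imp_le by blast
  qed
  have "(v - l) \<bullet> y = 0" if y: "y \<in> V" for y
  proof -
    \<comment> \<open>The variation l + t y gives a nonnegative quadratic in t with constant term 0,
      so the discriminant bound forces its linear coefficient to vanish.\<close>
    have "0 \<le> 0 + 2 * (- ((v - l) \<bullet> y)) * t + (y \<bullet> y) * t\<^sup>2" for t
    proof -
      have "l + t *\<^sub>R y \<in> V" using V(1) lV y by (intro subspace_scale subspace_add) auto
      from order_trans[OF ld dle[OF this]] have "(norm (v - l))\<^sup>2 \<le> (norm (v - (l + t *\<^sub>R y)))\<^sup>2" .
      then show ?thesis unfolding power2_norm_eq_inner
        by (simp add: inner_simps inner_commute power2_eq_square algebra_simps)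
    qed
    from nonneg_quadratic_discriminant[OF this] show ?thesis by simp
  qed
  with lV show ?thesis by (rule that)
qed

text \<open>The bound makes \<open>l z\<close> depend only on \<open>P z\<close>. Instead of
  extending this functional to the closure of the range, the representing vector is read off from
  the normal at (0, 1) to the closed graph.\<close>

lemma riesz_on_range:
  fixes P :: "'g::real_vector \<Rightarrow> 'h::{real_inner,banach}" and l :: "'g \<Rightarrow> real"
  assumes P: "linear P" and l: "linear l" and M: "0 \<le> M" and bd: "\<And>z. (l z)\<^sup>2 \<le> M * (P z \<bullet> P z)"
  obtains x where "x \<in> closure (range P)" "\<And>z. l z = P z \<bullet> x" "x \<bullet> x \<le> M"
proof -
  \<comment> \<open>The bound is a closed condition and survives the closure of the graph. It
    excludes (0, 1), so the component of (0, 1) normal to \<open>W\<close> is nonzero, with positive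
    second coordinate.\<close>
  define W where "W = closure (range (\<lambda>z. (P z, l z)))"
  have "subspace (range (\<lambda>z. (P z, l z)))"
  proof (rule linear_subspace_image[OF _ subspace_UNIV])
    show "linear (\<lambda>z. (P z, l z))"
      by (rule linearI) (auto simp: linear_add[OF P] linear_add[OF l] linear_scale[OF P] linear_scale[OF l])
  qed
  then have W: "subspace W" "closed W" unfolding W_def by (auto intro: subspace_closure)
  have Wb: "w2\<^sup>2 \<le> M * (w1 \<bullet> w1)" if "(w1, w2) \<in> W" for w1 w2
  proof -
    have "closed {w :: 'h \<times> real. (snd w)\<^sup>2 \<le> M * (fst w \<bullet> fst w)}"
      by (intro closed_Collect_le continuous_intros)
    moreover have "range (\<lambda>z. (P z, l z)) \<subseteq> {w. (snd w)\<^sup>2 \<le> M * (fst w \<bullet> fst w)}" using bd by auto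
    ultimately have "W \<subseteq> {w. (snd w)\<^sup>2 \<le> M * (fst w \<bullet> fst w)}" unfolding W_def by (rule closure_minimal[rotated])
    with that show ?thesis by auto
  qed
  obtain m where m: "m \<in> W" "\<And>y. y \<in> W \<Longrightarrow> ((0, 1) - m) \<bullet> y = 0"
    using closed_subspace_projection[OF W] by metis
  define w where "w = (0::'h, 1::real) - m"
  have "w \<noteq> 0"
  proof
    assume "w = 0"
    then have "m = (0, 1)" by (simp add: w_def)
    with Wb[of 0 1] m(1) show False by simp
  qed
  have "w \<bullet> w = w \<bullet> (0, 1)" using m(2)[OF m(1)] unfolding w_def[symmetric]
    by (metis add.right_neutral diff_add_cancel inner_add_right w_def)
  then have s: "snd w > 0" using \<open>w \<noteq> 0\<close> by (metis inner_Pair inner_gt_zero_iff inner_real_def inner_zero_right mult.right_neutral prod.collapse add.left_neutral)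
  define x0 where "x0 = (- 1 / snd w) *\<^sub>R fst w"
  have x0: "l z = P z \<bullet> x0" for z
  proof -
    have "(P z, l z) \<in> W" unfolding W_def using closure_subset by fastforce
    from m(2)[OF this] have "fst w \<bullet> P z + snd w * l z = 0" unfolding w_def[symmetric] inner_prod_def by simp
    then show ?thesis using s by (simp add: x0_def field_simps inner_commute)
  qed
  \<comment> \<open>Placing the representing vector in the closure of the range allows the bound to
    be tested on that vector itself, which yields its norm estimate.\<close>
  have V: "subspace (closure (range P))" "closed (closure (range P))"
    using linear_subspace_image[OF P subspace_UNIV] by (auto intro: subspace_closure)
  obtain x where x: "x \<in> closure (range P)" "\<And>y. y \<in> closure (range P) \<Longrightarrow> (x0 - x) \<bullet> y = 0"
    using closed_subspace_projection[OF V] by metis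
  have lx: "l z = P z \<bullet> x" for z
  proof -
    have "P z \<in> closure (range P)" using closure_subset by fastforce
    from x(2)[OF this] show ?thesis by (simp add: x0 inner_simps inner_commute)
  qed
  have "closed {w. (w \<bullet> x)\<^sup>2 \<le> M * (w \<bullet> w)}" by (intro closed_Collect_le continuous_intros)
  moreover have "range P \<subseteq> {w. (w \<bullet> x)\<^sup>2 \<le> M * (w \<bullet> w)}" using bd lx by auto
  ultimately have "closure (range P) \<subseteq> {w. (w \<bullet> x)\<^sup>2 \<le> M * (w \<bullet> w)}" by (rule closure_minimal[rotated])
  with x(1) have "(x \<bullet> x)\<^sup>2 \<le> M * (x \<bullet> x)" by blast
  then have xx: "(x \<bullet> x) * (x \<bullet> x) \<le> M * (x \<bullet> x)" by (simp only: power2_eq_square)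
  have "x \<bullet> x \<le> M \<or> x = 0"
    using xx by (metis inner_gt_zero_iff mult_le_cancel_right_pos)
  with M have "x \<bullet> x \<le> M" by auto
  with x(1) lx show ?thesis by (rule that)
qed

section \<open>Bounded positive operators and their square roots\<close>

definition posop :: "('h::real_inner \<Rightarrow>\<^sub>L 'h) \<Rightarrow> bool" where
  "posop X \<longleftrightarrow> (\<forall>x y. blinfun_apply X x \<bullet> y = x \<bullet> blinfun_apply X y) \<and> (\<forall>x. 0 \<le> blinfun_apply X x \<bullet> x)"

lemma posop_sym: "posop X \<Longrightarrow> blinfun_apply X x \<bullet> y = x \<bullet> blinfun_apply X y"
  and posop_nonneg: "posop X \<Longrightarrow> 0 \<le> blinfun_apply X x \<bullet> x"
  by (auto simp: posop_def)

lemma posop_cauchy_schwarz: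
  assumes "posop X"
  shows "(blinfun_apply X x \<bullet> y)\<^sup>2 \<le> (blinfun_apply X x \<bullet> x) * (blinfun_apply X y \<bullet> y)"
proof (rule nonneg_quadratic_discriminant)
  fix t
  have "0 \<le> blinfun_apply X (x + t *\<^sub>R y) \<bullet> (x + t *\<^sub>R y)" by (rule posop_nonneg[OF assms])
  then show "0 \<le> blinfun_apply X x \<bullet> x + 2 * (blinfun_apply X x \<bullet> y) * t + (blinfun_apply X y \<bullet> y) * t\<^sup>2"
    by (simp add: blinfun.bilinear_simps inner_simps power2_eq_square posop_sym[OF assms, of y x]
        inner_commute[of y "blinfun_apply X x"] algebra_simps)
qed

lemma posop_eq_0:
  assumes "posop X" "blinfun_apply X x \<bullet> x = 0"
  shows "blinfun_apply X x = 0"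
  using posop_cauchy_schwarz[OF assms(1), of x "blinfun_apply X x"] assms(2) by simp

text \<open>Cauchy-Schwarz for the form of \<open>X\<close>, applied to x and Xx, bounds |Xx|^4 by
  the product of the forms at x and at Xx. A bound on the form thereby becomes a bound on the
  operator norm.\<close>

lemma posop_norm_le_1:
  assumes X: "posop X" "\<And>x. blinfun_apply X x \<bullet> x \<le> x \<bullet> x"
  shows "norm X \<le> 1"
proof (rule norm_blinfun_bound)
  fix x
  let ?y = "blinfun_apply X x"
  have "(?y \<bullet> ?y)\<^sup>2 \<le> (?y \<bullet> x) * (blinfun_apply X ?y \<bullet> ?y)" by (rule posop_cauchy_schwarz[OF X(1)])
  also have "\<dots> \<le> (x \<bullet> x) * (?y \<bullet> ?y)"
    by (intro mult_mono X(2) posop_nonneg[OF X(1)]) auto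
  finally have "(?y \<bullet> ?y) * (?y \<bullet> ?y) \<le> (x \<bullet> x) * (?y \<bullet> ?y)" by (simp add: power2_eq_square)
  then have "?y \<bullet> ?y \<le> x \<bullet> x" by (metis inner_ge_zero inner_gt_zero_iff mult_le_cancel_right_pos inner_eq_zero_iff)
  then show "norm ?y \<le> 1 * norm x" by (simp add: norm_le)
qed simp

text \<open>The iteration $Y \mapsto (V + Y^2)/2$ tends to $1 - \sqrt{1 - V}$ for $0 \le V \le 1$; its increments are
  dominated in norm by those of the scalar iteration with $V = 1$, so it converges in operator norm.\<close>

primrec sqrt_iter :: "('h::real_normed_vector \<Rightarrow>\<^sub>L 'h) \<Rightarrow> nat \<Rightarrow> 'h \<Rightarrow>\<^sub>L 'h" where
  "sqrt_iter X 0 = 0"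
| "sqrt_iter X (Suc n) = (1/2) *\<^sub>R (X + (sqrt_iter X n o\<^sub>L sqrt_iter X n))"

primrec sqrt_majorant :: "nat \<Rightarrow> real" where
  "sqrt_majorant 0 = 0"
| "sqrt_majorant (Suc n) = (1 + (sqrt_majorant n)\<^sup>2) / 2"

lemma sqrt_majorant_bounds: "0 \<le> sqrt_majorant n" "sqrt_majorant n \<le> 1"
proof -
  have "0 \<le> sqrt_majorant n \<and> sqrt_majorant n \<le> 1"
    by (induction n) (auto simp: power_le_one)
  then show "0 \<le> sqrt_majorant n" "sqrt_majorant n \<le> 1" by auto
qed

lemma sqrt_majorant_mono: "sqrt_majorant n \<le> sqrt_majorant (Suc n)"
proof -
  have "0 \<le> (1 - sqrt_majorant n)\<^sup>2" by simp
  then show ?thesis by (simp add: power2_eq_square algebra_simps)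
qed

lemma sqrt_iter_commute:
  assumes "\<And>x. blinfun_apply Z (blinfun_apply X x) = blinfun_apply X (blinfun_apply Z x)"
  shows "blinfun_apply Z (blinfun_apply (sqrt_iter X n) x) = blinfun_apply (sqrt_iter X n) (blinfun_apply Z x)"
  by (induction n arbitrary: x) (simp_all add: blinfun.bilinear_simps assms)

lemma sqrt_iter_norm:
  assumes "norm X \<le> 1"
  shows "norm (sqrt_iter X n) \<le> sqrt_majorant n"
proof (induction n)
  case (Suc n)
  have "norm (sqrt_iter X n o\<^sub>L sqrt_iter X n) \<le> norm (sqrt_iter X n) * norm (sqrt_iter X n)"
    by (rule norm_blinfun_compose)
  also have "\<dots> \<le> sqrt_majorant n * sqrt_majorant n" using Suc by (intro mult_mono) (auto simp: sqrt_majorant_bounds)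
  finally have "norm (sqrt_iter X n o\<^sub>L sqrt_iter X n) \<le> (sqrt_majorant n)\<^sup>2" by (simp add: power2_eq_square)
  with assms norm_triangle_ineq[of X "sqrt_iter X n o\<^sub>L sqrt_iter X n"] show ?case by simp
qed simp

text \<open>The iterates commute, so the difference of consecutive squares factors as sum times
  difference. The scalar majorant satisfies the same recursion with equality, which lets the
  induction close.\<close>

lemma sqrt_iter_diff:
  assumes "norm X \<le> 1"
  shows "norm (sqrt_iter X (Suc n) - sqrt_iter X n) \<le> sqrt_majorant (Suc n) - sqrt_majorant n"
proof (induction n)
  case 0
  show ?case using assms by simp
next
  case (Suc n)
  let ?Y = "sqrt_iter X (Suc n)" and ?Z = "sqrt_iter X n"
  have com: "blinfun_apply ?Y (blinfun_apply ?Z x) = blinfun_apply ?Z (blinfun_apply ?Y x)" for x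
    by (rule sqrt_iter_commute[symmetric]) (rule sqrt_iter_commute[symmetric], simp)
  have "sqrt_iter X (Suc (Suc n)) - ?Y = (1/2) *\<^sub>R ((?Y + ?Z) o\<^sub>L (?Y - ?Z))"
  proof (rule blinfun_eqI)
    fix x
    have "2 *\<^sub>R blinfun_apply (sqrt_iter X (Suc (Suc n))) x = blinfun_apply X x + blinfun_apply ?Y (blinfun_apply ?Y x)"
      by (subst sqrt_iter.simps(2)) (simp add: blinfun.bilinear_simps del: sqrt_iter.simps)
    moreover have "2 *\<^sub>R blinfun_apply ?Y x = blinfun_apply X x + blinfun_apply ?Z (blinfun_apply ?Z x)"
      by (subst sqrt_iter.simps(2)) (simp add: blinfun.bilinear_simps del: sqrt_iter.simps)
    ultimately have "2 *\<^sub>R (blinfun_apply (sqrt_iter X (Suc (Suc n))) x - blinfun_apply ?Y x)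
        = blinfun_apply ?Y (blinfun_apply ?Y x) - blinfun_apply ?Z (blinfun_apply ?Z x)"
      unfolding scaleR_diff_right by (simp del: sqrt_iter.simps)
    also have "\<dots> = blinfun_apply ((?Y + ?Z) o\<^sub>L (?Y - ?Z)) x"
      by (simp add: blinfun.bilinear_simps com del: sqrt_iter.simps)
    finally have "(1/2) *\<^sub>R (2 *\<^sub>R (blinfun_apply (sqrt_iter X (Suc (Suc n))) x - blinfun_apply ?Y x))
      = (1/2) *\<^sub>R blinfun_apply ((?Y + ?Z) o\<^sub>L (?Y - ?Z)) x" by (rule arg_cong)
    then show "blinfun_apply (sqrt_iter X (Suc (Suc n)) - ?Y) x = blinfun_apply ((1/2) *\<^sub>R ((?Y + ?Z) o\<^sub>L (?Y - ?Z))) x"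
      by (simp add: blinfun.bilinear_simps del: sqrt_iter.simps)
  qed
  then have "norm (sqrt_iter X (Suc (Suc n)) - ?Y) = (1/2) * norm ((?Y + ?Z) o\<^sub>L (?Y - ?Z))" by simp
  also have "\<dots> \<le> (1/2) * (norm (?Y + ?Z) * norm (?Y - ?Z))"
    by (intro mult_left_mono norm_blinfun_compose) auto
  also have "\<dots> \<le> (1/2) * ((sqrt_majorant (Suc n) + sqrt_majorant n) * (sqrt_majorant (Suc n) - sqrt_majorant n))"
  proof -
    have "norm (?Y + ?Z) \<le> sqrt_majorant (Suc n) + sqrt_majorant n"
      using norm_triangle_ineq[of ?Y ?Z] sqrt_iter_norm[OF assms, of "Suc n"] sqrt_iter_norm[OF assms, of n] by linarith
    then show ?thesis using Suc by (intro mult_left_mono mult_mono) (auto simp: sqrt_majorant_bounds intro: add_nonneg_nonneg)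
  qed
  also have "\<dots> = sqrt_majorant (Suc (Suc n)) - sqrt_majorant (Suc n)"
    by (simp add: power2_eq_square algebra_simps add_divide_distrib diff_divide_distrib)
  finally show ?case .
qed

lemma sqrt_iter_diff_le:
  assumes "norm X \<le> 1" "m \<le> n"
  shows "norm (sqrt_iter X n - sqrt_iter X m) \<le> sqrt_majorant n - sqrt_majorant m"
  using assms(2)
proof (induction n rule: dec_induct)
  case (step n)
  have "sqrt_iter X (Suc n) - sqrt_iter X m = (sqrt_iter X (Suc n) - sqrt_iter X n) + (sqrt_iter X n - sqrt_iter X m)" by simp
  then have "norm (sqrt_iter X (Suc n) - sqrt_iter X m) \<le> norm (sqrt_iter X (Suc n) - sqrt_iter X n) + norm (sqrt_iter X n - sqrt_iter X m)"
    by (metis norm_triangle_ineq)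
  with sqrt_iter_diff[OF assms(1), of n] step.IH show ?case by linarith
qed simp

definition blinfun_commutes :: "('h::real_normed_vector \<Rightarrow>\<^sub>L 'h) \<Rightarrow> ('h \<Rightarrow>\<^sub>L 'h) \<Rightarrow> bool" where
  "blinfun_commutes Z X \<longleftrightarrow> (\<forall>x. blinfun_apply Z (blinfun_apply X x) = blinfun_apply X (blinfun_apply Z x))"

text \<open>The iteration is run on V = 1 - X, and the root is 1 minus its limit. The commutation
  clause passes from the iterates to the limit; it is indispensable later, since uniqueness of roots
  and positivity of products are only available for commuting operators.\<close>

lemma posop_sqrt_exists:
  fixes X :: "'h::{real_inner,banach} \<Rightarrow>\<^sub>L 'h"
  assumes X: "posop X" "\<And>x. blinfun_apply X x \<bullet> x \<le> x \<bullet> x"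
  obtains B where "posop B" "\<And>x. blinfun_apply B (blinfun_apply B x) = blinfun_apply X x"
    "\<And>Z. blinfun_commutes Z X \<Longrightarrow> blinfun_commutes Z B"
proof -
  define V where "V = id_blinfun - X"
  have Vx: "blinfun_apply V x = x - blinfun_apply X x" for x by (simp add: V_def blinfun.bilinear_simps)
  have V: "posop V" unfolding posop_def Vx using X by (auto simp: inner_simps posop_sym[OF X(1)])
  have nV: "norm V \<le> 1"
    by (rule posop_norm_le_1[OF V]) (simp add: Vx inner_simps posop_nonneg[OF X(1)])
  have "incseq sqrt_majorant" by (rule incseq_SucI) (rule sqrt_majorant_mono)
  then have "convergent sqrt_majorant"
    by (intro Bseq_monoseq_convergent BseqI'[of _ 1]) (auto simp: sqrt_majorant_bounds monoseq_iff)
  then have Cm: "Cauchy sqrt_majorant" by (rule convergent_Cauchy)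
  have "Cauchy (sqrt_iter V)"
  proof (rule CauchyI)
    fix e :: real assume "0 < e"
    from CauchyD[OF Cm this] obtain M where M: "\<forall>m\<ge>M. \<forall>n\<ge>M. norm (sqrt_majorant m - sqrt_majorant n) < e" by blast
    have *: "norm (sqrt_iter V n - sqrt_iter V m) < e" if "M \<le> m" "m \<le> n" for m n
    proof -
      have "norm (sqrt_majorant n - sqrt_majorant m) < e" using M that by (meson order_trans)
      with sqrt_iter_diff_le[OF nV that(2)] show ?thesis by simp
    qed
    show "\<exists>M. \<forall>m\<ge>M. \<forall>n\<ge>M. norm (sqrt_iter V m - sqrt_iter V n) < e"
      using * by (metis nle_le norm_minus_commute)
  qed
  then obtain Y where Y: "sqrt_iter V \<longlonglongrightarrow> Y" by (auto simp: Cauchy_convergent_iff convergent_def)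
  have Yx: "(\<lambda>n. blinfun_apply (sqrt_iter V n) x) \<longlonglongrightarrow> blinfun_apply Y x" for x
    by (intro tendsto_intros Y)
  have sym: "blinfun_apply (sqrt_iter V n) x \<bullet> y = x \<bullet> blinfun_apply (sqrt_iter V n) y" for n x y
    by (induction n arbitrary: x y) (simp_all add: blinfun.bilinear_simps inner_simps posop_sym[OF V])
  have symY: "blinfun_apply Y x \<bullet> y = x \<bullet> blinfun_apply Y y" for x y
    by (rule LIMSEQ_unique[OF tendsto_inner[OF Yx tendsto_const]]) (simp add: sym tendsto_inner[OF tendsto_const Yx])
  have nY: "norm Y \<le> 1"
    by (rule LIMSEQ_le_const2[OF tendsto_norm[OF Y]]) (meson sqrt_iter_norm[OF nV] sqrt_majorant_bounds order_trans)
  have "(\<lambda>n. sqrt_iter V (Suc n)) \<longlonglongrightarrow> (1/2) *\<^sub>R (V + (Y o\<^sub>L Y))"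
    unfolding sqrt_iter.simps
    by (intro tendsto_intros bounded_bilinear.tendsto[OF bounded_bilinear_blinfun_compose] Y)
  with LIMSEQ_Suc[OF Y] have fixY: "Y = (1/2) *\<^sub>R (V + (Y o\<^sub>L Y))" by (rule LIMSEQ_unique)
  have YY: "blinfun_apply Y (blinfun_apply Y x) = 2 *\<^sub>R blinfun_apply Y x - blinfun_apply V x" for x
  proof -
    have "blinfun_apply Y x = (1/2) *\<^sub>R (blinfun_apply V x + blinfun_apply Y (blinfun_apply Y x))"
      by (subst fixY) (simp add: blinfun.bilinear_simps)
    from arg_cong[OF this, of "scaleR 2"]
    have "2 *\<^sub>R blinfun_apply Y x = blinfun_apply V x + blinfun_apply Y (blinfun_apply Y x)"
      by (simp only: scaleR_scaleR) simp
    then show ?thesis by simp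
  qed
  define B where "B = id_blinfun - Y"
  have Bx: "blinfun_apply B x = x - blinfun_apply Y x" for x by (simp add: B_def blinfun.bilinear_simps)
  show ?thesis
  proof (rule that)
    show "posop B" unfolding posop_def
    proof (intro conjI allI)
      show "blinfun_apply B x \<bullet> y = x \<bullet> blinfun_apply B y" for x y by (simp add: Bx inner_simps symY)
      show "0 \<le> blinfun_apply B x \<bullet> x" for x
      proof -
        \<comment> \<open>Positivity of 1 - Y comes from the norm bound on Y, itself inherited from
          the majorant, which never exceeds 1.\<close>
        have "blinfun_apply Y x \<bullet> x \<le> norm (blinfun_apply Y x) * norm x" by (rule norm_cauchy_schwarz)
        also have "\<dots> \<le> (1 * norm x) * norm x"
          by (intro mult_right_mono order_trans[OF norm_blinfun[of Y x]] nY) auto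
        finally show ?thesis by (simp add: Bx inner_simps flip: power2_norm_eq_inner power2_eq_square)
      qed
    qed
    show "blinfun_apply B (blinfun_apply B x) = blinfun_apply X x" for x
      by (simp add: Bx blinfun.bilinear_simps YY Vx scaleR_2)
    fix Z :: "'h \<Rightarrow>\<^sub>L 'h"
    assume Z: "blinfun_commutes Z X"
    have ZV: "blinfun_apply Z (blinfun_apply V x) = blinfun_apply V (blinfun_apply Z x)" for x
      using Z by (simp add: Vx blinfun.bilinear_simps blinfun_commutes_def)
    have "blinfun_apply Z (blinfun_apply Y x) = blinfun_apply Y (blinfun_apply Z x)" for x
    proof (rule LIMSEQ_unique)
      show "(\<lambda>n. blinfun_apply Z (blinfun_apply (sqrt_iter V n) x)) \<longlonglongrightarrow> blinfun_apply Z (blinfun_apply Y x)"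
        by (intro tendsto_intros Yx)
      show "(\<lambda>n. blinfun_apply Z (blinfun_apply (sqrt_iter V n) x)) \<longlonglongrightarrow> blinfun_apply Y (blinfun_apply Z x)"
        by (simp add: sqrt_iter_commute[OF ZV] Yx)
    qed
    then show "blinfun_commutes Z B"
      by (simp add: Bx blinfun.bilinear_simps blinfun_commutes_def)
  qed
qed

text \<open>For y = (P - Q)x commutation gives (P + Q)y = 0. Both forms are nonnegative, so each
  vanishes at y, hence Py = Qy = 0, and moving P - Q to the other side of the inner product of y
  with itself gives y = 0.\<close>

lemma posop_sqrt_unique:
  assumes P: "posop P" and Q: "posop Q"
    and com: "\<And>x. blinfun_apply P (blinfun_apply Q x) = blinfun_apply Q (blinfun_apply P x)"
    and sq: "\<And>x. blinfun_apply P (blinfun_apply P x) = blinfun_apply Q (blinfun_apply Q x)"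
  shows "P = Q"
proof (rule blinfun_eqI)
  fix x
  define y where "y = blinfun_apply P x - blinfun_apply Q x"
  have "blinfun_apply P y + blinfun_apply Q y = 0" by (simp add: y_def blinfun.bilinear_simps com sq)
  then have "blinfun_apply P y \<bullet> y + blinfun_apply Q y \<bullet> y = 0" by (metis inner_add_left inner_zero_left)
  then have "blinfun_apply P y \<bullet> y = 0" "blinfun_apply Q y \<bullet> y = 0"
    using posop_nonneg[OF P, of y] posop_nonneg[OF Q, of y] by linarith+
  then have "blinfun_apply P y = 0" "blinfun_apply Q y = 0" using posop_eq_0 P Q by blast+
  moreover have "y \<bullet> y = x \<bullet> (blinfun_apply P y - blinfun_apply Q y)"
    by (subst (1) y_def) (simp add: inner_simps posop_sym[OF P] posop_sym[OF Q])
  ultimately show "blinfun_apply P x = blinfun_apply Q x" by (simp add: y_def)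
qed

text \<open>With D the root of \<open>P\<close>, which commutes with \<open>Q\<close>, the form of
  PQ at x is the form of \<open>Q\<close> at Dx.\<close>

lemma posop_compose:
  fixes P :: "'h::{real_inner,banach} \<Rightarrow>\<^sub>L 'h"
  assumes P: "posop P" "\<And>x. blinfun_apply P x \<bullet> x \<le> x \<bullet> x" and Q: "posop Q"
    and com: "\<And>x. blinfun_apply P (blinfun_apply Q x) = blinfun_apply Q (blinfun_apply P x)"
  shows "posop (P o\<^sub>L Q)"
proof -
  obtain D where D: "posop D" "\<And>x. blinfun_apply D (blinfun_apply D x) = blinfun_apply P x"
    "\<And>Z. blinfun_commutes Z P \<Longrightarrow> blinfun_commutes Z D"
    using posop_sqrt_exists[OF P] by metis
  have DQ: "blinfun_apply Q (blinfun_apply D x) = blinfun_apply D (blinfun_apply Q x)" for x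
    using D(3)[of Q] by (simp add: com blinfun_commutes_def)
  have "blinfun_apply P (blinfun_apply Q x) \<bullet> x = blinfun_apply Q (blinfun_apply D x) \<bullet> blinfun_apply D x" for x
    unfolding D(2)[symmetric] by (simp add: DQ posop_sym[OF D(1)])
  moreover have "blinfun_apply P (blinfun_apply Q x) \<bullet> y = x \<bullet> blinfun_apply P (blinfun_apply Q y)" for x y
    by (metis posop_sym[OF P(1)] posop_sym[OF Q] com)
  ultimately show ?thesis unfolding posop_def using posop_nonneg[OF Q] by simp
qed


section \<open>Self-adjoint linear relations and their resolvents\<close>

definition adjr :: "('h::real_inner \<times> 'h) set \<Rightarrow> ('h \<times> 'h) set" where
  "adjr G = {(u, v). \<forall>(f, g)\<in>G. g \<bullet> u = f \<bullet> v}"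

definition nonneg_rel :: "('h::real_inner \<times> 'h) set \<Rightarrow> bool" where
  "nonneg_rel G \<longleftrightarrow> (\<forall>(f, g)\<in>G. 0 \<le> g \<bullet> f)"

lemma adjr_iff: "(u, v) \<in> adjr G \<longleftrightarrow> (\<forall>f g. (f, g) \<in> G \<longrightarrow> g \<bullet> u = f \<bullet> v)"
  by (auto simp: adjr_def)

lemma adjr_antimono: "G \<subseteq> H \<Longrightarrow> adjr H \<subseteq> adjr G"
  by (auto simp: adjr_def)

lemma subspace_adjr: "subspace (adjr G)"
  unfolding subspace_def by (auto simp: adjr_iff inner_simps zero_prod_def)

lemma closed_adjr: "closed (adjr G)"
proof -
  have "adjr G = (\<Inter>w\<in>G. {z. snd w \<bullet> fst z = fst w \<bullet> snd z})" by (fastforce simp: adjr_def)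
  moreover have "closed (\<Inter>w\<in>G. {z. snd w \<bullet> fst z = fst w \<bullet> snd z})"
    by (intro closed_INT ballI closed_Collect_eq continuous_intros)
  ultimately show ?thesis by simp
qed

text \<open>No density of the domain is demanded, so pairs (0, k) with nonzero k are allowed. This
  generality is needed because the weighted space will only be a closed subspace of the ambient
  Hilbert space.\<close>

locale sa_rel =
  fixes A :: "('h::{real_inner,banach} \<times> 'h) set"
  assumes sa: "A = adjr A"
begin

lemma subsp: "subspace A" by (subst sa) (rule subspace_adjr)

lemma clos: "closed A" by (subst sa) (rule closed_adjr)

lemma sym: "(f, g) \<in> A \<Longrightarrow> (f', g') \<in> A \<Longrightarrow> g \<bullet> f' = f \<bullet> g'"
  using sa by (metis adjr_iff)

lemma memI: "(\<And>f g. (f, g) \<in> A \<Longrightarrow> g \<bullet> u = f \<bullet> v) \<Longrightarrow> (u, v) \<in> A"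
  by (subst sa) (simp add: adjr_iff)

lemma add_mem: "(f, g) \<in> A \<Longrightarrow> (f', g') \<in> A \<Longrightarrow> (f + f', g + g') \<in> A"
  using subspace_add[OF subsp] by fastforce

lemma diff_mem: "(f, g) \<in> A \<Longrightarrow> (f', g') \<in> A \<Longrightarrow> (f - f', g - g') \<in> A"
  using subspace_diff[OF subsp] by fastforce

lemma scale_mem: "(f, g) \<in> A \<Longrightarrow> (c *\<^sub>R f, c *\<^sub>R g) \<in> A"
  using subspace_scale[OF subsp] by fastforce

text \<open>Coercivity bounds f by g, so the range is closed. A vector orthogonal to the range lies
  in the kernel by self-adjointness, and coercivity makes the kernel trivial.\<close>

lemma surj_if_coercive:
  assumes c: "c > 0" "\<And>f g. (f, g) \<in> A \<Longrightarrow> c * (f \<bullet> f) \<le> g \<bullet> f"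
  obtains f where "(f, v) \<in> A"
proof -
  have bd: "c * norm f \<le> norm g" if "(f, g) \<in> A" for f g
  proof (cases "f = 0")
    case False
    have "(c * norm f) * norm f \<le> norm g * norm f"
      using c(2)[OF that] norm_cauchy_schwarz[of g f]
      by (simp add: power2_norm_eq_inner[symmetric] power2_eq_square)
    with False show ?thesis by simp
  qed simp
  have "closed (snd ` A)"
    unfolding closed_sequential_limits
  proof (intro allI impI, elim conjE)
    fix y l assume y: "\<forall>n. y n \<in> snd ` A" "y \<longlonglongrightarrow> l"
    from y(1) have "\<forall>n. \<exists>f. (f, y n) \<in> A" by force
    then obtain f where f: "\<And>n. (f n, y n) \<in> A" by metis
    have "Cauchy f"
    proof (rule CauchyI)
      fix e :: real assume "0 < e"
      then have "0 < c * e" using c(1) by simp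
      from CauchyD[OF LIMSEQ_imp_Cauchy[OF y(2)] this]
      obtain M where M: "\<forall>m\<ge>M. \<forall>n\<ge>M. norm (y m - y n) < c * e" by blast
      have "norm (f m - f n) < e" if "m \<ge> M" "n \<ge> M" for m n
      proof -
        have "c * norm (f m - f n) < c * e"
          using bd[OF diff_mem[OF f[of m] f[of n]]] M that by (meson le_less_trans)
        with c(1) show ?thesis by simp
      qed
      then show "\<exists>M. \<forall>m\<ge>M. \<forall>n\<ge>M. norm (f m - f n) < e" by blast
    qed
    then obtain k where "f \<longlonglongrightarrow> k" by (auto simp: Cauchy_convergent_iff convergent_def)
    then have "(\<lambda>n. (f n, y n)) \<longlonglongrightarrow> (k, l)" using y(2) by (intro tendsto_intros)
    with clos f have "(k, l) \<in> A" by (meson closed_sequentially)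
    then show "l \<in> snd ` A" by force
  qed
  moreover have "subspace (snd ` A)"
    by (intro linear_subspace_image subsp bounded_linear.linear bounded_linear_snd)
  ultimately obtain m where m: "m \<in> snd ` A" "\<And>y. y \<in> snd ` A \<Longrightarrow> (v - m) \<bullet> y = 0"
    using closed_subspace_projection by metis
  have "(v - m, 0) \<in> A"
  proof (rule memI)
    fix f g assume "(f, g) \<in> A"
    then have "(v - m) \<bullet> g = 0" using m(2) by force
    then show "g \<bullet> (v - m) = f \<bullet> 0" by (simp add: inner_commute)
  qed
  from c(2)[OF this] c(1) have "v = m"
    by (metis inner_eq_zero_iff inner_ge_zero inner_zero_left mult_le_0_iff order_antisym_conv not_less right_minus_eq)
  with m(1) that show ?thesis by force
qed

end

locale nonneg_sa_rel = sa_rel A for A :: "('h::{real_inner,banach} \<times> 'h) set" +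
  assumes nonneg: "nonneg_rel A"
begin

lemma nonnegD: "(f, g) \<in> A \<Longrightarrow> 0 \<le> g \<bullet> f"
  using nonneg by (auto simp: nonneg_rel_def)

text \<open>A + 1 is self-adjoint and coercive with constant 1, hence onto; \<open>R\<close> is its
  inverse. The parametrisation of \<open>A\<close> by \<open>R\<close> stays valid for multivalued
  relations, the multivalued part being the kernel of \<open>R\<close>.\<close>

lemma resolvent_exists:
  obtains R :: "'h \<Rightarrow>\<^sub>L 'h" where "A = range (\<lambda>x. (blinfun_apply R x, x - blinfun_apply R x))"
    "posop R" "posop (id_blinfun - R)"
proof -
  define A1 where "A1 = {(f, g + f) | f g. (f, g) \<in> A}"
  have A1: "(f, v) \<in> A1 \<longleftrightarrow> (f, v - f) \<in> A" for f v
    unfolding A1_def by force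
  interpret A1: sa_rel A1
  proof
    show "A1 = adjr A1"
    proof (intro set_eqI iffI; clarify)
      fix u v assume uv: "(u, v) \<in> A1"
      show "(u, v) \<in> adjr A1" unfolding adjr_iff
      proof (intro allI impI)
        fix f g assume "(f, g) \<in> A1"
        with uv sym[of f "g - f" u "v - u"] show "g \<bullet> u = f \<bullet> v" by (simp add: A1 inner_simps)
      qed
    next
      fix u v assume uv: "(u, v) \<in> adjr A1"
      have "(u, v - u) \<in> A"
      proof (rule memI)
        fix f g assume "(f, g) \<in> A"
        then have "(f, g + f) \<in> A1" by (simp add: A1)
        with uv show "g \<bullet> u = f \<bullet> (v - u)" unfolding adjr_iff by (fastforce simp: inner_simps)
      qed
      then show "(u, v) \<in> A1" by (simp add: A1)
    qed
  qed
  have "\<exists>f. (f, v - f) \<in> A" for v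
    using A1.surj_if_coercive[of 1 v] nonnegD A1 by (fastforce simp: inner_simps)
  then obtain r where r: "\<And>v. (r v, v - r v) \<in> A" by metis
  \<comment> \<open>The difference d of two candidates satisfies (d, -d) in \<open>A\<close>, and
    nonnegativity then gives d = 0.\<close>
  have uniq: "f = f'" if "(f, v - f) \<in> A" "(f', v - f') \<in> A" for f f' v
  proof -
    from diff_mem[OF that] have "(f - f', - (f - f')) \<in> A" by simp
    from nonnegD[OF this] have "(f - f') \<bullet> (f - f') \<le> 0" by (simp only: inner_minus_left)
    then show ?thesis by (metis inner_eq_zero_iff inner_ge_zero order_antisym right_minus_eq)
  qed
  have nr: "r v \<bullet> r v \<le> v \<bullet> r v" for v
    using nonnegD[OF r[of v]] by (simp add: inner_simps)
  have bl: "bounded_linear r"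
  proof (rule bounded_linear_intro[of _ 1])
    show "r (x + y) = r x + r y" for x y
      by (rule uniq[OF r]) (use add_mem[OF r[of x] r[of y]] in \<open>simp add: algebra_simps\<close>)
    show "r (c *\<^sub>R x) = c *\<^sub>R r x" for c x
      by (rule uniq[OF r]) (use scale_mem[OF r[of x], of c] in \<open>simp add: algebra_simps\<close>)
    show "norm (r x) \<le> norm x * 1" for x
    proof (cases "r x = 0")
      case False
      have "norm (r x) * norm (r x) \<le> norm x * norm (r x)"
        using nr[of x] norm_cauchy_schwarz[of x "r x"] by (simp add: power2_norm_eq_inner[symmetric] power2_eq_square)
      with False show ?thesis by simp
    qed simp
  qed
  define R where "R = Blinfun r"
  have R: "blinfun_apply R = r" unfolding R_def by (rule bounded_linear_Blinfun_apply[OF bl])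
  have rs: "r x \<bullet> y = x \<bullet> r y" for x y
    using sym[OF r[of x] r[of y]] by (simp add: inner_simps)
  show ?thesis
  proof (rule that)
    show "A = range (\<lambda>x. (blinfun_apply R x, x - blinfun_apply R x))"
    proof (intro set_eqI iffI; clarify)
      fix u v assume uv: "(u, v) \<in> A"
      then have "(u, (u + v) - u) \<in> A" by simp
      then have "r (u + v) = u" by (rule uniq[OF r])
      then have "(u, v) = (r (u + v), (u + v) - r (u + v))" by simp
      then show "(u, v) \<in> range (\<lambda>x. (blinfun_apply R x, x - blinfun_apply R x))" unfolding R by blast
    next
      fix u v x show "(blinfun_apply R x, x - blinfun_apply R x) \<in> A" using r by (simp add: R)
    qed
    show "posop R" unfolding posop_def R using rs nr by (metis inner_commute inner_ge_zero order_trans)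
    show "posop (id_blinfun - R)" unfolding posop_def
    proof (intro conjI allI)
      fix x y
      show "blinfun_apply (id_blinfun - R) x \<bullet> y = x \<bullet> blinfun_apply (id_blinfun - R) y"
        by (simp add: R blinfun.bilinear_simps inner_simps rs)
      have "(x - r x) \<bullet> (x - r x) \<ge> 0" by simp
      then show "0 \<le> blinfun_apply (id_blinfun - R) x \<bullet> x"
        using nr[of x] by (simp add: R blinfun.bilinear_simps inner_simps inner_commute)
    qed
  qed
qed


lemma sqrt_data:
  obtains R B C :: "'h \<Rightarrow>\<^sub>L 'h" where
    "A = range (\<lambda>x. (blinfun_apply R x, x - blinfun_apply R x))" "posop R" "posop B" "posop C" "posop (B o\<^sub>L C)"
    "\<And>x. blinfun_apply B (blinfun_apply B x) = blinfun_apply R x"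
    "\<And>x. blinfun_apply C (blinfun_apply C x) = x - blinfun_apply R x"
    "\<And>x. blinfun_apply C (blinfun_apply B x) = blinfun_apply B (blinfun_apply C x)"
    "\<And>Z. blinfun_commutes Z R \<Longrightarrow> blinfun_commutes Z B \<and> blinfun_commutes Z C"
proof -
  obtain R where A: "A = range (\<lambda>x. (blinfun_apply R x, x - blinfun_apply R x))"
    and R: "posop R" "posop (id_blinfun - R)" by (rule resolvent_exists)
  have Q: "blinfun_apply (id_blinfun - R) x = x - blinfun_apply R x" for x by (simp add: blinfun.bilinear_simps)
  have R1: "blinfun_apply R x \<bullet> x \<le> x \<bullet> x" and Q1: "blinfun_apply (id_blinfun - R) x \<bullet> x \<le> x \<bullet> x" for x
    using posop_nonneg[OF R(2), of x] posop_nonneg[OF R(1), of x] unfolding Q by (simp_all add: inner_simps)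
  obtain B where B: "posop B" "\<And>x. blinfun_apply B (blinfun_apply B x) = blinfun_apply R x"
    "\<And>Z. blinfun_commutes Z R \<Longrightarrow> blinfun_commutes Z B"
    using posop_sqrt_exists[OF R(1) R1] by metis
  obtain C where C: "posop C" "\<And>x. blinfun_apply C (blinfun_apply C x) = blinfun_apply (id_blinfun - R) x"
    "\<And>Z. blinfun_commutes Z (id_blinfun - R) \<Longrightarrow> blinfun_commutes Z C"
    using posop_sqrt_exists[OF R(2) Q1] by metis
  have CZ: "blinfun_commutes Z C" if "blinfun_commutes Z R" for Z
    by (rule C(3)) (use that in \<open>simp add: Q blinfun.bilinear_simps blinfun_commutes_def\<close>)
  have "blinfun_commutes B C"
    by (rule CZ) (simp add: blinfun_commutes_def B(2)[symmetric])
  then have CB: "blinfun_apply C (blinfun_apply B x) = blinfun_apply B (blinfun_apply C x)" for x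
    by (simp add: blinfun_commutes_def)
  \<comment> \<open>Expanding |Bx - x|^2 >= 0 bounds twice the form of \<open>B\<close> by |Bx|^2 +
    |x|^2, and |Bx|^2 is the form of \<open>R\<close>, at most |x|^2.\<close>
  have B1: "blinfun_apply B x \<bullet> x \<le> x \<bullet> x" for x
  proof -
    have "0 \<le> (blinfun_apply B x - x) \<bullet> (blinfun_apply B x - x)" by simp
    moreover have "blinfun_apply B x \<bullet> blinfun_apply B x \<le> x \<bullet> x"
      using R1[of x] B(2)[of x] posop_sym[OF B(1), of "blinfun_apply B x" x] by simp
    ultimately show ?thesis by (simp add: inner_simps inner_commute)
  qed
  have BC: "posop (B o\<^sub>L C)" by (rule posop_compose[OF B(1) B1 C(1)]) (simp add: CB)
  from A R(1) B(1) C(1) BC B(2) show ?thesis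
    by (rule that) (auto simp: C(2) Q CB intro!: B(3) CZ)
qed

end

text \<open>With $R = (1 + A)^{-1}$, $B = R^{1/2}$ and $C = (1 - R)^{1/2}$ the square root of $A$ is the range of
  $x \mapsto (Bx, Cx)$. If $T'$ is any root, $x \mapsto T' R x$ is positive, commutes with $R$ and squares to
  $R(1 - R)$, hence equals $BC$; this puts $(Bx, Cx)$ into $T'$.\<close>

definition is_sqrt_rel :: "('h::real_inner \<times> 'h) set \<Rightarrow> ('h \<times> 'h) set \<Rightarrow> bool" where
  "is_sqrt_rel A T \<longleftrightarrow> T = adjr T \<and> nonneg_rel T \<and> T O T = A"

context nonneg_sa_rel
begin

text \<open>The last clause describes domain and norm of the root using \<open>A\<close> alone. For
  g = Rx and h = x - Rx the product of h with g equals |BCx|^2, so the criterion says that x maps to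
  a functional bounded along BC; its Riesz vector is the value of the root at
  \<open>f\<close>.\<close>

lemma sqrt_rel_data:
  obtains T where "is_sqrt_rel A T" "\<And>T'. is_sqrt_rel A T' \<Longrightarrow> T' = T"
    "\<And>f M. 0 \<le> M \<Longrightarrow> (\<exists>y. (f, y) \<in> T \<and> y \<bullet> y \<le> M) \<longleftrightarrow> (\<forall>(g, h)\<in>A. (f \<bullet> h)\<^sup>2 \<le> M * (h \<bullet> g))"
proof -
  obtain R B C :: "'h \<Rightarrow>\<^sub>L 'h" where A: "A = range (\<lambda>x. (blinfun_apply R x, x - blinfun_apply R x))"
    and R: "posop R" and B: "posop B" and C: "posop C" and BCpos: "posop (B o\<^sub>L C)"
    and BB: "\<And>x. blinfun_apply B (blinfun_apply B x) = blinfun_apply R x"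
    and CC: "\<And>x. blinfun_apply C (blinfun_apply C x) = x - blinfun_apply R x"
    and CB: "\<And>x. blinfun_apply C (blinfun_apply B x) = blinfun_apply B (blinfun_apply C x)"
    and com: "\<And>Z. blinfun_commutes Z R \<Longrightarrow> blinfun_commutes Z B \<and> blinfun_commutes Z C"
    by (rule sqrt_data, rule that)
  note Bs = posop_sym[OF B] and Cs = posop_sym[OF C] and Rs = posop_sym[OF R]
  note bs = blinfun.bilinear_simps
  have Amem: "(u, v) \<in> A \<longleftrightarrow> blinfun_apply R (u + v) = u" for u v
  proof
    assume "(u, v) \<in> A" then show "blinfun_apply R (u + v) = u" unfolding A by auto
  next
    assume "blinfun_apply R (u + v) = u"
    then have "(u, v) = (blinfun_apply R (u + v), (u + v) - blinfun_apply R (u + v))" by simp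
    then show "(u, v) \<in> A" unfolding A by blast
  qed
  define T where "T = range (\<lambda>x. (blinfun_apply B x, blinfun_apply C x))"
  have adjT: "(u, v) \<in> adjr T \<longleftrightarrow> blinfun_apply C u = blinfun_apply B v" for u v
  proof -
    have "(u, v) \<in> adjr T \<longleftrightarrow> (\<forall>x. x \<bullet> blinfun_apply C u = x \<bullet> blinfun_apply B v)"
      unfolding adjr_def T_def by (simp add: Bs Cs)
    also have "\<dots> \<longleftrightarrow> blinfun_apply C u = blinfun_apply B v" by (rule vector_eq_ldot)
    finally show ?thesis .
  qed
  have memT: "(u, v) \<in> T" if "blinfun_apply C u = blinfun_apply B v" for u v
  proof -
    \<comment> \<open>Since B^2 + C^2 = 1, a preimage x of (u, v) = (Bx, Cx) can only be Bu +
      Cv.\<close>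
    let ?x = "blinfun_apply B u + blinfun_apply C v"
    have "blinfun_apply B ?x = u"
      by (simp add: bs BB CB[symmetric]) (simp add: that[symmetric] CC)
    moreover have "blinfun_apply C ?x = v"
      by (simp add: bs CC CB that BB)
    ultimately have "(u, v) = (blinfun_apply B ?x, blinfun_apply C ?x)" by simp
    then show ?thesis unfolding T_def by blast
  qed
  have Tadj: "T = adjr T"
  proof (intro set_eqI iffI; clarify)
    fix u v assume "(u, v) \<in> T" then show "(u, v) \<in> adjr T" unfolding adjT by (auto simp: T_def CB)
  next
    fix u v assume "(u, v) \<in> adjr T" then show "(u, v) \<in> T" unfolding adjT by (rule memT)
  qed
  have Tnn: "nonneg_rel T"
    using posop_nonneg[OF BCpos] by (auto simp: nonneg_rel_def T_def Bs)
  have TT: "T O T = A"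
  proof (intro set_eqI iffI; clarify)
    fix u v w assume "(u, v) \<in> T" "(v, w) \<in> T"
    then have uv: "blinfun_apply C u = blinfun_apply B v" and vw: "blinfun_apply C v = blinfun_apply B w"
      using Tadj adjT by auto
    have "blinfun_apply R (u + w) = blinfun_apply R u + blinfun_apply B (blinfun_apply B w)" by (simp add: bs BB)
    also have "\<dots> = blinfun_apply R u + blinfun_apply C (blinfun_apply C u)"
      unfolding vw[symmetric] uv by (simp add: CB)
    also have "\<dots> = u" by (simp add: CC)
    finally show "(u, w) \<in> A" unfolding Amem .
  next
    fix u w assume "(u, w) \<in> A"
    then obtain x where x: "u = blinfun_apply R x" "w = x - blinfun_apply R x" unfolding A by auto
    have "(u, blinfun_apply B (blinfun_apply C x)) \<in> T"
      by (rule memT) (simp add: x(1) BB[symmetric] CB)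
    moreover have "(blinfun_apply B (blinfun_apply C x), w) \<in> T"
      by (rule memT) (simp add: x(2) CC[symmetric] CB)
    ultimately show "(u, w) \<in> T O T" by blast
  qed
  have uniq: "T' = T" if T': "is_sqrt_rel A T'" for T'
  proof -
    interpret T': nonneg_sa_rel T' using T' by unfold_locales (auto simp: is_sqrt_rel_def)
    have TT': "T' O T' = A" using T' by (simp add: is_sqrt_rel_def)
    \<comment> \<open>For any root \<open>T'\<close> the vector z is the intermediate point between
      Rx and x - Rx, that is, \<open>T'\<close> applied to Rx.\<close>
    have "\<exists>z. (blinfun_apply R x, z) \<in> T' \<and> (z, x - blinfun_apply R x) \<in> T'" for x
    proof -
      have "(blinfun_apply R x, x - blinfun_apply R x) \<in> T' O T'" unfolding TT' Amem by simp
      then show ?thesis by blast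
    qed
    then obtain e where e: "\<And>x. (blinfun_apply R x, e x) \<in> T'" "\<And>x. (e x, x - blinfun_apply R x) \<in> T'" by metis
    \<comment> \<open>Two intermediate points differ by some d with both (0, d) and (d, 0) in
      \<open>T'\<close>; symmetry gives d . d = 0. This makes \<open>e\<close> linear without
      assuming \<open>T'\<close> single valued.\<close>
    have eI: "e x = z" if "(blinfun_apply R x, z) \<in> T'" "(z, x - blinfun_apply R x) \<in> T'" for x z
    proof -
      have "(0, e x - z) \<in> T'" "(e x - z, 0) \<in> T'"
        using T'.diff_mem[OF e(1)[of x] that(1)] T'.diff_mem[OF e(2)[of x] that(2)] by auto
      from T'.sym[OF this] show ?thesis by simp
    qed
    have bl: "bounded_linear e"
    proof (rule bounded_linear_intro[of _ 1])
      show "e (x + y) = e x + e y" for x y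
        by (rule eI) (use T'.add_mem[OF e(1)[of x] e(1)[of y]] T'.add_mem[OF e(2)[of x] e(2)[of y]] in \<open>simp_all add: bs algebra_simps\<close>)
      show "e (c *\<^sub>R x) = c *\<^sub>R e x" for c x
        by (rule eI) (use T'.scale_mem[OF e(1)[of x], of c] T'.scale_mem[OF e(2)[of x], of c] in \<open>simp_all add: bs algebra_simps\<close>)
      show "norm (e x) \<le> norm x * 1" for x
      proof -
        have "e x \<bullet> e x = blinfun_apply R x \<bullet> (x - blinfun_apply R x)"
          by (rule T'.sym[OF e])
        also have "\<dots> = blinfun_apply C (blinfun_apply C x) \<bullet> blinfun_apply R x" by (simp add: CC inner_commute)
        also have "\<dots> \<le> x \<bullet> x"
        proof -
          have "x \<bullet> x - blinfun_apply C (blinfun_apply C x) \<bullet> blinfun_apply R x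
            = blinfun_apply C (blinfun_apply C x) \<bullet> blinfun_apply C (blinfun_apply C x) + blinfun_apply R x \<bullet> x"
            by (simp add: CC inner_simps inner_commute)
          then show ?thesis using posop_nonneg[OF R, of x] by (smt (verit) inner_ge_zero)
        qed
        finally show ?thesis by (simp add: norm_le)
      qed
    qed
    define E where "E = Blinfun e"
    have E: "blinfun_apply E = e" unfolding E_def by (rule bounded_linear_Blinfun_apply[OF bl])
    have Epos: "posop E" unfolding posop_def E
    proof (intro conjI allI)
      fix x y
      show "e x \<bullet> y = x \<bullet> e y"
        using T'.sym[OF e(1)[of x] e(1)[of y]] T'.sym[OF e(2)[of x] e(2)[of y]] by (simp add: inner_simps)
      show "0 \<le> e x \<bullet> x"
        using T'.nonnegD[OF e(1)[of x]] T'.nonnegD[OF e(2)[of x]] by (simp add: inner_simps inner_commute)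
    qed
    have Re: "blinfun_apply R (e x) = e (blinfun_apply R x)"
      and ee: "e (e x) = blinfun_apply R x - blinfun_apply R (blinfun_apply R x)" for x
    proof -
      let ?y = "blinfun_apply R x"
      have 1: "(e ?y, ?y - blinfun_apply R ?y) \<in> T'" by (rule e(2))
      have 2: "(?y - blinfun_apply R ?y, e x - e ?y) \<in> T'" by (rule T'.diff_mem[OF e(1) e(1)])
      have "(e ?y, e x - e ?y) \<in> T' O T'" using 1 2 by (rule relcompI)
      then show R2: "blinfun_apply R (e x) = e ?y" unfolding TT' Amem by simp
      show "e (e x) = ?y - blinfun_apply R ?y" by (rule eI) (use 1 2 in \<open>simp_all add: R2\<close>)
    qed
    have EBC: "\<And>x. e (blinfun_apply B x) = blinfun_apply B (e x)" "\<And>x. e (blinfun_apply C x) = blinfun_apply C (e x)"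
      using com[of E] by (simp_all add: E Re blinfun_commutes_def)
    have "E = B o\<^sub>L C"
    proof (rule posop_sqrt_unique[OF Epos BCpos])
      show "blinfun_apply E (blinfun_apply (B o\<^sub>L C) x) = blinfun_apply (B o\<^sub>L C) (blinfun_apply E x)" for x
        by (simp add: E EBC)
      show "blinfun_apply E (blinfun_apply E x) = blinfun_apply (B o\<^sub>L C) (blinfun_apply (B o\<^sub>L C) x)" for x
        by (simp add: E ee CB BB CC bs)
    qed
    then have eBC: "e x = blinfun_apply B (blinfun_apply C x)" for x using E by (metis blinfun_apply_blinfun_compose)
    have RB: "blinfun_apply R (blinfun_apply B x) = blinfun_apply B (blinfun_apply R x)" for x by (simp add: BB[symmetric])
    have "T \<subseteq> T'"
    proof
      fix w assume "w \<in> T"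
      \<comment> \<open>(Bu, Cu) is the sum of (RBu, eBu) and (eCu, Cu - RCu), both of which lie in
        \<open>T'\<close> by the choice of \<open>e\<close>.\<close>
      then obtain u where u: "w = (blinfun_apply B u, blinfun_apply C u)" unfolding T_def by auto
      have 1: "blinfun_apply R (blinfun_apply B u) + e (blinfun_apply C u) = blinfun_apply B u"
        by (simp add: eBC CC bs RB)
      have 2: "e (blinfun_apply B u) + (blinfun_apply C u - blinfun_apply R (blinfun_apply C u)) = blinfun_apply C u"
        by (simp add: eBC CB BB)
      show "w \<in> T'" using T'.add_mem[OF e(1)[of "blinfun_apply B u"] e(2)[of "blinfun_apply C u"]]
        unfolding u 1 2 .
    qed
    \<comment> \<open>Passing to adjoints reverses the inclusion, and both relations equal their
      adjoints.\<close>
    moreover from adjr_antimono[OF this] have "T' \<subseteq> T" using Tadj T'.sa by simp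
    ultimately show "T' = T" by simp
  qed
  have form: "(\<exists>y. (f, y) \<in> T \<and> y \<bullet> y \<le> M) \<longleftrightarrow> (\<forall>(g, h)\<in>A. (f \<bullet> h)\<^sup>2 \<le> M * (h \<bullet> g))" if M: "0 \<le> M" for f M
  proof -
    let ?P = "\<lambda>z. blinfun_apply B (blinfun_apply C z)"
    have hg: "(x - blinfun_apply R x) \<bullet> blinfun_apply R x = ?P x \<bullet> ?P x" for x
    proof -
      have "(x - blinfun_apply R x) \<bullet> blinfun_apply R x
        = blinfun_apply C (blinfun_apply C x) \<bullet> blinfun_apply B (blinfun_apply B x)" by (simp only: CC BB)
      also have "\<dots> = ?P x \<bullet> ?P x" by (simp add: Bs Cs CB)
      finally show ?thesis .
    qed
    have quant: "(\<forall>(g, h)\<in>A. (f \<bullet> h)\<^sup>2 \<le> M * (h \<bullet> g)) \<longleftrightarrow>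
      (\<forall>x. (f \<bullet> (x - blinfun_apply R x))\<^sup>2 \<le> M * (?P x \<bullet> ?P x))" unfolding A by (auto simp: hg)
    show ?thesis unfolding quant
    proof (intro iffI allI)
      fix x assume "\<exists>y. (f, y) \<in> T \<and> y \<bullet> y \<le> M"
      then obtain y where y: "(f, y) \<in> T" "y \<bullet> y \<le> M" by blast
      then have fy: "blinfun_apply C f = blinfun_apply B y" using Tadj adjT by simp
      have "f \<bullet> (x - blinfun_apply R x) = y \<bullet> ?P x"
        by (simp only: CC[symmetric] Cs[of f, symmetric] fy Bs)
      then have "(f \<bullet> (x - blinfun_apply R x))\<^sup>2 \<le> (y \<bullet> y) * (?P x \<bullet> ?P x)"
        using Cauchy_Schwarz_ineq[of y "?P x"] by simp
      also have "\<dots> \<le> M * (?P x \<bullet> ?P x)" using y(2) by (intro mult_right_mono) auto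
      finally show "(f \<bullet> (x - blinfun_apply R x))\<^sup>2 \<le> M * (?P x \<bullet> ?P x)" .
    next
      assume bd: "\<forall>x. (f \<bullet> (x - blinfun_apply R x))\<^sup>2 \<le> M * (?P x \<bullet> ?P x)"
      obtain x where x: "x \<in> closure (range ?P)" "\<And>z. f \<bullet> (z - blinfun_apply R z) = ?P z \<bullet> x" "x \<bullet> x \<le> M"
      proof (rule riesz_on_range[of ?P "\<lambda>z. f \<bullet> (z - blinfun_apply R z)" M])
        show "linear ?P" by (rule linearI) (simp_all add: bs)
        show "linear (\<lambda>z. f \<bullet> (z - blinfun_apply R z))" by (rule linearI) (simp_all add: bs inner_simps algebra_simps)
      qed (use M bd in auto)
      \<comment> \<open>Membership of (f, x) in \<open>T\<close> means e = 0. The Riesz identity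
        gives Ce = 0; then Be is orthogonal to the range of BC and to the limit point x, so e . e =
        Ce . f - Be . x vanishes.\<close>
      define e where "e = blinfun_apply C f - blinfun_apply B x"
      have "blinfun_apply C e \<bullet> z = 0" for z
      proof -
        have "f \<bullet> blinfun_apply C (blinfun_apply C z) = ?P z \<bullet> x" using x(2)[of z] by (simp only: CC)
        moreover have "blinfun_apply C (blinfun_apply C f) \<bullet> z = f \<bullet> blinfun_apply C (blinfun_apply C z)" by (simp only: Cs)
        moreover have "blinfun_apply C (blinfun_apply B x) \<bullet> z = ?P z \<bullet> x" by (simp only: Cs Bs inner_commute[of _ x])
        ultimately show ?thesis by (simp add: e_def bs inner_diff_left)
      qed
      then have Ce: "blinfun_apply C e = 0" by (metis inner_eq_zero_iff)
      have "closed {w. blinfun_apply B e \<bullet> w = 0}" by (intro closed_Collect_eq continuous_intros)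
      moreover have "range ?P \<subseteq> {w. blinfun_apply B e \<bullet> w = 0}"
        using Ce by (auto simp: CB[symmetric] Cs[symmetric]) (simp add: CB Ce bs)
      ultimately have "closure (range ?P) \<subseteq> {w. blinfun_apply B e \<bullet> w = 0}" by (rule closure_minimal[rotated])
      with x(1) have "blinfun_apply B e \<bullet> x = 0" by auto
      moreover have "e \<bullet> e = blinfun_apply C e \<bullet> f - blinfun_apply B e \<bullet> x"
        by (subst (2) e_def) (simp add: inner_simps Bs Cs)
      ultimately have "e = 0" using Ce by simp
      then have "(f, x) \<in> T" by (intro memT) (simp add: e_def)
      with x(3) show "\<exists>y. (f, y) \<in> T \<and> y \<bullet> y \<le> M" by blast
    qed
  qed
  have "is_sqrt_rel A T" using Tadj Tnn TT by (simp add: is_sqrt_rel_def)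
  from this uniq form show ?thesis by (rule that)
qed

end

section \<open>The Hilbert space of square integrable functions\<close>

definition sqint :: "(real \<Rightarrow> complex) \<Rightarrow> bool" where
  "sqint f \<longleftrightarrow> f \<in> borel_measurable lebesgue \<and> integrable lebesgue (\<lambda>x. (cmod (f x))\<^sup>2)"

lemma sqint_measurable: "sqint f \<Longrightarrow> f \<in> borel_measurable lebesgue"
  and sqint_integrable: "sqint f \<Longrightarrow> integrable lebesgue (\<lambda>x. (cmod (f x))\<^sup>2)"
  by (auto simp: sqint_def)

lemma norm_add_square_le: "(norm (x + y))\<^sup>2 \<le> 2 * (norm x)\<^sup>2 + 2 * (norm (y :: 'a::real_normed_vector))\<^sup>2"
proof -
  have "(norm (x + y))\<^sup>2 \<le> (norm x + norm y)\<^sup>2" by (intro power_mono norm_triangle_ineq) auto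
  also have "\<dots> \<le> 2 * (norm x)\<^sup>2 + 2 * (norm y)\<^sup>2"
    using zero_le_power2[of "norm x - norm y"] by (simp add: power2_eq_square algebra_simps)
  finally show ?thesis .
qed

lemma sqint_add: "sqint f \<Longrightarrow> sqint g \<Longrightarrow> sqint (\<lambda>x. f x + g x)"
  unfolding sqint_def
proof (intro conjI; elim conjE)
  assume m: "f \<in> borel_measurable lebesgue" "g \<in> borel_measurable lebesgue"
    and i: "integrable lebesgue (\<lambda>x. (cmod (f x))\<^sup>2)" "integrable lebesgue (\<lambda>x. (cmod (g x))\<^sup>2)"
  show "(\<lambda>x. f x + g x) \<in> borel_measurable lebesgue" using m by measurable
  show "integrable lebesgue (\<lambda>x. (cmod (f x + g x))\<^sup>2)"
  proof (rule Bochner_Integration.integrable_bound)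
    show "integrable lebesgue (\<lambda>x. 2 * (cmod (f x))\<^sup>2 + 2 * (cmod (g x))\<^sup>2)"
      using i by (intro Bochner_Integration.integrable_add integrable_mult_right)
    show "AE x in lebesgue. norm ((cmod (f x + g x))\<^sup>2) \<le> norm (2 * (cmod (f x))\<^sup>2 + 2 * (cmod (g x))\<^sup>2)"
      using norm_add_square_le by (auto intro!: AE_I2)
  qed (use m in measurable)
qed

lemma sqint_bounded_mult:
  assumes "sqint f" "m \<in> borel_measurable lebesgue" "\<And>x. cmod (m x) \<le> K"
  shows "sqint (\<lambda>x. m x * f x)"
proof -
  have "0 \<le> K" using assms(3)[of 0] norm_ge_zero order_trans by blast
  have "integrable lebesgue (\<lambda>x. (cmod (m x * f x))\<^sup>2)"
  proof (rule Bochner_Integration.integrable_bound)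
    show "integrable lebesgue (\<lambda>x. K\<^sup>2 * (cmod (f x))\<^sup>2)" using sqint_integrable[OF assms(1)] by simp
    have "(cmod (m x))\<^sup>2 * (cmod (f x))\<^sup>2 \<le> K\<^sup>2 * (cmod (f x))\<^sup>2" for x
      using assms(3)[of x] by (intro mult_right_mono power_mono) auto
    then show "AE x in lebesgue. norm ((cmod (m x * f x))\<^sup>2) \<le> norm (K\<^sup>2 * (cmod (f x))\<^sup>2)"
      by (simp add: norm_mult power_mult_distrib)
  qed (use assms sqint_measurable[OF assms(1)] in measurable)
  with assms sqint_measurable[OF assms(1)] show ?thesis unfolding sqint_def by simp
qed

lemma sqint_const_mult: "sqint f \<Longrightarrow> sqint (\<lambda>x. c * f x)"
  using sqint_bounded_mult[of f "\<lambda>_. c" "cmod c"] by simp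

lemma sqint_scaleR: "sqint f \<Longrightarrow> sqint (\<lambda>x. c *\<^sub>R f x)"
  unfolding scaleR_conv_of_real by (rule sqint_const_mult)

lemma sqint_minus: "sqint f \<Longrightarrow> sqint (\<lambda>x. - f x)"
  using sqint_const_mult[of f "-1"] by simp

lemma sqint_diff: "sqint f \<Longrightarrow> sqint g \<Longrightarrow> sqint (\<lambda>x. f x - g x)"
  using sqint_add[OF _ sqint_minus] by fastforce

lemma sqint_zero: "sqint (\<lambda>_. 0)"
  by (simp add: sqint_def)

lemma sqint_inner_integrable:
  assumes "sqint f" "sqint g"
  shows "integrable lebesgue (\<lambda>x. f x \<bullet> g x)"
proof (rule Bochner_Integration.integrable_bound)
  show "integrable lebesgue (\<lambda>x. (cmod (f x))\<^sup>2 + (cmod (g x))\<^sup>2)"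
    using assms by (intro Bochner_Integration.integrable_add sqint_integrable)
  have "norm (f x \<bullet> g x) \<le> (cmod (f x))\<^sup>2 + (cmod (g x))\<^sup>2" for x
  proof -
    have "norm (f x \<bullet> g x) \<le> cmod (f x) * cmod (g x)" by (simp add: Cauchy_Schwarz_ineq2)
    also have "\<dots> \<le> (cmod (f x))\<^sup>2 + (cmod (g x))\<^sup>2"
      using zero_le_power2[of "cmod (f x) - cmod (g x)"] mult_nonneg_nonneg[of "cmod (f x)" "cmod (g x)"]
      by (simp add: power2_diff del: mult_nonneg_nonneg)
    finally show ?thesis .
  qed
  then show "AE x in lebesgue. norm (f x \<bullet> g x) \<le> norm ((cmod (f x))\<^sup>2 + (cmod (g x))\<^sup>2)"
    by (auto intro!: AE_I2)
qed (use sqint_measurable[OF assms(1)] sqint_measurable[OF assms(2)] in measurable)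

text \<open>The weights $2^n$ make the increments summable almost everywhere without Minkowski's inequality.\<close>

lemma sqint_complete:
  assumes f: "\<And>n. sqint (f n)" and small: "\<And>n. (\<integral>x. (cmod (f (Suc n) x - f n x))\<^sup>2 \<partial>lebesgue) \<le> (1/4) ^ n"
    and cau: "\<And>e. 0 < e \<Longrightarrow> \<exists>M. \<forall>m\<ge>M. \<forall>n\<ge>M. (\<integral>x. (cmod (f m x - f n x))\<^sup>2 \<partial>lebesgue) < e"
  obtains g where "sqint g" "(\<lambda>n. \<integral>x. (cmod (f n x - g x))\<^sup>2 \<partial>lebesgue) \<longlonglongrightarrow> 0"
proof -
  have [measurable]: "f n \<in> borel_measurable lebesgue" for n using f sqint_measurable by blast
  define d where "d n x = (cmod (f (Suc n) x - f n x))\<^sup>2" for n x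
  have dm[measurable]: "d n \<in> borel_measurable lebesgue" for n unfolding d_def by measurable
  have nni: "(\<integral>\<^sup>+x. ennreal ((cmod (u x))\<^sup>2) \<partial>lebesgue) = ennreal (\<integral>x. (cmod (u x))\<^sup>2 \<partial>lebesgue)" if "sqint u" for u
    by (rule nn_integral_eq_integral[OF sqint_integrable[OF that]]) auto
  have di: "(\<integral>\<^sup>+x. ennreal (2 ^ n * d n x) \<partial>lebesgue) \<le> ennreal ((1/2) ^ n)" for n
  proof -
    have "(\<integral>\<^sup>+x. ennreal (2 ^ n * d n x) \<partial>lebesgue) = ennreal (2 ^ n) * (\<integral>\<^sup>+x. ennreal (d n x) \<partial>lebesgue)"
      by (subst nn_integral_cmult[symmetric]) (auto simp: ennreal_mult d_def)
    also have "\<dots> = ennreal (2 ^ n) * ennreal (\<integral>x. (cmod (f (Suc n) x - f n x))\<^sup>2 \<partial>lebesgue)"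
      unfolding d_def by (subst nni[OF sqint_diff[OF f f]]) simp
    also have "\<dots> = ennreal (2 ^ n * (\<integral>x. (cmod (f (Suc n) x - f n x))\<^sup>2 \<partial>lebesgue))"
      by (rule ennreal_mult[symmetric]) auto
    also have "\<dots> \<le> ennreal (2 ^ n * (1/4) ^ n)" by (intro ennreal_leI mult_left_mono small) auto
    also have "(2::real) ^ n * (1/4) ^ n = (1/2) ^ n" by (simp flip: power_mult_distrib)
    finally show ?thesis .
  qed
  have "(\<integral>\<^sup>+x. (\<Sum>n. ennreal (2 ^ n * d n x)) \<partial>lebesgue) = (\<Sum>n. \<integral>\<^sup>+x. ennreal (2 ^ n * d n x) \<partial>lebesgue)"
    by (rule nn_integral_suminf) measurable
  also have "\<dots> \<le> (\<Sum>n. ennreal ((1/2) ^ n))" by (intro suminf_le di) auto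
  also have "\<dots> < \<infinity>" by (subst suminf_ennreal2) (auto simp: summable_geometric)
  finally have fin: "(\<integral>\<^sup>+x. (\<Sum>n. ennreal (2 ^ n * d n x)) \<partial>lebesgue) \<noteq> \<infinity>" by simp
  have "AE x in lebesgue. (\<Sum>n. ennreal (2 ^ n * d n x)) \<noteq> \<infinity>"
    by (rule nn_integral_PInf_AE[OF _ fin]) measurable
  then have conv: "AE x in lebesgue. convergent (\<lambda>n. f n x)"
  proof (rule AE_mp, intro AE_I2 impI)
    fix x assume "(\<Sum>n. ennreal (2 ^ n * d n x)) \<noteq> \<infinity>"
    then have "summable (\<lambda>n. 2 ^ n * d n x)"
      by (intro summable_suminf_not_top) (auto simp: d_def)
    from summable_LIMSEQ_zero[OF this] have "Bseq (\<lambda>n. 2 ^ n * d n x)"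
      by (intro convergent_imp_Bseq convergentI)
    then obtain K where K: "0 < K" "\<And>n. norm (2 ^ n * d n x) \<le> K" by (auto simp: Bseq_def)
    \<comment> \<open>Boundedness of 2^n \<open>d n x\<close> gives pointwise increments of order
      2^{-n/2}, a summable geometric rate.\<close>
    have le: "norm (f (Suc n) x - f n x) \<le> sqrt K * (1 / sqrt 2) ^ n" for n
    proof -
      have "d n x \<le> K * (1/2) ^ n" using K(2)[of n] by (simp add: d_def field_simps power_divide)
      then have "sqrt (d n x) \<le> sqrt (K * (1/2) ^ n)" by simp
      then show ?thesis by (simp add: d_def real_sqrt_mult real_sqrt_power real_sqrt_divide)
    qed
    have "summable (\<lambda>n. norm (f (Suc n) x - f n x))"
    proof (rule summable_comparison_test'[of "\<lambda>n. sqrt K * (1 / sqrt 2) ^ n" 0])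
      show "summable (\<lambda>n. sqrt K * (1 / sqrt 2) ^ n)" by (intro summable_mult summable_geometric) simp
    qed (use le in auto)
    then have "summable (\<lambda>n. f (Suc n) x - f n x)" by (rule summable_norm_cancel)
    then have "convergent (\<lambda>n. f n x - f 0 x)"
      unfolding summable_iff_convergent by (simp add: sum_lessThan_telescope[of "\<lambda>n. f n x"])
    from convergent_add[OF this convergent_const[of "f 0 x"]] show "convergent (\<lambda>n. f n x)" by simp
  qed
  define g where "g x = lim (\<lambda>n. f n x)" for x
  have gm[measurable]: "g \<in> borel_measurable lebesgue" unfolding g_def by measurable
  have lim: "AE x in lebesgue. (\<lambda>n. f n x) \<longlonglongrightarrow> g x"
    using conv by (rule AE_mp) (auto simp: g_def convergent_LIMSEQ_iff)
  \<comment> \<open>Fatou's lemma passes the Cauchy bound in the second index to the pointwise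
    limit; it yields both square integrability of the limit and convergence in mean.\<close>
  have fatou: "(\<integral>\<^sup>+x. ennreal ((cmod (f m x - g x))\<^sup>2) \<partial>lebesgue) \<le> ennreal e"
    if M: "\<forall>n\<ge>M. (\<integral>x. (cmod (f m x - f n x))\<^sup>2 \<partial>lebesgue) \<le> e" for m M e
  proof -
    have "(\<integral>\<^sup>+x. ennreal ((cmod (f m x - g x))\<^sup>2) \<partial>lebesgue)
      = (\<integral>\<^sup>+x. liminf (\<lambda>n. ennreal ((cmod (f m x - f n x))\<^sup>2)) \<partial>lebesgue)"
    proof (rule nn_integral_cong_AE, rule AE_mp[OF lim], intro AE_I2 impI)
      fix x assume l: "(\<lambda>n. f n x) \<longlonglongrightarrow> g x"
      have "(\<lambda>n. ennreal ((cmod (f m x - f n x))\<^sup>2)) \<longlonglongrightarrow> ennreal ((cmod (f m x - g x))\<^sup>2)"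
        by (intro tendsto_intros l tendsto_ennrealI)
      then show "ennreal ((cmod (f m x - g x))\<^sup>2) = liminf (\<lambda>n. ennreal ((cmod (f m x - f n x))\<^sup>2))"
        by (rule lim_imp_Liminf[symmetric, rotated]) simp
    qed
    also have "\<dots> \<le> liminf (\<lambda>n. \<integral>\<^sup>+x. ennreal ((cmod (f m x - f n x))\<^sup>2) \<partial>lebesgue)"
      by (rule nn_integral_liminf) measurable
    also have "\<dots> \<le> liminf (\<lambda>n. ennreal e)"
    proof (rule Liminf_mono)
      show "\<forall>\<^sub>F n in sequentially. (\<integral>\<^sup>+x. ennreal ((cmod (f m x - f n x))\<^sup>2) \<partial>lebesgue) \<le> ennreal e"
        using M by (auto simp: eventually_sequentially nni[OF sqint_diff[OF f f]] intro!: exI[of _ M] ennreal_leI)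
    qed
    finally show ?thesis by (simp add: Liminf_const)
  qed
  have sqd: "sqint (\<lambda>x. f m x - g x)" and le: "(\<integral>x. (cmod (f m x - g x))\<^sup>2 \<partial>lebesgue) \<le> e"
    if M: "\<forall>n\<ge>M. (\<integral>x. (cmod (f m x - f n x))\<^sup>2 \<partial>lebesgue) \<le> e" "0 \<le> e" for m M e
  proof -
    note F = fatou[OF M(1)]
    have "integrable lebesgue (\<lambda>x. (cmod (f m x - g x))\<^sup>2)"
      by (rule integrableI_nonneg) (use F in \<open>auto intro: le_less_trans\<close>)
    then show s: "sqint (\<lambda>x. f m x - g x)" by (simp add: sqint_def)
    show "(\<integral>x. (cmod (f m x - g x))\<^sup>2 \<partial>lebesgue) \<le> e"
      using F M(2) unfolding nni[OF s] by simp
  qed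
  have ex: "\<exists>M. \<forall>m\<ge>M. \<forall>n\<ge>M. (\<integral>x. (cmod (f m x - f n x))\<^sup>2 \<partial>lebesgue) \<le> e" if "0 < e" for e
    using cau[OF that] less_imp_le by blast
  obtain M0 where "\<forall>n\<ge>M0. (\<integral>x. (cmod (f M0 x - f n x))\<^sup>2 \<partial>lebesgue) \<le> 1" using ex[of 1] by auto
  from sqint_diff[OF f[of M0] sqd[OF this]] have "sqint g" by simp
  moreover have "(\<lambda>n. \<integral>x. (cmod (f n x - g x))\<^sup>2 \<partial>lebesgue) \<longlonglongrightarrow> 0"
  proof (rule LIMSEQ_I)
    fix e :: real assume e: "0 < e"
    obtain M where M: "\<forall>m\<ge>M. \<forall>n\<ge>M. (\<integral>x. (cmod (f m x - f n x))\<^sup>2 \<partial>lebesgue) \<le> e / 2"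
      using ex[of "e/2"] e by auto
    have "(\<integral>x. (cmod (f m x - g x))\<^sup>2 \<partial>lebesgue) < e" if "m \<ge> M" for m
    proof -
      have "(\<integral>x. (cmod (f m x - g x))\<^sup>2 \<partial>lebesgue) \<le> e / 2" using M that e by (intro le[of M]) auto
      with e show ?thesis by linarith
    qed
    then show "\<exists>no. \<forall>n\<ge>no. norm ((\<integral>x. (cmod (f n x - g x))\<^sup>2 \<partial>lebesgue) - 0) < e"
      by (intro exI[of _ M]) auto
  qed
  ultimately show ?thesis by (rule that)
qed

\<comment> \<open>The functions are complex valued but the space is treated as a real Hilbert space,
  its inner product being the real part of the complex one. Multiplication by i is kept as a
  separate isometry \<open>imul\<close>, so the results on real relations apply.\<close>
quotient_type l2 = "real \<Rightarrow> complex" / partial: "\<lambda>f g. sqint f \<and> sqint g \<and> (AE x in lebesgue. f x = g x)"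
proof (rule part_equivpI)
  show "\<exists>x. sqint x \<and> sqint x \<and> (AE t in lebesgue. x t = x t)" using sqint_zero by auto
  show "symp (\<lambda>f g. sqint f \<and> sqint g \<and> (AE x in lebesgue. f x = g x))"
    by (rule sympI) (auto simp: eq_commute)
  show "transp (\<lambda>f g. sqint f \<and> sqint g \<and> (AE x in lebesgue. f x = g x))"
    by (rule transpI) (auto elim!: AE_mp)
qed

instantiation l2 :: real_vector
begin

lift_definition zero_l2 :: l2 is "\<lambda>_. 0" by (simp add: sqint_zero)
lift_definition plus_l2 :: "l2 \<Rightarrow> l2 \<Rightarrow> l2" is "\<lambda>f g x. f x + g x"
  by (auto intro: sqint_add elim!: AE_mp)
lift_definition minus_l2 :: "l2 \<Rightarrow> l2 \<Rightarrow> l2" is "\<lambda>f g x. f x - g x"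
  by (auto intro: sqint_diff elim!: AE_mp)
lift_definition uminus_l2 :: "l2 \<Rightarrow> l2" is "\<lambda>f x. - f x"
  by (auto intro: sqint_minus elim!: AE_mp)
lift_definition scaleR_l2 :: "real \<Rightarrow> l2 \<Rightarrow> l2" is "\<lambda>c f x. c *\<^sub>R f x"
  by (auto intro: sqint_scaleR elim!: AE_mp)

instance
  by standard (transfer; auto intro!: sqint_add sqint_diff sqint_minus sqint_scaleR sqint_zero simp: algebra_simps)+

end

instantiation l2 :: real_inner
begin

lift_definition inner_l2 :: "l2 \<Rightarrow> l2 \<Rightarrow> real" is "\<lambda>f g. \<integral>x. f x \<bullet> g x \<partial>lebesgue"
  by (rule integral_cong_AE) (auto intro!: borel_measurable_inner sqint_measurable elim!: AE_mp)

definition norm_l2 :: "l2 \<Rightarrow> real" where "norm_l2 x = sqrt (inner x x)"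
definition sgn_l2 :: "l2 \<Rightarrow> l2" where "sgn_l2 x = x /\<^sub>R norm x"
definition dist_l2 :: "l2 \<Rightarrow> l2 \<Rightarrow> real" where "dist_l2 x y = norm (x - y)"
definition uniformity_l2 :: "(l2 \<times> l2) filter" where
  "uniformity_l2 = (INF e\<in>{0 <..}. principal {(x, y). dist x y < e})"
definition open_l2 :: "l2 set \<Rightarrow> bool" where
  "open_l2 U = (\<forall>x\<in>U. eventually (\<lambda>(x', y). x' = x \<longrightarrow> y \<in> U) uniformity)"

instance
proof
  fix x y z :: l2 and r :: real
  show "dist x y = norm (x - y)" by (rule dist_l2_def)
  show "sgn x = x /\<^sub>R norm x" by (rule sgn_l2_def)
  show "uniformity = (INF e\<in>{0 <..}. principal {(x, y :: l2). dist x y < e})" by (rule uniformity_l2_def)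
  show "open U = (\<forall>x\<in>U. \<forall>\<^sub>F (x', y) in uniformity. x' = x \<longrightarrow> y \<in> U)" for U :: "l2 set" by (rule open_l2_def)
  show "inner x y = inner y x" by transfer (simp add: inner_commute)
  show "inner (x + y) z = inner x z + inner y z"
    by transfer (auto simp: inner_add_left intro!: Bochner_Integration.integral_add sqint_inner_integrable)
  show "inner (r *\<^sub>R x) y = r * inner x y" by transfer simp
  show "0 \<le> inner x x" by transfer (auto intro!: integral_nonneg)
  show "(inner x x = 0) = (x = 0)"
  proof (transfer)
    fix f assume f: "sqint f \<and> sqint f \<and> (AE x in lebesgue. f x = f x)"
    have "(\<integral>x. f x \<bullet> f x \<partial>lebesgue) = 0 \<longleftrightarrow> (AE x in lebesgue. f x \<bullet> f x = 0)"
      using f by (intro integral_nonneg_eq_0_iff_AE sqint_inner_integrable) auto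
    then show "((\<integral>x. f x \<bullet> f x \<partial>lebesgue) = 0) = (sqint f \<and> sqint (\<lambda>_. 0) \<and> (AE x in lebesgue. f x = 0))"
      using f sqint_zero by simp
  qed
  show "norm x = sqrt (inner x x)" by (rule norm_l2_def)
qed

end

lemma abs_l2_eq_iff: "sqint f \<Longrightarrow> sqint g \<Longrightarrow> abs_l2 f = abs_l2 g \<longleftrightarrow> (AE x in lebesgue. f x = g x)"
  using Quotient_rel_abs[OF Quotient_l2] Quotient_rel[OF Quotient_l2] by (metis (mono_tags, lifting) AE_I2)

lemma l2_rep_exists: obtains f where "sqint f" "x = abs_l2 f"
  by (metis (mono_tags, lifting) Quotient_abs_rep[OF Quotient_l2] Quotient_rep_reflp[OF Quotient_l2])

lemma abs_l2_add: "sqint f \<Longrightarrow> sqint g \<Longrightarrow> abs_l2 f + abs_l2 g = abs_l2 (\<lambda>x. f x + g x)"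
  by (rule plus_l2.abs_eq) auto

lemma abs_l2_diff: "sqint f \<Longrightarrow> sqint g \<Longrightarrow> abs_l2 f - abs_l2 g = abs_l2 (\<lambda>x. f x - g x)"
  by (rule minus_l2.abs_eq) auto

lemma abs_l2_scaleR: "sqint f \<Longrightarrow> c *\<^sub>R abs_l2 f = abs_l2 (\<lambda>x. c *\<^sub>R f x)"
  by (rule scaleR_l2.abs_eq) auto

lemma inner_abs_l2: "sqint f \<Longrightarrow> sqint g \<Longrightarrow> abs_l2 f \<bullet> abs_l2 g = (\<integral>x. f x \<bullet> g x \<partial>lebesgue)"
  by (rule inner_l2.abs_eq) auto

lemma norm_abs_l2: "sqint f \<Longrightarrow> (norm (abs_l2 f))\<^sup>2 = (\<integral>x. (cmod (f x))\<^sup>2 \<partial>lebesgue)"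
  by (simp add: power2_norm_eq_inner inner_abs_l2)

instance l2 :: banach
proof
  fix X :: "nat \<Rightarrow> l2" assume X: "Cauchy X"
  have "\<exists>N. \<forall>m\<ge>N. \<forall>n\<ge>N. norm (X m - X n) < (1/2) ^ k" for k
    using CauchyD[OF X, of "(1/2) ^ k"] by simp
  then obtain N where N: "\<And>k m n. m \<ge> N k \<Longrightarrow> n \<ge> N k \<Longrightarrow> norm (X m - X n) < (1/2) ^ k" by metis
  \<comment> \<open>Strictly increasing indices along which consecutive differences have norm at
    most 2^{-k}; their squares meet the bound 4^{-k} of the completeness lemma.\<close>
  define s where "s = rec_nat (N 0) (\<lambda>k v. max (Suc v) (N (Suc k)))"
  have s_Suc: "s (Suc k) = max (Suc (s k)) (N (Suc k))" for k by (simp add: s_def)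
  have sm: "strict_mono s" by (rule strict_mono_Suc_iff[THEN iffD2]) (simp add: s_Suc less_max_iff_disj)
  have sN: "N k \<le> s k" for k by (cases k) (simp add: s_def, simp add: s_Suc)
  have "\<forall>n. \<exists>f. sqint f \<and> X (s n) = abs_l2 f" by (meson l2_rep_exists)
  then obtain f where f: "\<And>n. sqint (f n)" "\<And>n. X (s n) = abs_l2 (f n)" by metis
  have nrm: "(\<integral>x. (cmod (f m x - f n x))\<^sup>2 \<partial>lebesgue) = (norm (X (s m) - X (s n)))\<^sup>2" for m n
    by (simp add: f abs_l2_diff norm_abs_l2 sqint_diff)
  obtain g where g: "sqint g" "(\<lambda>n. \<integral>x. (cmod (f n x - g x))\<^sup>2 \<partial>lebesgue) \<longlonglongrightarrow> 0"
  proof (rule sqint_complete[of f])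
    show "(\<integral>x. (cmod (f (Suc n) x - f n x))\<^sup>2 \<partial>lebesgue) \<le> (1/4) ^ n" for n
    proof -
      have "s n \<le> s (Suc n)" by (simp add: s_Suc)
      then have "norm (X (s (Suc n)) - X (s n)) \<le> (1/2) ^ n"
        using N[of n "s (Suc n)" "s n"] sN[of n] by simp
      then have "(norm (X (s (Suc n)) - X (s n)))\<^sup>2 \<le> ((1/2) ^ n)\<^sup>2" by (rule power_mono) simp
      then show ?thesis unfolding nrm by (simp add: power2_eq_square flip: power_mult_distrib)
    qed
    show "\<exists>M. \<forall>m\<ge>M. \<forall>n\<ge>M. (\<integral>x. (cmod (f m x - f n x))\<^sup>2 \<partial>lebesgue) < e" if e: "0 < e" for e
    proof -
      obtain M where M: "\<forall>m\<ge>M. \<forall>n\<ge>M. norm (X m - X n) < sqrt e" using CauchyD[OF X, of "sqrt e"] e by auto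
      have "(norm (X (s m) - X (s n)))\<^sup>2 < e" if "m \<ge> M" "n \<ge> M" for m n
      proof -
        have "norm (X (s m) - X (s n)) < sqrt e"
          using M that seq_suble[OF sm, of m] seq_suble[OF sm, of n] by (meson order_trans)
        then have "(norm (X (s m) - X (s n)))\<^sup>2 < (sqrt e)\<^sup>2" by (intro power_strict_mono) auto
        with e show ?thesis by simp
      qed
      then show ?thesis unfolding nrm by blast
    qed
  qed (use f in auto)
  have "(\<lambda>n. (norm (X (s n) - abs_l2 g))\<^sup>2) \<longlonglongrightarrow> 0"
    using g(2) by (simp add: f abs_l2_diff norm_abs_l2 sqint_diff g(1))
  from tendsto_real_sqrt[OF this] have "(\<lambda>n. norm (X (s n) - abs_l2 g)) \<longlonglongrightarrow> 0" by simp
  then have "(X \<circ> s) \<longlonglongrightarrow> abs_l2 g" unfolding o_def by (metis LIM_zero_iff tendsto_norm_zero_cancel)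
  with Cauchy_converges_subseq[OF X sm] show "convergent X" by (auto intro: convergentI)
qed

lift_definition imul :: "l2 \<Rightarrow> l2" is "\<lambda>f x. \<i> * f x"
  by (auto intro: sqint_const_mult elim!: AE_mp)

lemma imul_abs: "sqint f \<Longrightarrow> imul (abs_l2 f) = abs_l2 (\<lambda>x. \<i> * f x)"
  by (rule imul.abs_eq) auto

lemma imul_imul: "imul (imul x) = - x"
  by transfer (auto intro: sqint_const_mult sqint_minus simp flip: mult.assoc)

lemma imul_inner: "imul x \<bullet> imul y = x \<bullet> y"
  by transfer (simp add: inner_complex_def algebra_simps)

section \<open>The form order on weighted spaces\<close>

lemma imul_add: "imul (x + y) = imul x + imul y"
  by transfer (auto simp: algebra_simps intro: sqint_add sqint_const_mult)

lemma imul_scaleR: "imul (c *\<^sub>R x) = c *\<^sub>R imul x"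
  by transfer (auto simp: algebra_simps intro: sqint_scaleR sqint_const_mult)

lemma imul_minus: "imul (- x) = - imul x"
  using imul_scaleR[of "-1" x] by simp

lemma imul_inner_left: "imul x \<bullet> y = - (x \<bullet> imul y)"
  using imul_inner[of x "imul y"] by (simp add: imul_imul)

lemma open_Ioo_e: "open (Ioo_e a b)"
proof -
  have "Ioo_e a b = einterval a b" by (simp add: Ioo_e_def einterval_def)
  then show ?thesis by simp
qed

lemma Ioo_e_lebesgue [measurable, simp]: "Ioo_e a b \<in> sets lebesgue"
  using borel_open[OF open_Ioo_e[of a b]] by simp

locale weighted_L2 =
  fixes a b :: ereal and r :: "real \<Rightarrow> real"
  assumes r_meas: "set_borel_measurable lebesgue (Ioo_e a b) r"
    and r_pos: "AE x in lebesgue. x \<in> Ioo_e a b \<longrightarrow> 0 < r x"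
begin

abbreviation "I \<equiv> Ioo_e a b"
abbreviation "LL \<equiv> L2 a b r"
abbreviation "ip \<equiv> inner_L2 a b r"
abbreviation "eqv \<equiv> ae_eq a b"

text \<open>An isometry from the weighted space into unweighted square integrable functions on the
  whole line. Extension by zero makes endpoints and unbounded intervals irrelevant to the Hilbert
  space part.\<close>

definition emb :: "fn \<Rightarrow> fn" where
  "emb f x = (if x \<in> I then complex_of_real (sqrt (r x)) * f x else 0)"

lemma r_meas': "(\<lambda>x. indicator I x * r x) \<in> borel_measurable lebesgue"
  using r_meas by (simp add: set_borel_measurable_def)

lemma L2_meas: "LL f \<Longrightarrow> (\<lambda>x. indicator I x *\<^sub>R f x) \<in> borel_measurable lebesgue"
  by (simp add: L2_def set_borel_measurable_def)

lemma L2_int: "LL f \<Longrightarrow> integrable lebesgue (\<lambda>x. indicator I x * ((cmod (f x))\<^sup>2 * r x))"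
  by (simp add: L2_def set_integrable_def)

lemma emb_meas:
  assumes "(\<lambda>x. indicator I x *\<^sub>R f x) \<in> borel_measurable lebesgue"
  shows "emb f \<in> borel_measurable lebesgue"
proof -
  have "emb f = (\<lambda>x. complex_of_real (sqrt (indicator I x * r x)) * (indicator I x *\<^sub>R f x))"
    by (auto simp: emb_def fun_eq_iff indicator_def)
  moreover have "(\<lambda>x. complex_of_real (sqrt (indicator I x * r x)) * (indicator I x *\<^sub>R f x)) \<in> borel_measurable lebesgue"
    using assms r_meas' by measurable
  ultimately show ?thesis by (simp only:)
qed

lemma emb_norm: "AE x in lebesgue. (cmod (emb f x))\<^sup>2 = indicator I x * ((cmod (f x))\<^sup>2 * r x)"
  using r_pos by (rule AE_mp) (auto intro!: AE_I2 simp: emb_def norm_mult power_mult_distrib)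

lemma emb_inner: "AE x in lebesgue. emb f x \<bullet> emb g x = Re (indicator I x *\<^sub>R (f x * cnj (g x) * complex_of_real (r x)))"
proof (rule AE_mp[OF r_pos], intro AE_I2 impI)
  fix x assume "x \<in> I \<longrightarrow> 0 < r x"
  moreover have "(complex_of_real s * u) \<bullet> (complex_of_real s * v) = Re (u * cnj v * complex_of_real (s * s))" for s u v
    by (simp add: inner_complex_def algebra_simps)
  ultimately show "emb f x \<bullet> emb g x = Re (indicator I x *\<^sub>R (f x * cnj (g x) * complex_of_real (r x)))"
    using \<open>x \<in> I \<longrightarrow> 0 < r x\<close> by (cases "x \<in> I") (simp_all add: emb_def abs_of_pos)
qed

lemma emb_sqint: assumes "LL f" shows "sqint (emb f)"
proof -
  have m[measurable]: "emb f \<in> borel_measurable lebesgue" by (rule emb_meas[OF L2_meas[OF assms]])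
  have "integrable lebesgue (\<lambda>x. (cmod (emb f x))\<^sup>2) \<longleftrightarrow> integrable lebesgue (\<lambda>x. indicator I x * ((cmod (f x))\<^sup>2 * r x))"
    by (rule integrable_cong_AE[OF _ _ emb_norm]) (use borel_measurable_integrable[OF L2_int[OF assms]] in measurable)
  with L2_int[OF assms] m show ?thesis by (simp add: sqint_def)
qed

lemma L2_I_emb:
  assumes m: "(\<lambda>x. indicator I x *\<^sub>R f x) \<in> borel_measurable lebesgue" and s: "sqint (emb f)"
  shows "LL f"
proof -
  have [measurable]: "(\<lambda>x. indicator I x * ((cmod (f x))\<^sup>2 * r x)) \<in> borel_measurable lebesgue"
  proof -
    have "(\<lambda>x. indicator I x * ((cmod (f x))\<^sup>2 * r x)) = (\<lambda>x. (cmod (indicator I x *\<^sub>R f x))\<^sup>2 * (indicator I x * r x))"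
      by (auto simp: indicator_def fun_eq_iff)
    also have "\<dots> \<in> borel_measurable lebesgue" using m r_meas' by measurable
    finally show ?thesis .
  qed
  have "integrable lebesgue (\<lambda>x. (cmod (emb f x))\<^sup>2) \<longleftrightarrow> integrable lebesgue (\<lambda>x. indicator I x * ((cmod (f x))\<^sup>2 * r x))"
    by (rule integrable_cong_AE[OF _ _ emb_norm]) (use emb_meas[OF m] in measurable)
  with s m show ?thesis by (simp add: L2_def sqint_def set_integrable_def set_borel_measurable_def)
qed

lemma emb_add: "emb (\<lambda>x. f x + g x) = (\<lambda>x. emb f x + emb g x)"
  and emb_cmult: "emb (\<lambda>x. c * f x) = (\<lambda>x. c * emb f x)"
  and emb_diff: "emb (\<lambda>x. f x - g x) = (\<lambda>x. emb f x - emb g x)"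
  and emb_zero: "emb (\<lambda>_. 0) = (\<lambda>_. 0)"
  by (auto simp: emb_def algebra_simps)

lemma L2_add: assumes "LL f" "LL g" shows "LL (\<lambda>x. f x + g x)"
proof (rule L2_I_emb)
  have "(\<lambda>x. indicator I x *\<^sub>R f x + indicator I x *\<^sub>R g x) \<in> borel_measurable lebesgue"
    using assms[THEN L2_meas] by measurable
  then show "(\<lambda>x. indicator I x *\<^sub>R (f x + g x)) \<in> borel_measurable lebesgue" by (simp add: scaleR_add_right)
  show "sqint (emb (\<lambda>x. f x + g x))" unfolding emb_add by (intro sqint_add emb_sqint assms)
qed

lemma L2_cmult: assumes "LL f" shows "LL (\<lambda>x. c * f x)"
proof (rule L2_I_emb)
  have "(\<lambda>x. c * (indicator I x *\<^sub>R f x)) \<in> borel_measurable lebesgue"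
    using assms[THEN L2_meas] by measurable
  then show "(\<lambda>x. indicator I x *\<^sub>R (c * f x)) \<in> borel_measurable lebesgue" by (simp add: algebra_simps)
  show "sqint (emb (\<lambda>x. c * f x))" unfolding emb_cmult by (intro sqint_const_mult emb_sqint assms)
qed

lemma L2_diff: "LL f \<Longrightarrow> LL g \<Longrightarrow> LL (\<lambda>x. f x - g x)"
  using L2_add[OF _ L2_cmult[of g "-1"], of f] by simp

lemma L2_zero: "LL (\<lambda>_. 0)"
  by (rule L2_I_emb) (auto simp: emb_zero sqint_zero)

definition U :: "fn \<Rightarrow> l2" where "U f = abs_l2 (emb f)"

lemma U_add: "LL f \<Longrightarrow> LL g \<Longrightarrow> U (\<lambda>x. f x + g x) = U f + U g"
  by (simp add: U_def emb_add abs_l2_add emb_sqint)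

lemma U_diff: "LL f \<Longrightarrow> LL g \<Longrightarrow> U (\<lambda>x. f x - g x) = U f - U g"
  by (simp add: U_def emb_diff abs_l2_diff emb_sqint)

lemma U_imul: "LL f \<Longrightarrow> U (\<lambda>x. \<i> * f x) = imul (U f)"
  by (simp add: U_def emb_cmult imul_abs emb_sqint)

lemma U_zero: "U (\<lambda>_. 0) = 0"
  by (simp add: U_def emb_zero zero_l2_def)

lemma U_scaleR: "LL f \<Longrightarrow> U (\<lambda>x. complex_of_real c * f x) = c *\<^sub>R U f"
  by (simp add: U_def emb_cmult abs_l2_scaleR emb_sqint scaleR_conv_of_real)

lemma U_cmult: assumes "LL f" shows "U (\<lambda>x. c * f x) = Re c *\<^sub>R U f + Im c *\<^sub>R imul (U f)"
proof -
  have "(\<lambda>x. c * f x) = (\<lambda>x. complex_of_real (Re c) * f x + complex_of_real (Im c) * (\<i> * f x))"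
  proof
    fix x show "c * f x = complex_of_real (Re c) * f x + complex_of_real (Im c) * (\<i> * f x)"
      by (subst complex_eq[of c]) (simp add: algebra_simps)
  qed
  then show ?thesis using assms by (simp add: U_add U_scaleR U_imul L2_cmult)
qed

lemma U_eq_iff: assumes "LL f" "LL g" shows "U f = U g \<longleftrightarrow> eqv f g"
proof -
  have "U f = U g \<longleftrightarrow> (AE x in lebesgue. emb f x = emb g x)"
    unfolding U_def by (rule abs_l2_eq_iff[OF emb_sqint[OF assms(1)] emb_sqint[OF assms(2)]])
  also have "\<dots> \<longleftrightarrow> (AE x in lebesgue. x \<in> I \<longrightarrow> f x = g x)"
  proof
    assume "AE x in lebesgue. emb f x = emb g x"
    with r_pos show "AE x in lebesgue. x \<in> I \<longrightarrow> f x = g x"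
      by eventually_elim (auto simp: emb_def)
  next
    assume "AE x in lebesgue. x \<in> I \<longrightarrow> f x = g x"
    then show "AE x in lebesgue. emb f x = emb g x" by eventually_elim (auto simp: emb_def)
  qed
  finally show ?thesis by (simp add: ae_eq_def)
qed

lemma L2_mult_integrable:
  assumes "LL f" "LL g"
  shows "set_integrable lebesgue I (\<lambda>x. f x * g x * complex_of_real (r x))"
  unfolding set_integrable_def
proof (rule Bochner_Integration.integrable_bound)
  show "integrable lebesgue (\<lambda>x. indicator I x * ((cmod (f x))\<^sup>2 * r x) + indicator I x * ((cmod (g x))\<^sup>2 * r x))"
    by (intro Bochner_Integration.integrable_add L2_int assms)
  have "(\<lambda>x. indicator I x *\<^sub>R (f x * g x * complex_of_real (r x)))
      = (\<lambda>x. (indicator I x *\<^sub>R f x) * (indicator I x *\<^sub>R g x) * complex_of_real (indicator I x * r x))"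
    by (auto simp: indicator_def fun_eq_iff)
  also have "\<dots> \<in> borel_measurable lebesgue"
    using r_meas' assms[THEN L2_meas] by measurable
  finally show "(\<lambda>x. indicator I x *\<^sub>R (f x * g x * complex_of_real (r x))) \<in> borel_measurable lebesgue" .
  show "AE x in lebesgue. norm (indicator I x *\<^sub>R (f x * g x * complex_of_real (r x)))
      \<le> norm (indicator I x * ((cmod (f x))\<^sup>2 * r x) + indicator I x * ((cmod (g x))\<^sup>2 * r x))"
  proof (rule AE_mp[OF r_pos], intro AE_I2 impI)
    fix x assume r: "x \<in> I \<longrightarrow> 0 < r x"
    have "cmod (f x) * cmod (g x) \<le> (cmod (f x))\<^sup>2 + (cmod (g x))\<^sup>2"
      using zero_le_power2[of "cmod (f x) - cmod (g x)"] mult_nonneg_nonneg[of "cmod (f x)" "cmod (g x)"]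
      by (simp add: power2_diff del: mult_nonneg_nonneg)
    then have "x \<in> I \<Longrightarrow> cmod (f x) * cmod (g x) * r x \<le> ((cmod (f x))\<^sup>2 + (cmod (g x))\<^sup>2) * r x"
      using r by (intro mult_right_mono) auto
    then show "norm (indicator I x *\<^sub>R (f x * g x * complex_of_real (r x)))
      \<le> norm (indicator I x * ((cmod (f x))\<^sup>2 * r x) + indicator I x * ((cmod (g x))\<^sup>2 * r x))"
      using r by (auto simp: indicator_def norm_mult algebra_simps)
  qed
qed

lemma L2_cnj: assumes "LL f" shows "LL (\<lambda>x. cnj (f x))"
proof -
  have "(\<lambda>x. cnj (indicator I x *\<^sub>R f x)) \<in> borel_measurable lebesgue" 
    using L2_meas[OF assms] by (intro borel_measurable_continuous_on[OF continuous_on_cnj[OF continuous_on_id]])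
  then show ?thesis using assms by (simp add: L2_def set_borel_measurable_def)
qed

lemma Re_ip: assumes "LL f" "LL g" shows "Re (ip f g) = U f \<bullet> U g"
proof -
  have i: "integrable lebesgue (\<lambda>x. indicator I x *\<^sub>R (f x * cnj (g x) * complex_of_real (r x)))"
    using L2_mult_integrable[OF assms(1) L2_cnj[OF assms(2)]] by (simp add: set_integrable_def)
  have "Re (ip f g) = (\<integral>x. Re (indicator I x *\<^sub>R (f x * cnj (g x) * complex_of_real (r x))) \<partial>lebesgue)"
    unfolding inner_L2_def set_lebesgue_integral_def by (rule integral_Re[OF i, symmetric])
  also have "\<dots> = (\<integral>x. emb f x \<bullet> emb g x \<partial>lebesgue)"
    using emb_inner[of f g] emb_sqint[OF assms(1)] emb_sqint[OF assms(2)]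
    by (intro integral_cong_AE borel_measurable_inner sqint_measurable borel_measurable_integrable[OF integrable_Re[OF i]]) (auto simp: eq_commute)
  also have "\<dots> = U f \<bullet> U g" unfolding U_def by (rule inner_abs_l2[symmetric]) (intro emb_sqint assms)+
  finally show ?thesis .
qed

lemma Im_ip: assumes "LL f" "LL g" shows "Im (ip f g) = U f \<bullet> imul (U g)"
proof -
  have "(\<lambda>x. f x * cnj (\<i> * g x) * complex_of_real (r x)) = (\<lambda>x. - \<i> * (f x * cnj (g x) * complex_of_real (r x)))"
    by (simp add: fun_eq_iff)
  then have "ip f (\<lambda>x. \<i> * g x) = - \<i> * ip f g"
    unfolding inner_L2_def by (simp only: set_integral_mult_right)
  then have "Im (ip f g) = Re (ip f (\<lambda>x. \<i> * g x))" by simp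
  also have "\<dots> = U f \<bullet> imul (U g)" using assms by (simp add: Re_ip L2_cmult U_imul)
  finally show ?thesis .
qed

lemma ip_eq: "LL f \<Longrightarrow> LL g \<Longrightarrow> ip f g = Complex (U f \<bullet> U g) (U f \<bullet> imul (U g))"
  by (simp add: complex_eq_iff Re_ip Im_ip)

lemma ip_add_left: "LL f \<Longrightarrow> LL g \<Longrightarrow> LL h \<Longrightarrow> ip (\<lambda>x. f x + g x) h = ip f h + ip g h"
  by (simp add: ip_eq L2_add U_add inner_add_left complex_eq_iff)

lemma ip_cmult_left: "LL f \<Longrightarrow> LL h \<Longrightarrow> ip (\<lambda>x. c * f x) h = c * ip f h"
  by (simp add: ip_eq L2_cmult U_cmult inner_add_left complex_eq_iff imul_inner_left imul_imul)

lemma ip_commute: assumes "LL f" "LL g" shows "ip g f = cnj (ip f g)"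
proof -
  have "U g \<bullet> imul (U f) = - (U f \<bullet> imul (U g))"
    by (subst inner_commute) (rule imul_inner_left)
  then show ?thesis using assms by (simp add: ip_eq complex_eq_iff inner_commute[of "U g" "U f"])
qed

lemma ip_add_right: assumes "LL f" "LL g" "LL h" shows "ip h (\<lambda>x. f x + g x) = ip h f + ip h g"
proof -
  have "ip h (\<lambda>x. f x + g x) = cnj (ip (\<lambda>x. f x + g x) h)" by (rule ip_commute) (intro L2_add assms)+
  also have "\<dots> = cnj (ip f h) + cnj (ip g h)" by (simp add: ip_add_left assms)
  finally show ?thesis by (simp only: ip_commute[OF assms(1,3)] ip_commute[OF assms(2,3)])
qed

lemma ip_cmult_right: assumes "LL f" "LL h" shows "ip h (\<lambda>x. c * f x) = cnj c * ip h f"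
proof -
  have "ip h (\<lambda>x. c * f x) = cnj (ip (\<lambda>x. c * f x) h)" by (rule ip_commute) (intro L2_cmult assms)+
  also have "\<dots> = cnj c * cnj (ip f h)" by (simp add: ip_cmult_left assms)
  finally show ?thesis by (simp only: ip_commute[OF assms])
qed

lemma ip_cong: "LL f \<Longrightarrow> LL f' \<Longrightarrow> eqv f f' \<Longrightarrow> LL g \<Longrightarrow> LL g' \<Longrightarrow> eqv g g' \<Longrightarrow> ip f g = ip f' g'"
  by (simp add: ip_eq flip: U_eq_iff)

lemma ip_self_nonneg: "LL f \<Longrightarrow> 0 \<le> Re (ip f f)"
  by (simp add: Re_ip)

lemma ip_self: assumes "LL f" shows "ip f f = complex_of_real (Re (ip f f))"
proof -
  have "U f \<bullet> imul (U f) = 0" using imul_inner_left[of "U f" "U f"] by (simp add: inner_commute[of "imul (U f)"])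
  then show ?thesis using assms by (simp add: complex_eq_iff Im_ip)
qed

lemma ip_self_eq_0: assumes "LL f" shows "ip f f = 0 \<longleftrightarrow> eqv f (\<lambda>_. 0)"
proof -
  have "ip f f = 0 \<longleftrightarrow> Re (ip f f) = 0" by (subst ip_self[OF assms]) simp
  also have "\<dots> \<longleftrightarrow> U f = U (\<lambda>_. 0)" by (simp add: Re_ip assms U_zero)
  also have "\<dots> \<longleftrightarrow> eqv f (\<lambda>_. 0)" by (rule U_eq_iff[OF assms L2_zero])
  finally show ?thesis .
qed

lemma eqv_refl [simp]: "eqv f f"
  by (simp add: ae_eq_def)

lemma eqv_sym: "eqv f g \<Longrightarrow> eqv g f"
  by (auto simp: ae_eq_def elim!: AE_mp)

lemma eqv_trans: "eqv f g \<Longrightarrow> eqv g h \<Longrightarrow> eqv f h"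
  by (auto simp: ae_eq_def elim!: AE_mp)


text \<open>The image of $f \mapsto \sqrt r f$ is only a closed subspace of $L^2(\mathbb R)$. Adding $\{0\} \times$ its
  orthogonal complement to a graph keeps self-adjointness, at the price of working with linear relations.\<close>

definition range_perp :: "l2 set" where "range_perp = {k. \<forall>f. LL f \<longrightarrow> U f \<bullet> k = 0}"

lemma range_perp_inner: "k \<in> range_perp \<Longrightarrow> LL f \<Longrightarrow> U f \<bullet> k = 0"
  by (simp add: range_perp_def)

lemma zero_in_range_perp: "0 \<in> range_perp" and add_in_range_perp: "k \<in> range_perp \<Longrightarrow> k' \<in> range_perp \<Longrightarrow> k + k' \<in> range_perp"
  and diff_in_range_perp: "k \<in> range_perp \<Longrightarrow> k' \<in> range_perp \<Longrightarrow> k - k' \<in> range_perp"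
  by (simp_all add: range_perp_def inner_simps)

lemma imul_in_range_perp: "k \<in> range_perp \<Longrightarrow> imul k \<in> range_perp"
  unfolding range_perp_def
proof safe
  fix f assume k: "\<forall>f. LL f \<longrightarrow> U f \<bullet> k = 0" and f: "LL f"
  have "imul (U f) \<bullet> k = 0" using k L2_cmult[OF f] U_imul[OF f] by metis
  then show "U f \<bullet> imul k = 0" by (simp add: imul_inner_left)
qed

lemma U_range_perp_unique: assumes "LL f" "LL g" "U f - U g \<in> range_perp" shows "U f = U g"
proof -
  have "U (\<lambda>x. f x - g x) \<bullet> (U f - U g) = 0" using assms by (intro range_perp_inner L2_diff)
  then show ?thesis using assms by (simp add: U_diff)
qed

text \<open>The projection onto the image of \<open>U\<close> is explicit: restrict to
  \<open>I\<close>, with preimage obtained by division by the root of \<open>r\<close>. The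
  remainder vanishes on \<open>I\<close> and is orthogonal to everything supported there.\<close>

lemma l2_decomp: obtains g k where "LL g" "k \<in> range_perp" "y = U g + k"
proof -
  obtain h where h: "sqint h" "y = abs_l2 h" by (rule l2_rep_exists)
  define g where "g x = h x / complex_of_real (sqrt (indicator I x * r x))" for x
  have gm: "(\<lambda>x. indicator I x *\<^sub>R g x) \<in> borel_measurable lebesgue"
    unfolding g_def using sqint_measurable[OF h(1)] r_meas' by measurable
  have eg: "AE x in lebesgue. emb g x = indicator I x * h x"
    using r_pos by eventually_elim (auto simp: emb_def g_def)
  have sh: "sqint (\<lambda>x. indicator I x * h x)"
    by (rule sqint_bounded_mult[OF h(1), of _ 1]) (auto simp: indicator_def)
  have sg: "sqint (emb g)"
  proof -
    have [measurable]: "emb g \<in> borel_measurable lebesgue" by (rule emb_meas[OF gm])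
    have [measurable]: "(\<lambda>x. indicator I x * h x) \<in> borel_measurable lebesgue" by (rule sqint_measurable[OF sh])
    have "AE x in lebesgue. (cmod (emb g x))\<^sup>2 = (cmod (indicator I x * h x))\<^sup>2"
      using eg by eventually_elim simp
    then have "integrable lebesgue (\<lambda>x. (cmod (emb g x))\<^sup>2) \<longleftrightarrow> integrable lebesgue (\<lambda>x. (cmod (indicator I x * h x))\<^sup>2)"
      by (intro integrable_cong_AE) measurable
    with sqint_integrable[OF sh] show ?thesis by (simp add: sqint_def)
  qed
  have g: "LL g" by (rule L2_I_emb[OF gm sg])
  have Ug: "U g = abs_l2 (\<lambda>x. indicator I x * h x)" unfolding U_def by (simp add: abs_l2_eq_iff sg sh eg)
  have "y - U g \<in> range_perp" unfolding range_perp_def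
  proof safe
    fix f assume f: "LL f"
    have "U f \<bullet> (y - U g) = (\<integral>x. emb f x \<bullet> (h x - indicator I x * h x) \<partial>lebesgue)"
      unfolding Ug h(2) unfolding U_def by (simp add: abs_l2_diff h sh inner_abs_l2 sqint_diff emb_sqint[OF f])
    also have "(\<lambda>x. emb f x \<bullet> (h x - indicator I x * h x)) = (\<lambda>_. 0)"
      by (auto simp: fun_eq_iff emb_def)
    finally show "U f \<bullet> (y - U g) = 0" by simp
  qed
  with g show ?thesis by (intro that[of g "y - U g"]) auto
qed

section \<open>Transport of graphs between the weighted space and \<open>l2\<close>\<close>

definition up :: "graph \<Rightarrow> (l2 \<times> l2) set" where
  "up G = {(x, y). \<exists>f g k. (f, g) \<in> G \<and> k \<in> range_perp \<and> x = U f \<and> y = U g + k}"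

definition down :: "(l2 \<times> l2) set \<Rightarrow> graph" where
  "down T = {(f, g). LL f \<and> LL g \<and> (U f, U g) \<in> T}"

lemma upI: "(f, g) \<in> G \<Longrightarrow> k \<in> range_perp \<Longrightarrow> (U f, U g + k) \<in> up G"
  by (auto simp: up_def)

lemma upE: assumes "(x, y) \<in> up G" obtains f g k where "(f, g) \<in> G" "k \<in> range_perp" "x = U f" "y = U g + k"
  using assms by (auto simp: up_def)

lemma adjoint_iff: "(u, v) \<in> adjoint a b r G \<longleftrightarrow> LL u \<and> LL v \<and> (\<forall>f g. (f, g) \<in> G \<longrightarrow> ip g u = ip f v)"
  by (auto simp: adjoint_def)

lemma sat_iff: "(u, v) \<in> sat a b r G \<longleftrightarrow> LL u \<and> LL v \<and> (\<exists>f g. (f, g) \<in> G \<and> eqv u f \<and> eqv v g)"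
  by (auto simp: sat_def)

lemma L2_pairsD: "G \<subseteq> L2_pairs a b r \<Longrightarrow> (f, g) \<in> G \<Longrightarrow> LL f \<and> LL g"
  by (auto simp: L2_pairs_def)

lemma adjoint_L2: "adjoint a b r G \<subseteq> L2_pairs a b r"
  by (auto simp: adjoint_def L2_pairs_def)

lemma subset_sat: "G \<subseteq> L2_pairs a b r \<Longrightarrow> G \<subseteq> sat a b r G"
  by (force simp: sat_iff L2_pairs_def)

lemma adjoint_antimono: "G \<subseteq> H \<Longrightarrow> adjoint a b r H \<subseteq> adjoint a b r G"
  by (auto simp: adjoint_def)

lemma adjoint_sat:
  assumes G: "G \<subseteq> L2_pairs a b r"
  shows "adjoint a b r (sat a b r G) = adjoint a b r G"
proof
  show "adjoint a b r (sat a b r G) \<subseteq> adjoint a b r G" by (rule adjoint_antimono[OF subset_sat[OF G]])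
  show "adjoint a b r G \<subseteq> adjoint a b r (sat a b r G)"
  proof (clarify)
    fix u v assume uv: "(u, v) \<in> adjoint a b r G"
    show "(u, v) \<in> adjoint a b r (sat a b r G)" unfolding adjoint_iff
    proof (intro conjI allI impI)
      show u: "LL u" and v: "LL v" using uv by (auto simp: adjoint_iff)
      fix f g assume "(f, g) \<in> sat a b r G"
      then obtain f' g' where fg: "LL f" "LL g" "(f', g') \<in> G" "eqv f f'" "eqv g g'" by (auto simp: sat_iff)
      have "ip g' u = ip f' v" using uv fg(3) by (auto simp: adjoint_iff)
      moreover have "LL f'" "LL g'" using G fg(3) by (auto simp: L2_pairs_def)
      ultimately show "ip g u = ip f v"
        using ip_cong[of g g' u u] ip_cong[of f f' v v] fg u v by simp
    qed
  qed
qed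

lemma adjoint_cmult:
  assumes G: "G \<subseteq> L2_pairs a b r" and uv: "(u, v) \<in> adjoint a b r G"
  shows "((\<lambda>x. c * u x), (\<lambda>x. c * v x)) \<in> adjoint a b r G"
proof -
  have L: "LL u" "LL v" using uv by (auto simp: adjoint_iff)
  have "ip g (\<lambda>x. c * u x) = ip f (\<lambda>x. c * v x)" if fg: "(f, g) \<in> G" for f g
    using uv fg L L2_pairsD[OF G fg] by (simp add: adjoint_iff ip_cmult_right)
  with L show ?thesis by (simp add: adjoint_iff L2_cmult)
qed

lemma adjoint_eqv:
  assumes G: "G \<subseteq> L2_pairs a b r" and "(u, v) \<in> adjoint a b r G" "LL u'" "LL v'" "eqv u u'" "eqv v v'"
  shows "(u', v') \<in> adjoint a b r G"
proof -
  have L: "LL u" "LL v" using assms(2) by (auto simp: adjoint_iff)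
  have "ip g u = ip g u'" "ip f v = ip f v'" if "(f, g) \<in> G" for f g
    using L2_pairsD[OF G that] L assms(3-6) by (auto intro: ip_cong)
  then show ?thesis using assms by (simp add: adjoint_iff)
qed

end

text \<open>A graph equal to its adjoint contains all representatives modulo null sets, so
  \<open>sat\<close> acts on it as the identity. Square roots are selected in exactly this
  form.\<close>

locale closed_sa = weighted_L2 +
  fixes H :: graph
  assumes H: "H = adjoint a b r H"
begin

lemma H_mem: "(f, g) \<in> H \<longleftrightarrow> (f, g) \<in> adjoint a b r H"
  unfolding H[symmetric] ..

lemma H_L2: "(f, g) \<in> H \<Longrightarrow> LL f" "(f, g) \<in> H \<Longrightarrow> LL g"
  unfolding H_mem by (auto simp: adjoint_iff)

lemma H_L2_pairs: "H \<subseteq> L2_pairs a b r"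
  by (subst H) (rule adjoint_L2)

lemma H_cmult: "(f, g) \<in> H \<Longrightarrow> ((\<lambda>x. c * f x), (\<lambda>x. c * g x)) \<in> H"
  using adjoint_cmult[OF H_L2_pairs] unfolding H[symmetric] .

lemma H_eqv: "(f, g) \<in> H \<Longrightarrow> LL f' \<Longrightarrow> LL g' \<Longrightarrow> eqv f f' \<Longrightarrow> eqv g g' \<Longrightarrow> (f', g') \<in> H"
  using adjoint_eqv[OF H_L2_pairs] unfolding H[symmetric] .

lemma H_sym: "(f, g) \<in> H \<Longrightarrow> (f', g') \<in> H \<Longrightarrow> ip g f' = ip f g'"
  unfolding H_mem[of f' g'] by (auto simp: adjoint_iff)

lemma H_zero: "((\<lambda>_. 0), (\<lambda>_. 0)) \<in> H"
proof -
  have "((\<lambda>_. 0), (\<lambda>_. 0)) \<in> adjoint a b r H"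
    using H_L2 L2_zero by (auto simp: adjoint_iff inner_L2_def)
  with H show ?thesis by simp
qed

lemma H_Re_ip_real: assumes "(f, g) \<in> H" shows "ip g f \<in> \<real>"
proof -
  have "ip g f = cnj (ip g f)" using H_sym[OF assms assms] ip_commute[OF H_L2[OF assms]] by simp
  then show ?thesis by (metis Reals_cnj_iff)
qed

lemma sat_H: "sat a b r H = H"
proof
  show "sat a b r H \<subseteq> H"
  proof clarify
    fix u v assume "(u, v) \<in> sat a b r H"
    then obtain f g where *: "LL u" "LL v" "(f, g) \<in> H" "eqv u f" "eqv v g" by (auto simp: sat_iff)
    show "(u, v) \<in> H" by (rule H_eqv[OF *(3,1,2) eqv_sym[OF *(4)] eqv_sym[OF *(5)]])
  qed
qed (rule subset_sat[OF H_L2_pairs])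

lemma up_mem_iff:
  assumes "LL f" "LL g"
  shows "(U f, U g) \<in> up H \<longleftrightarrow> (f, g) \<in> H"
proof
  assume "(U f, U g) \<in> up H"
  then obtain f' g' k where *: "(f', g') \<in> H" "k \<in> range_perp" "U f = U f'" "U g = U g' + k" by (rule upE)
  then have "U g - U g' \<in> range_perp" by simp
  then have "U g = U g'" using assms H_L2[OF *(1)] by (intro U_range_perp_unique)
  with * assms H_L2[OF *(1)] have "eqv f' f" "eqv g' g" by (simp_all flip: U_eq_iff)
  with H_eqv[OF *(1) assms] show "(f, g) \<in> H" by blast
next
  assume "(f, g) \<in> H"
  from upI[OF this zero_in_range_perp] show "(U f, U g) \<in> up H" by simp
qed

lemma down_up: "down (up H) = H"
proof (intro set_eqI iffI; clarify)
  fix f g assume "(f, g) \<in> down (up H)" then show "(f, g) \<in> H" by (auto simp: down_def up_mem_iff)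
next
  fix f g assume "(f, g) \<in> H" then show "(f, g) \<in> down (up H)" using H_L2[of f g] by (simp add: down_def up_mem_iff)
qed

text \<open>The orthogonal complement cancels in the symmetry identity. Conversely, pairs (0, k)
  with k in the complement confine the domain of the adjoint to the image of \<open>U\<close>, and
  there the complex adjoint condition of \<open>H\<close> takes over.\<close>

lemma up_sa: "up H = adjr (up H)"
proof (intro set_eqI iffI; clarify)
  fix x y assume "(x, y) \<in> up H"
  then obtain u v l where uv: "(u, v) \<in> H" "l \<in> range_perp" "x = U u" "y = U v + l" by (rule upE)
  show "(x, y) \<in> adjr (up H)" unfolding adjr_iff
  proof (intro allI impI)
    fix x' y' assume "(x', y') \<in> up H"
    then obtain f g k where fg: "(f, g) \<in> H" "k \<in> range_perp" "x' = U f" "y' = U g + k" by (rule upE)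
    have "U g \<bullet> U u = U f \<bullet> U v"
      using H_sym[OF fg(1) uv(1)] H_L2[OF fg(1)] H_L2[OF uv(1)] by (simp flip: Re_ip)
    moreover have "k \<bullet> U u = 0" "U f \<bullet> l = 0"
      using range_perp_inner[OF fg(2)] range_perp_inner[OF uv(2)] H_L2[OF fg(1)] H_L2[OF uv(1)] by (simp_all add: inner_commute)
    ultimately show "y' \<bullet> x = x' \<bullet> y" by (simp add: uv fg inner_simps)
  qed
next
  fix x y assume xy: "(x, y) \<in> adjr (up H)"
  obtain u k where u: "LL u" "k \<in> range_perp" "x = U u + k" by (rule l2_decomp)
  obtain v l where v: "LL v" "l \<in> range_perp" "y = U v + l" by (rule l2_decomp)
  \<comment> \<open>Pairing with this element removes the component of x in the orthogonal
    complement.\<close>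
  have "(U (\<lambda>_. 0), U (\<lambda>_. 0) + k) \<in> up H" by (rule upI[OF H_zero u(2)])
  with xy have "k \<bullet> x = 0" by (force simp: adjr_iff U_zero)
  then have "k \<bullet> k = 0" using range_perp_inner[OF u(2,1)] by (simp add: u(3) inner_simps inner_commute)
  then have x: "x = U u" by (simp add: u(3))
  have *: "U g \<bullet> U u = U f \<bullet> U v" if "(f, g) \<in> H" for f g
  proof -
    have "(U f, U g) \<in> up H" using up_mem_iff H_L2[OF that] that by blast
    with xy have "U g \<bullet> x = U f \<bullet> y" by (auto simp: adjr_iff)
    then show ?thesis using range_perp_inner[OF v(2)] H_L2[OF that] by (simp add: x v(3) inner_simps)
  qed
  have "(u, v) \<in> adjoint a b r H" unfolding adjoint_iff
  proof (intro conjI allI impI u(1) v(1))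
    fix f g assume fg: "(f, g) \<in> H"
    \<comment> \<open>The real identity for (f, g) gives the real part of the complex one; the same
      identity for (i f, i g) gives the imaginary part.\<close>
    from *[OF fg] *[OF H_cmult[OF fg, of \<i>]] H_L2[OF fg] u(1) v(1) show "ip g u = ip f v"
      by (simp add: ip_eq U_imul imul_inner_left)
  qed
  with H have "(u, v) \<in> H" by simp
  from upI[OF this v(2)] show "(x, y) \<in> up H" by (simp add: x v(3))
qed

end

context weighted_L2
begin

lemma dom_in_range_U:
  assumes T: "T = adjr T" and TN: "\<And>k. k \<in> range_perp \<Longrightarrow> (0, k) \<in> T" and xy: "(x, y) \<in> T"
  obtains f where "LL f" "x = U f"
proof -
  interpret T: sa_rel T using T by unfold_locales
  obtain u k where u: "LL u" "k \<in> range_perp" "x = U u + k" by (rule l2_decomp)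
  have "k \<bullet> x = 0 \<bullet> y" by (rule T.sym[OF TN[OF u(2)] xy])
  then have "k \<bullet> k = 0" using range_perp_inner[OF u(2,1)] by (simp add: u(3) inner_simps inner_commute)
  with u that show ?thesis by auto
qed

text \<open>Real self-adjointness yields only real parts of the adjoint identity. Invariance under
  multiplication by i supplies the imaginary parts, and the pairs (0, k) keep the domain inside the
  image of \<open>U\<close>.\<close>

lemma down_closed_sa:
  assumes T: "T = adjr T" and TN: "\<And>k. k \<in> range_perp \<Longrightarrow> (0, k) \<in> T"
    and TJ: "\<And>x y. (x, y) \<in> T \<Longrightarrow> (imul x, imul y) \<in> T"
  shows "down T = adjoint a b r (down T)"
proof -
  interpret T: sa_rel T using T by unfold_locales
  show "down T = adjoint a b r (down T)"
  proof (intro set_eqI iffI; clarify)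
    fix u v assume uv: "(u, v) \<in> down T"
    then have L: "LL u" "LL v" and m: "(U u, U v) \<in> T" by (auto simp: down_def)
    show "(u, v) \<in> adjoint a b r (down T)" unfolding adjoint_iff
    proof (intro conjI L allI impI)
      fix f g assume "(f, g) \<in> down T"
      then have fg: "LL f" "LL g" "(U f, U g) \<in> T" by (auto simp: down_def)
      from T.sym[OF fg(3) m] T.sym[OF fg(3) TJ[OF m]] show "ip g u = ip f v"
        using L fg by (simp add: ip_eq)
    qed
  next
    fix u v assume uv: "(u, v) \<in> adjoint a b r (down T)"
    then have L: "LL u" "LL v" by (auto simp: adjoint_iff)
    have "(U u, U v) \<in> T"
    proof (rule T.memI)
      fix x y assume xy: "(x, y) \<in> T"
      obtain f where f: "LL f" "x = U f" using dom_in_range_U[OF T TN xy] .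
      obtain g k where g: "LL g" "k \<in> range_perp" "y = U g + k" by (rule l2_decomp)
      have "(U f, U g) \<in> T" using T.diff_mem[OF xy TN[OF g(2)]] by (simp add: f g)
      then have "(f, g) \<in> down T" using f g by (simp add: down_def)
      with uv have "ip g u = ip f v" by (auto simp: adjoint_iff)
      then have "U g \<bullet> U u = U f \<bullet> U v" using f g L by (simp flip: Re_ip)
      then show "y \<bullet> U u = x \<bullet> U v" using range_perp_inner[OF g(2) L(1)] by (simp add: f g inner_simps inner_commute)
    qed
    with L show "(u, v) \<in> down T" by (simp add: down_def)
  qed
qed

text \<open>For nonnegative self-adjoint $G$ this says that $f \in \mathrm{dom}(G^{1/2})$ and $\|G^{1/2} f\|^2 \le M$.\<close>

definition form_bound :: "graph \<Rightarrow> fn \<Rightarrow> real \<Rightarrow> bool" where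
  "form_bound G f M \<longleftrightarrow> (\<forall>(g, h)\<in>G. (cmod (ip f h))\<^sup>2 \<le> M * Re (ip h g))"

text \<open>The predicate under the definite description of \<open>sqrt_op\<close>, named so that
  its unique solvability can be stated.\<close>

definition sqrt_spec :: "graph \<Rightarrow> graph \<Rightarrow> bool" where
  "sqrt_spec A S \<longleftrightarrow> S = adjoint a b r S \<and> single_valued_op a b r S \<and> nonneg_op a b r S \<and>
      sat a b r (S O S) = sat a b r A"

lemma unimodular_rotation: obtains w :: complex where "cmod w = 1" "cnj w * z = complex_of_real (cmod z)"
proof (cases "z = 0")
  case True
  then show ?thesis using that[of 1] by simp
next
  case False
  then have "cnj (z / complex_of_real (cmod z)) * z = complex_of_real ((cmod z)\<^sup>2) / complex_of_real (cmod z)"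
    by (simp add: complex_norm_square mult.commute del: of_real_power)
  also have "\<dots> = complex_of_real (cmod z)" using False by (simp add: power2_eq_square)
  finally have "cnj (z / complex_of_real (cmod z)) * z = complex_of_real (cmod z)" .
  with False show ?thesis using that[of "z / complex_of_real (cmod z)"] by (simp add: norm_divide)
qed

text \<open>The root \<open>T\<close> of the enlarged relation \<open>up H\<close> is pulled back to
  functions. Uniqueness is transported in the other direction: for any admissible graph
  \<open>S'\<close> the relation \<open>up S'\<close> is a root of the same relation. The form
  criterion changes from real to complex pairings through multiplication by a phase.\<close>

lemma sqrt_op_exists:
  assumes G: "nonneg_sa a b r G"
  obtains S where "sqrt_spec G S" "\<And>S'. sqrt_spec G S' \<Longrightarrow> S' = S"
    "\<And>f M. LL f \<Longrightarrow> 0 \<le> M \<Longrightarrow> (\<exists>y. (f, y) \<in> S \<and> (norm_L2 a b r y)\<^sup>2 \<le> M) \<longleftrightarrow> form_bound G f M"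
proof -
  define H where "H = sat a b r G"
  have GL: "G \<subseteq> L2_pairs a b r" and sv: "single_valued_op a b r G" and nn: "nonneg_op a b r G"
    using G by (auto simp: nonneg_sa_def self_adjoint_op_def single_valued_op_def)
  have GH: "G \<subseteq> H" unfolding H_def by (rule subset_sat[OF GL])
  have "H = adjoint a b r G" using G by (simp add: H_def nonneg_sa_def self_adjoint_op_def)
  then have "H = adjoint a b r H" using adjoint_sat[OF GL] by (simp add: H_def)
  then interpret H: closed_sa a b r H by unfold_locales
  have HG: "\<exists>f' g'. (f', g') \<in> G \<and> U f = U f' \<and> U g = U g'" if "(f, g) \<in> H" for f g
  proof -
    from that obtain f' g' where *: "(f', g') \<in> G" "eqv f f'" "eqv g g'" unfolding H_def sat_iff by blast
    then have "U f = U f'" "U g = U g'" using L2_pairsD[OF GL *(1)] H.H_L2[OF that] by (simp_all add: U_eq_iff)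
    with *(1) show ?thesis by blast
  qed
  have nnH: "0 \<le> U g \<bullet> U f" if fg: "(f, g) \<in> H" for f g
  proof -
    obtain f' g' where *: "(f', g') \<in> G" "U f = U f'" "U g = U g'" using HG[OF fg] by blast
    have "0 \<le> Re (ip g' f')" using nn *(1) by (auto simp: nonneg_op_def)
    then show ?thesis using * L2_pairsD[OF GL *(1)] by (simp add: Re_ip)
  qed
  have svH: "U g = 0" if fg: "(f, g) \<in> H" "U f = 0" for f g
  proof -
    obtain f1 g1 where 1: "(f1, g1) \<in> G" "U f = U f1" "U g = U g1" using HG[OF fg(1)] by blast
    obtain f0 g0 where 0: "(f0, g0) \<in> G" "U (\<lambda>_. 0) = U f0" "U (\<lambda>_. 0) = U g0" using HG[OF H.H_zero] by blast
    have "U f1 = U f0" using 1 0 fg by (simp add: U_zero)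
    then have "eqv f1 f0" using L2_pairsD[OF GL 1(1)] L2_pairsD[OF GL 0(1)] by (simp add: U_eq_iff)
    then have "eqv g1 g0" using sv 1(1) 0(1) by (fastforce simp: single_valued_op_def)
    then have "U g1 = U g0" using L2_pairsD[OF GL 1(1)] L2_pairsD[OF GL 0(1)] by (simp add: U_eq_iff)
    then show ?thesis using 1 0 by (simp add: U_zero)
  qed
  define A where "A = up H"
  interpret A: nonneg_sa_rel A
  proof
    show "A = adjr A" unfolding A_def by (rule H.up_sa)
    show "nonneg_rel A" unfolding nonneg_rel_def
    proof clarify
      fix x y assume "(x, y) \<in> A"
      then obtain f g k where *: "(f, g) \<in> H" "k \<in> range_perp" "x = U f" "y = U g + k" unfolding A_def by (rule upE)
      then show "0 \<le> y \<bullet> x" using nnH[OF *(1)] range_perp_inner[OF *(2)] H.H_L2[OF *(1)]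
        by (simp add: inner_add_left inner_commute[of k])
    qed
  qed
  obtain T where T: "is_sqrt_rel A T" and Tu: "\<And>T'. is_sqrt_rel A T' \<Longrightarrow> T' = T"
    and form: "\<And>f M. 0 \<le> M \<Longrightarrow> (\<exists>y. (f, y) \<in> T \<and> y \<bullet> y \<le> M) \<longleftrightarrow> (\<forall>(g, h)\<in>A. (f \<bullet> h)\<^sup>2 \<le> M * (h \<bullet> g))"
    by (rule A.sqrt_rel_data, rule that)
  interpret T: nonneg_sa_rel T using T by unfold_locales (auto simp: is_sqrt_rel_def)
  have TT: "T O T = A" using T by (simp add: is_sqrt_rel_def)
  have AN: "(0, k) \<in> A" if "k \<in> range_perp" for k
    using upI[OF H.H_zero that] by (simp add: A_def U_zero)
  have TN: "(0, k) \<in> T" if k: "k \<in> range_perp" for k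
  proof -
    \<comment> \<open>Symmetry applied to (0, z) and (z, k) gives z . z = 0, so \<open>T\<close>
      inherits the multivalued part of \<open>A\<close>.\<close>
    obtain z where z: "(0, z) \<in> T" "(z, k) \<in> T" using AN[OF k] TT by blast
    from T.sym[OF z(1,2)] have "z = 0" by simp
    with z show ?thesis by simp
  qed
  have AJ: "(imul x, imul y) \<in> A" if "(x, y) \<in> A" for x y
  proof -
    from that obtain f g k where *: "(f, g) \<in> H" "k \<in> range_perp" "x = U f" "y = U g + k" unfolding A_def by (rule upE)
    have "(U (\<lambda>x. \<i> * f x), U (\<lambda>x. \<i> * g x) + imul k) \<in> A"
      unfolding A_def by (intro upI H.H_cmult imul_in_range_perp *)
    then show ?thesis using H.H_L2[OF *(1)] by (simp add: * imul_add U_imul)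
  qed
  \<comment> \<open>The conjugate of \<open>T\<close> by i is again a root of \<open>A\<close>,
    since \<open>A\<close> is invariant under i. Uniqueness of the real root identifies it with
    \<open>T\<close> and makes \<open>T\<close> complex linear.\<close>
  define T' where "T' = {(imul x, imul y) | x y. (x, y) \<in> T}"
  have T'_iff: "(x, y) \<in> T' \<longleftrightarrow> (- imul x, - imul y) \<in> T" for x y
  proof
    assume "(x, y) \<in> T'"
    then show "(- imul x, - imul y) \<in> T" by (auto simp: T'_def imul_imul)
  next
    assume "(- imul x, - imul y) \<in> T"
    then have "(imul (- imul x), imul (- imul y)) \<in> T'" unfolding T'_def by blast
    then show "(x, y) \<in> T'" by (simp add: imul_minus imul_imul)
  qed
  have "is_sqrt_rel A T'" unfolding is_sqrt_rel_def
  proof (intro conjI)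
    show "T' = adjr T'"
    proof (intro set_eqI iffI; clarify)
      fix u v assume uv: "(u, v) \<in> T'"
      show "(u, v) \<in> adjr T'" unfolding adjr_iff
      proof (intro allI impI)
        fix f g assume "(f, g) \<in> T'"
        with uv have "(- imul g) \<bullet> (- imul u) = (- imul f) \<bullet> (- imul v)" unfolding T'_iff by (intro T.sym)
        then show "g \<bullet> u = f \<bullet> v" by (simp add: imul_inner)
      qed
    next
      fix u v assume uv: "(u, v) \<in> adjr T'"
      show "(u, v) \<in> T'" unfolding T'_iff
      proof (rule T.memI)
        fix f g assume "(f, g) \<in> T"
        then have "(imul f, imul g) \<in> T'" by (auto simp: T'_def)
        with uv have "imul g \<bullet> u = imul f \<bullet> v" by (auto simp: adjr_iff)
        then show "g \<bullet> - imul u = f \<bullet> - imul v" by (simp add: imul_inner_left)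
      qed
    qed
    show "nonneg_rel T'" using T.nonnegD by (auto simp: nonneg_rel_def T'_def imul_inner)
    show "T' O T' = A"
    proof (intro set_eqI iffI; clarify)
      fix x y z assume "(x, y) \<in> T'" "(y, z) \<in> T'"
      then have "(- imul x, - imul z) \<in> A" unfolding T'_iff TT[symmetric] by blast
      from AJ[OF this] show "(x, z) \<in> A" by (simp add: imul_minus imul_imul)
    next
      fix x z assume "(x, z) \<in> A"
      from A.scale_mem[OF AJ[OF this], of "-1"] obtain y where "(- imul x, y) \<in> T" "(y, - imul z) \<in> T"
        unfolding TT[symmetric] by auto
      then have "(x, imul y) \<in> T'" "(imul y, z) \<in> T'" unfolding T'_iff by (simp_all add: imul_imul)
      then show "(x, z) \<in> T' O T'" by blast
    qed
  qed
  from Tu[OF this] have TJ: "(imul x, imul y) \<in> T" if "(x, y) \<in> T" for x y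
    using that by (auto simp: T'_def)
  define S where "S = down T"
  have Sadj: "S = adjoint a b r S" unfolding S_def by (rule down_closed_sa[OF T.sa TN TJ])
  interpret S: closed_sa a b r S using Sadj by unfold_locales
  have S_iff: "(f, g) \<in> S \<longleftrightarrow> LL f \<and> LL g \<and> (U f, U g) \<in> T" for f g by (simp add: S_def down_def)
  have SS: "(f, h) \<in> S O S \<longleftrightarrow> (f, h) \<in> H" for f h
  proof
    assume "(f, h) \<in> S O S"
    then obtain g where "(f, g) \<in> S" "(g, h) \<in> S" by blast
    then have "LL f" "LL h" "(U f, U h) \<in> A" unfolding S_iff TT[symmetric] by auto
    then show "(f, h) \<in> H" using H.up_mem_iff unfolding A_def by blast
  next
    assume fh: "(f, h) \<in> H"
    then have L: "LL f" "LL h" using H.H_L2 by auto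
    with fh have "(U f, U h) \<in> T O T" unfolding TT A_def by (simp add: H.up_mem_iff)
    then obtain y where y: "(U f, y) \<in> T" "(y, U h) \<in> T" by blast
    obtain g where "LL g" "y = U g" using dom_in_range_U[OF T.sa TN y(2)] .
    with y L have "(f, g) \<in> S" "(g, h) \<in> S" by (auto simp: S_iff)
    then show "(f, h) \<in> S O S" by blast
  qed
  have spec: "sqrt_spec G S" unfolding sqrt_spec_def
  proof (intro conjI Sadj)
    show "single_valued_op a b r S" unfolding single_valued_op_def
    proof (intro conjI S.H_L2_pairs, clarify)
      fix f1 g1 f2 g2 assume 1: "(f1, g1) \<in> S" and 2: "(f2, g2) \<in> S" and e: "eqv f1 f2"
      have L: "LL f1" "LL g1" "LL f2" "LL g2" using S.H_L2[OF 1] S.H_L2[OF 2] by auto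
      define d where "d = U g1 - U g2"
      have d: "(0, d) \<in> T" using T.diff_mem[of "U f1" "U g1" "U f2" "U g2"] 1 2 e L by (simp add: S_iff d_def U_eq_iff[symmetric])
      \<comment> \<open>Preceding (0, d) by (0, 0) puts (0, d) into T O T = A, whose values over 0
        lie in the orthogonal complement because \<open>G\<close> is single valued.\<close>
      have "(0, 0) \<in> T" using T.diff_mem[OF d d] by simp
      with d have "(0, d) \<in> A" unfolding TT[symmetric] by blast
      then obtain f g k where *: "(f, g) \<in> H" "k \<in> range_perp" "0 = U f" "d = U g + k" unfolding A_def by (rule upE)
      have "U g = 0" using svH[OF *(1)] *(3) by simp
      then have "U g1 - U g2 \<in> range_perp" using * by (simp add: d_def)
      then have "U g1 = U g2" using L by (intro U_range_perp_unique)
      then show "eqv g1 g2" using L by (simp add: U_eq_iff)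
    qed
    show "nonneg_op a b r S" unfolding nonneg_op_def
    proof clarify
      fix f g assume fg: "(f, g) \<in> S"
      then show "ip g f \<in> \<real> \<and> 0 \<le> Re (ip g f)"
        using S.H_Re_ip_real[OF fg] T.nonnegD[of "U f" "U g"] by (simp add: S_iff Re_ip)
    qed
    have "S O S = H" using SS by auto
    then show "sat a b r (S O S) = sat a b r G" using H.sat_H by (simp add: H_def)
  qed
  have uniq: "S' = S" if S': "sqrt_spec G S'" for S'
  proof -
    have S'adj: "S' = adjoint a b r S'" and S'nn: "nonneg_op a b r S'" and S'sq: "sat a b r (S' O S') = H"
      using S' by (auto simp: sqrt_spec_def H_def)
    interpret S': closed_sa a b r S' using S'adj by unfold_locales
    have SS'L: "S' O S' \<subseteq> L2_pairs a b r" using S'.H_L2 by (auto simp: L2_pairs_def)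
    have "is_sqrt_rel A (up S')" unfolding is_sqrt_rel_def
    proof (intro conjI S'.up_sa)
      show "nonneg_rel (up S')" unfolding nonneg_rel_def
      proof clarify
        fix x y assume "(x, y) \<in> up S'"
        then obtain f g k where *: "(f, g) \<in> S'" "k \<in> range_perp" "x = U f" "y = U g + k" by (rule upE)
        have "0 \<le> Re (ip g f)" using S'nn *(1) by (auto simp: nonneg_op_def)
        then show "0 \<le> y \<bullet> x" using range_perp_inner[OF *(2)] S'.H_L2[OF *(1)]
          by (simp add: * Re_ip inner_add_left inner_commute[of k])
      qed
      show "up S' O up S' = A"
      proof (intro set_eqI iffI; clarify)
        fix x y z assume xy: "(x, y) \<in> up S'" and yz: "(y, z) \<in> up S'"
        obtain f g k where 1: "(f, g) \<in> S'" "k \<in> range_perp" "x = U f" "y = U g + k" using xy by (rule upE)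
        obtain g' h l where 2: "(g', h) \<in> S'" "l \<in> range_perp" "y = U g'" "z = U h + l" using yz by (rule upE)
        have L: "LL f" "LL g" "LL g'" "LL h" using S'.H_L2[OF 1(1)] S'.H_L2[OF 2(1)] by auto
        have "U g' - U g \<in> range_perp" using 1 2 by (metis add_diff_cancel_left')
        then have "U g' = U g" using L by (intro U_range_perp_unique)
        then have "eqv g g'" using L by (simp flip: U_eq_iff)
        then have "(f, g') \<in> S'" using S'.H_eqv[OF 1(1)] L by simp
        with 2(1) have "(f, h) \<in> S' O S'" by blast
        then have "(f, h) \<in> H" using subset_sat[OF SS'L] S'sq by blast
        from upI[OF this 2(2)] show "(x, z) \<in> A" by (simp add: A_def 1 2)
      next
        fix x z assume "(x, z) \<in> A"
        then obtain f h k where *: "(f, h) \<in> H" "k \<in> range_perp" "x = U f" "z = U h + k" unfolding A_def by (rule upE)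
        then have "(f, h) \<in> sat a b r (S' O S')" using S'sq by simp
        then obtain f0 g0 h0 where 0: "(f0, g0) \<in> S'" "(g0, h0) \<in> S'" "eqv f f0" "eqv h h0" unfolding sat_iff by blast
        have "U f = U f0" "U h = U h0" using 0 H.H_L2[OF *(1)] S'.H_L2[OF 0(1)] S'.H_L2[OF 0(2)] by (simp_all add: U_eq_iff)
        then have "(x, U g0) \<in> up S'" "(U g0, z) \<in> up S'"
          using upI[OF 0(1) zero_in_range_perp] upI[OF 0(2) *(2)] by (simp_all add: *)
        then show "(x, z) \<in> up S' O up S'" by blast
      qed
    qed
    from Tu[OF this] show "S' = S" using S'.down_up by (simp add: S_def)
  qed
  have bound: "(\<exists>y. (f, y) \<in> S \<and> (norm_L2 a b r y)\<^sup>2 \<le> M) \<longleftrightarrow> form_bound G f M" if f: "LL f" and M: "0 \<le> M" for f M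
  proof -
    have nrm: "(norm_L2 a b r y)\<^sup>2 = U y \<bullet> U y" if "LL y" for y
      using that by (simp add: norm_L2_def Re_ip)
    have "(\<exists>y. (f, y) \<in> S \<and> (norm_L2 a b r y)\<^sup>2 \<le> M) \<longleftrightarrow> (\<exists>y. (U f, y) \<in> T \<and> y \<bullet> y \<le> M)"
    proof
      assume "\<exists>y. (f, y) \<in> S \<and> (norm_L2 a b r y)\<^sup>2 \<le> M"
      then show "\<exists>y. (U f, y) \<in> T \<and> y \<bullet> y \<le> M" by (auto simp: S_iff nrm)
    next
      assume "\<exists>y. (U f, y) \<in> T \<and> y \<bullet> y \<le> M"
      then obtain y where y: "(U f, y) \<in> T" "y \<bullet> y \<le> M" by blast
      obtain g k where g: "LL g" "k \<in> range_perp" "y = U g + k" by (rule l2_decomp)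
      have "(U f, U g) \<in> T" using T.diff_mem[OF y(1) TN[OF g(2)]] by (simp add: g)
      moreover have "U g \<bullet> U g \<le> y \<bullet> y" using range_perp_inner[OF g(2,1)] by (simp add: g(3) inner_simps inner_commute)
      ultimately show "\<exists>y. (f, y) \<in> S \<and> (norm_L2 a b r y)\<^sup>2 \<le> M"
        using f g y(2) by (intro exI[of _ g]) (auto simp: S_iff nrm)
    qed
    also have "\<dots> \<longleftrightarrow> (\<forall>(g, h)\<in>A. (U f \<bullet> h)\<^sup>2 \<le> M * (h \<bullet> g))" by (rule form[OF M])
    also have "\<dots> \<longleftrightarrow> form_bound G f M"
    proof
      assume a: "\<forall>(g, h)\<in>A. (U f \<bullet> h)\<^sup>2 \<le> M * (h \<bullet> g)"
      show "form_bound G f M" unfolding form_bound_def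
      proof clarify
        fix g h assume gh: "(g, h) \<in> G"
        then have L: "LL g" "LL h" using L2_pairsD[OF GL] by auto
        \<comment> \<open>Rotating the test pair by a phase turns the real pairing into the modulus
          of the complex one and leaves the form value unchanged.\<close>
        obtain w where w: "cmod w = 1" "cnj w * ip f h = complex_of_real (cmod (ip f h))" by (rule unimodular_rotation)
        have "((\<lambda>x. w * g x), (\<lambda>x. w * h x)) \<in> H" using gh GH by (intro H.H_cmult) auto
        then have "(U (\<lambda>x. w * g x), U (\<lambda>x. w * h x)) \<in> A" unfolding A_def using L by (simp add: H.up_mem_iff L2_cmult)
        with a have "(U f \<bullet> U (\<lambda>x. w * h x))\<^sup>2 \<le> M * (U (\<lambda>x. w * h x) \<bullet> U (\<lambda>x. w * g x))" by auto
        moreover have "U f \<bullet> U (\<lambda>x. w * h x) = cmod (ip f h)"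
          using f L w(2) by (simp flip: Re_ip add: L2_cmult ip_cmult_right)
        moreover have "U (\<lambda>x. w * h x) \<bullet> U (\<lambda>x. w * g x) = Re (w * cnj w * ip h g)"
          using L by (simp flip: Re_ip add: L2_cmult ip_cmult_right ip_cmult_left algebra_simps)
        moreover have "w * cnj w = 1" using w(1) by (simp add: complex_norm_square[symmetric])
        ultimately show "(cmod (ip f h))\<^sup>2 \<le> M * Re (ip h g)" by simp
      qed
    next
      assume fb: "form_bound G f M"
      show "\<forall>(g, h)\<in>A. (U f \<bullet> h)\<^sup>2 \<le> M * (h \<bullet> g)"
      proof clarify
        fix x y assume "(x, y) \<in> A"
        then obtain g h k where *: "(g, h) \<in> H" "k \<in> range_perp" "x = U g" "y = U h + k" unfolding A_def by (rule upE)
        obtain g' h' where g': "(g', h') \<in> G" "U g = U g'" "U h = U h'" using HG[OF *(1)] by blast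
        have L: "LL g'" "LL h'" using L2_pairsD[OF GL g'(1)] by auto
        have "U f \<bullet> y = Re (ip f h')" using range_perp_inner[OF *(2) f] f L by (simp add: * g' inner_simps Re_ip)
        moreover have "y \<bullet> x = Re (ip h' g')" using range_perp_inner[OF *(2) L(1)] L by (simp add: * g' inner_simps Re_ip inner_commute[of k])
        moreover have "(Re (ip f h'))\<^sup>2 \<le> (cmod (ip f h'))\<^sup>2" by (simp add: cmod_power2)
        moreover have "(cmod (ip f h'))\<^sup>2 \<le> M * Re (ip h' g')" using fb g'(1) by (auto simp: form_bound_def)
        ultimately show "(U f \<bullet> y)\<^sup>2 \<le> M * (y \<bullet> x)" by simp
      qed
    qed
    finally show ?thesis .
  qed
  from spec uniq bound show ?thesis by (rule that)
qed

lemma sqrt_op_properties: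
  assumes G: "nonneg_sa a b r G"
  shows "sqrt_spec G (sqrt_op a b r G)"
    and "LL f \<Longrightarrow> 0 \<le> M \<Longrightarrow> (\<exists>y. (f, y) \<in> sqrt_op a b r G \<and> (norm_L2 a b r y)\<^sup>2 \<le> M) \<longleftrightarrow> form_bound G f M"
proof -
  obtain S where S: "sqrt_spec G S" "\<And>S'. sqrt_spec G S' \<Longrightarrow> S' = S"
    "\<And>f M. LL f \<Longrightarrow> 0 \<le> M \<Longrightarrow> (\<exists>y. (f, y) \<in> S \<and> (norm_L2 a b r y)\<^sup>2 \<le> M) \<longleftrightarrow> form_bound G f M"
    by (rule sqrt_op_exists[OF G], rule that)
  have "sqrt_op a b r G = (THE S. sqrt_spec G S)" by (simp add: sqrt_op_def sqrt_spec_def)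
  also have "\<dots> = S" by (rule the_equality, rule S(1), rule S(2))
  finally have *: "sqrt_op a b r G = S" .
  show "sqrt_spec G (sqrt_op a b r G)" using S(1) by (simp add: *)
  show "LL f \<Longrightarrow> 0 \<le> M \<Longrightarrow> (\<exists>y. (f, y) \<in> sqrt_op a b r G \<and> (norm_L2 a b r y)\<^sup>2 \<le> M) \<longleftrightarrow> form_bound G f M"
    unfolding * by (rule S(3))
qed

lemma norm_L2_nonneg: "LL f \<Longrightarrow> 0 \<le> norm_L2 a b r f"
  by (simp add: norm_L2_def ip_self_nonneg)

text \<open>Choosing M as the squared norm of the larger root at f turns domain inclusion together
  with the norm inequality into one implication between form bounds. Operators are compared in this
  shape from here on.\<close>

lemma op_le_iff:
  "op_le a b r A B \<longleftrightarrow> nonneg_sa a b r A \<and> nonneg_sa a b r B \<and>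
    (\<forall>f M. LL f \<longrightarrow> 0 \<le> M \<longrightarrow> form_bound B f M \<longrightarrow> form_bound A f M)"
proof (cases "nonneg_sa a b r A \<and> nonneg_sa a b r B")
  case False
  then show ?thesis by (auto simp: op_le_def)
next
  case True
  then have A: "nonneg_sa a b r A" and B: "nonneg_sa a b r B" by auto
  note PA = sqrt_op_properties[OF A] and PB = sqrt_op_properties[OF B]
  have LA: "LL f" "LL y" if "(f, y) \<in> sqrt_op a b r A" for f y
  proof -
    have "sqrt_op a b r A \<subseteq> L2_pairs a b r" using PA(1) by (auto simp: sqrt_spec_def single_valued_op_def)
    from L2_pairsD[OF this that] show "LL f" "LL y" by auto
  qed
  have LB: "LL f" "LL y" if "(f, y) \<in> sqrt_op a b r B" for f y
  proof -
    have "sqrt_op a b r B \<subseteq> L2_pairs a b r" using PB(1) by (auto simp: sqrt_spec_def single_valued_op_def)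
    from L2_pairsD[OF this that] show "LL f" "LL y" by auto
  qed
  show ?thesis
  proof (intro iffI conjI A B allI impI)
    fix f M assume le: "op_le a b r A B" and f: "LL f" and M: "0 \<le> M" and fb: "form_bound B f M"
    obtain y where y: "(f, y) \<in> sqrt_op a b r B" "(norm_L2 a b r y)\<^sup>2 \<le> M" using PB(2)[OF f M] fb by blast
    then have "f \<in> fst ` sqrt_op a b r A" using le by (force simp: op_le_def)
    then obtain x where x: "(f, x) \<in> sqrt_op a b r A" by force
    have "norm_L2 a b r x \<le> norm_L2 a b r y" using le x y(1) by (simp add: op_le_def)
    then have "(norm_L2 a b r x)\<^sup>2 \<le> (norm_L2 a b r y)\<^sup>2" by (rule power_mono[OF _ norm_L2_nonneg[OF LA(2)[OF x]]])
    with y(2) x show "form_bound A f M" using PA(2)[OF f M] by fastforce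
  next
    assume "nonneg_sa a b r A \<and> nonneg_sa a b r B \<and>
      (\<forall>f M. LL f \<longrightarrow> 0 \<le> M \<longrightarrow> form_bound B f M \<longrightarrow> form_bound A f M)"
    then have imp: "\<And>f M. LL f \<Longrightarrow> 0 \<le> M \<Longrightarrow> form_bound B f M \<Longrightarrow> form_bound A f M" by blast
    have key: "\<exists>x. (f, x) \<in> sqrt_op a b r A \<and> (norm_L2 a b r x)\<^sup>2 \<le> (norm_L2 a b r y)\<^sup>2"
      if y: "(f, y) \<in> sqrt_op a b r B" for f y
      using PA(2)[of f "(norm_L2 a b r y)\<^sup>2"] PB(2)[of f "(norm_L2 a b r y)\<^sup>2"] imp[of f "(norm_L2 a b r y)\<^sup>2"] LB[OF y] y
      by auto
    show "op_le a b r A B" unfolding op_le_def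
    proof (intro conjI A B allI impI)
      show "fst ` sqrt_op a b r B \<subseteq> fst ` sqrt_op a b r A" using key by force
      fix f gA gB assume gA: "(f, gA) \<in> sqrt_op a b r A" and gB: "(f, gB) \<in> sqrt_op a b r B"
      obtain x where x: "(f, x) \<in> sqrt_op a b r A" "(norm_L2 a b r x)\<^sup>2 \<le> (norm_L2 a b r gB)\<^sup>2" using key[OF gB] by blast
      have "single_valued_op a b r (sqrt_op a b r A)" using PA(1) by (simp add: sqrt_spec_def)
      then have "eqv gA x" using gA x(1) by (fastforce simp: single_valued_op_def)
      then have "ip gA gA = ip x x" using LA[OF gA] LA[OF x(1)] by (intro ip_cong)
      then have "norm_L2 a b r gA = norm_L2 a b r x" by (simp add: norm_L2_def)
      also have "\<dots> \<le> norm_L2 a b r gB"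
        by (rule power2_le_imp_le[OF x(2) norm_L2_nonneg[OF LB(2)[OF gB]]])
      finally show "norm_L2 a b r gA \<le> norm_L2 a b r gB" .
    qed
  qed
qed

end

section \<open>Absolutely continuous functions\<close>

definition ac_modulus :: "real \<Rightarrow> real \<Rightarrow> fn \<Rightarrow> real \<Rightarrow> real \<Rightarrow> bool" where
  "ac_modulus c d f \<delta> e \<longleftrightarrow> (\<forall>(n::nat) (xs::nat \<Rightarrow> real) ys.
      (\<forall>i<n. c \<le> xs i \<and> xs i \<le> ys i \<and> ys i \<le> d) \<and>
      (\<forall>i<n. \<forall>j<n. i \<noteq> j \<longrightarrow> ys i \<le> xs j \<or> ys j \<le> xs i) \<and>
      (\<Sum>i<n. ys i - xs i) < \<delta> \<longrightarrow> (\<Sum>i<n. cmod (f (ys i) - f (xs i))) < e)"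

lemma abs_cont_on_iff: "abs_cont_on c d f \<longleftrightarrow> (\<forall>e>0. \<exists>\<delta>>0. ac_modulus c d f \<delta> e)"
  unfolding abs_cont_on_def ac_modulus_def ..

lemma ac_modulusD:
  fixes n :: nat
  assumes "ac_modulus c d f \<delta> e"
    and "\<And>i. i < n \<Longrightarrow> c \<le> xs i \<and> xs i \<le> ys i \<and> ys i \<le> d"
    and "\<And>i j. i < n \<Longrightarrow> j < n \<Longrightarrow> i \<noteq> j \<Longrightarrow> ys i \<le> xs j \<or> ys j \<le> xs i"
    and "(\<Sum>i<n. ys i - xs i) < \<delta>"
  shows "(\<Sum>i<n. cmod (f (ys i) - f (xs i))) < e"
  by (rule mp[OF assms(1)[unfolded ac_modulus_def, THEN spec[of _ n], THEN spec[of _ xs], THEN spec[of _ ys]]])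
    (use assms(2-) in auto)

lemma abs_cont_onD_finite:
  assumes ac: "ac_modulus c d f \<delta> e"
    and S: "finite S" "\<And>s. s \<in> S \<Longrightarrow> c \<le> l s \<and> l s \<le> u s \<and> u s \<le> d"
    and disj: "\<And>s t. s \<in> S \<Longrightarrow> t \<in> S \<Longrightarrow> s \<noteq> t \<Longrightarrow> u s \<le> l t \<or> u t \<le> l s"
    and len: "(\<Sum>s\<in>S. u s - l s) < \<delta>"
  shows "(\<Sum>s\<in>S. cmod (f (u s) - f (l s))) < e"
proof -
  obtain h where h: "bij_betw h {..<card S} S"
    using ex_bij_betw_nat_finite[OF S(1)] by (auto simp: atLeast0LessThan)
  then have hS: "h i \<in> S" if "i < card S" for i using that by (auto simp: bij_betw_def)
  have inj: "i \<noteq> j \<Longrightarrow> i < card S \<Longrightarrow> j < card S \<Longrightarrow> h i \<noteq> h j" for i j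
    using h by (auto simp: bij_betw_def inj_on_def)
  have 1: "(\<Sum>i<card S. u (h i) - l (h i)) = (\<Sum>s\<in>S. u s - l s)"
    by (rule sum.reindex_bij_betw[OF h])
  have 2: "(\<Sum>i<card S. cmod (f (u (h i)) - f (l (h i)))) = (\<Sum>s\<in>S. cmod (f (u s) - f (l s)))"
    by (rule sum.reindex_bij_betw[OF h])
  have "(\<Sum>i<card S. cmod (f (u (h i)) - f (l (h i)))) < e"
    by (rule ac_modulusD[OF ac]) (use S(2) hS disj inj len 1 in auto)
  with 2 show ?thesis by simp
qed

text \<open>Tags in the null set $Z$ get a gauge inside an open set of small measure, where absolute continuity makes
  the increments of $f$ negligible; elsewhere the usual straddle estimate applies.\<close>

lemma abs_cont_on_has_integral:
  assumes ac: "abs_cont_on c d f" and cd: "c \<le> d" and Z: "negligible Z"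
    and der: "\<And>x. x \<in> {c..d} - Z \<Longrightarrow> (f has_vector_derivative F x) (at x)"
  shows "((\<lambda>x. if x \<in> Z then 0 else F x) has_integral (f d - f c)) {c..d}"
  unfolding has_integral box_real[symmetric]
proof (intro allI impI)
  let ?F = "\<lambda>x. if x \<in> Z then 0 else F x"
  fix e :: real assume e: "0 < e"
  \<comment> \<open>The slope error summed over the whole interval stays below e/2; the summand 1 in
    the denominator covers the case c = d.\<close>
  define e1 where "e1 = e / (2 * (d - c + 1))"
  have e1: "0 < e1" "e1 * (d - c) < e / 2" using e cd by (auto simp: e1_def field_simps)
  obtain \<delta> where \<delta>: "0 < \<delta>" and ac\<delta>: "ac_modulus c d f \<delta> (e / 2)"
    using ac e unfolding abs_cont_on_iff by (meson half_gt_zero)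
  have Zn: "Z \<in> null_sets lebesgue" using Z by (simp add: negligible_iff_null_sets)
  then obtain T where T: "open T" "Z \<subseteq> T" "T - Z \<in> lmeasurable" "emeasure lebesgue (T - Z) < ennreal \<delta>"
    using sets_lebesgue_outer_open[of Z \<delta>] \<delta> by (auto simp: null_sets_def)
  \<comment> \<open>Outer regularity bounds the measure of T - Z only; since \<open>Z\<close> is
    null, the bound holds for \<open>T\<close>.\<close>
  have T\<delta>: "T \<in> lmeasurable" "measure lebesgue T < \<delta>"
  proof -
    have eq: "emeasure lebesgue T = emeasure lebesgue (T - Z)"
      using emeasure_Diff_null_set[OF Zn, of T] T(1) by simp
    then show "T \<in> lmeasurable" using T(1,4) by (auto intro!: fmeasurableI simp: less_top[symmetric])
    then have "ennreal (measure lebesgue T) < ennreal \<delta>" using T(4) eq by (simp add: emeasure_eq_measure2)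
    then show "measure lebesgue T < \<delta>" using \<delta> by (simp add: ennreal_less_iff)
  qed
  have "\<exists>\<rho>>0. t \<in> {c..d} - Z \<longrightarrow> (\<forall>y. norm (y - t) < \<rho> \<longrightarrow> norm (f y - f t - (y - t) *\<^sub>R F t) \<le> e1 * norm (y - t))" for t
    using der[of t] e1(1) unfolding has_vector_derivative_def has_derivative_at_alt
    by (cases "t \<in> {c..d} - Z") (auto intro: exI[of _ 1])
  then obtain \<rho> where \<rho>: "\<And>t. 0 < \<rho> t"
    and app: "\<And>t y. t \<in> {c..d} - Z \<Longrightarrow> norm (y - t) < \<rho> t \<Longrightarrow> norm (f y - f t - (y - t) *\<^sub>R F t) \<le> e1 * norm (y - t)"
    by metis
  define \<gamma> where "\<gamma> t = (if t \<in> Z then T else ball t (\<rho> t))" for t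
  have gau: "gauge \<gamma>" using T(1,2) \<rho> by (auto simp: gauge_def \<gamma>_def)
  have main: "norm ((\<Sum>(x, K)\<in>p. measure lborel K *\<^sub>R ?F x) - (f d - f c)) < e"
    if p: "p tagged_division_of cbox c d" and fine: "\<gamma> fine p" for p
  proof -
    have fp: "finite p" using p by blast
    have sums: "d - c = (\<Sum>(x,K)\<in>p. Sup K - Inf K)" "f d - f c = (\<Sum>(x,K)\<in>p. f (Sup K) - f (Inf K))"
      using additive_tagged_division_1[where f="\<lambda>x. x", OF cd] additive_tagged_division_1[where f=f, OF cd] p by auto
    have K: "\<exists>u v. K = {u..v} \<and> u \<le> v \<and> Sup K = v \<and> Inf K = u \<and> u \<le> x \<and> x \<le> v \<and> c \<le> u \<and> v \<le> d \<and> K \<subseteq> \<gamma> x"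
      if xK: "(x, K) \<in> p" for x K
    proof -
      from tagged_division_ofD(2,3,4)[OF p xK] obtain u v where "x \<in> K" "K \<subseteq> cbox c d" "K = cbox u v" by blast
      moreover have "K \<subseteq> \<gamma> x" using fine xK by blast
      ultimately show ?thesis by (intro exI[of _ u] exI[of _ v]) auto
    qed
    \<comment> \<open>Intervals with tags in the exceptional set. Degenerate intervals contribute
      nothing and are dropped, because disjoint interiors imply an ordering only for intervals of
      positive length.\<close>
    define q where "q = {(x, K) \<in> p. x \<in> Z \<and> Inf K < Sup K}"
    have qp: "q \<subseteq> p" by (auto simp: q_def)
    then have fq: "finite q" using fp finite_subset by blast
    have disj: "Sup (snd s) \<le> Inf (snd t) \<or> Sup (snd t) \<le> Inf (snd s)" if st: "s \<in> q" "t \<in> q" "s \<noteq> t" for s t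
    proof (rule ccontr)
      assume neg: "\<not> ?thesis"
      obtain x K y L where s: "s = (x, K)" "(x, K) \<in> p" "Inf K < Sup K" and t: "t = (y, L)" "(y, L) \<in> p" "Inf L < Sup L"
        using st by (auto simp: q_def)
      obtain u v where uv: "K = {u..v}" "Sup K = v" "Inf K = u" using K[OF s(2)] by blast
      obtain u' v' where uv': "L = {u'..v'}" "Sup L = v'" "Inf L = u'" using K[OF t(2)] by blast
      have "interior K \<inter> interior L = {}"
        using tagged_division_ofD(5)[OF p s(2) t(2)] st(3) s(1) t(1) by auto
      then have "{u<..<v} \<inter> {u'<..<v'} = {}" by (simp add: uv uv')
      moreover have "(max u u' + min v v') / 2 \<in> {u<..<v} \<inter> {u'<..<v'}"
        using neg s t uv uv' by (auto simp: max_def min_def)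
      ultimately show False by blast
    qed
    have len: "(\<Sum>s\<in>q. Sup (snd s) - Inf (snd s)) < \<delta>"
    proof -
      have lm: "snd s \<in> lmeasurable" "measure lebesgue (snd s) = Sup (snd s) - Inf (snd s)" "snd s \<subseteq> T" if s: "s \<in> q" for s
      proof -
        obtain x K where xK: "s = (x, K)" "(x, K) \<in> p" "x \<in> Z" using s by (auto simp: q_def)
        obtain u v where uv: "K = {u..v}" "u \<le> v" "Sup K = v" "Inf K = u" "K \<subseteq> \<gamma> x" using K[OF xK(2)] by blast
        then show "snd s \<in> lmeasurable" "measure lebesgue (snd s) = Sup (snd s) - Inf (snd s)" "snd s \<subseteq> T"
          using xK by (auto simp: \<gamma>_def)
      qed
      have "pairwise (\<lambda>x y. negligible (snd x \<inter> snd y)) q"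
      proof (rule pairwiseI)
        fix s t assume st: "s \<in> q" "t \<in> q" "s \<noteq> t"
        obtain x K y L where s: "s = (x, K)" "(x, K) \<in> p" and t: "t = (y, L)" "(y, L) \<in> p"
          using st by (auto simp: q_def)
        obtain u v where uv: "K = {u..v}" "Sup K = v" "Inf K = u" using K[OF s(2)] by blast
        obtain u' v' where uv': "L = {u'..v'}" "Sup L = v'" "Inf L = u'" using K[OF t(2)] by blast
        have "snd s \<inter> snd t \<subseteq> {u, v}" using disj[OF st] by (auto simp: s t uv uv')
        then show "negligible (snd s \<inter> snd t)" by (rule negligible_subset[rotated]) simp
      qed
      then have "measure lebesgue (\<Union> (snd ` q)) = (\<Sum>s\<in>q. measure lebesgue (snd s))"
        by (intro measure_negligible_finite_Union_image fq lm)
      moreover have "measure lebesgue (\<Union> (snd ` q)) \<le> measure lebesgue T"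
      proof (rule measure_mono_fmeasurable[OF _ _ T\<delta>(1)])
        show "\<Union> (snd ` q) \<subseteq> T" using lm(3) by blast
        show "\<Union> (snd ` q) \<in> sets lebesgue" using lm(1) fq by (intro sets.finite_UN) (auto simp: fmeasurable_def)
      qed
      ultimately show ?thesis using T\<delta>(2) lm by simp
    qed
    have bad: "(\<Sum>s\<in>q. cmod (f (Sup (snd s)) - f (Inf (snd s)))) < e / 2"
    proof (rule abs_cont_onD_finite[OF ac\<delta> fq _ disj len])
      fix s assume "s \<in> q"
      then obtain x K where "s = (x, K)" "(x, K) \<in> p" by (auto simp: q_def)
      then show "c \<le> Inf (snd s) \<and> Inf (snd s) \<le> Sup (snd s) \<and> Sup (snd s) \<le> d" using K by fastforce
    qed
    let ?g = "\<lambda>(x, K). measure lborel K *\<^sub>R ?F x - (f (Sup K) - f (Inf K))"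
    have term_le: "norm (?g s) \<le> (if s \<in> q then cmod (f (Sup (snd s)) - f (Inf (snd s))) else 0) + e1 * (Sup (snd s) - Inf (snd s))"
      if s: "s \<in> p" for s
    proof -
      obtain x K where xK: "s = (x, K)" "(x, K) \<in> p" using s by (cases s) auto
      obtain u v where uv: "K = {u..v}" "u \<le> v" "Sup K = v" "Inf K = u" "u \<le> x" "x \<le> v" "c \<le> u" "v \<le> d" "K \<subseteq> \<gamma> x"
        using K[OF xK(2)] by blast
      show ?thesis
      proof (cases "x \<in> Z")
        case True
        then show ?thesis using xK uv e1(1) norm_minus_commute[of "f u" "f v"] by (cases "u = v") (auto simp: q_def)
      next
        case False
        have "u \<in> K" "v \<in> K" using uv by auto
        then have "u \<in> ball x (\<rho> x)" "v \<in> ball x (\<rho> x)" using uv(9) False by (auto simp: \<gamma>_def)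
        then have "norm (u - x) < \<rho> x" "norm (v - x) < \<rho> x" by (auto simp: dist_real_def)
        then have *: "norm (f u - f x - (u - x) *\<^sub>R F x) \<le> e1 * norm (u - x)" "norm (f v - f x - (v - x) *\<^sub>R F x) \<le> e1 * norm (v - x)"
          using uv False by (intro app; auto)+
        have "?g s = (f u - f x - (u - x) *\<^sub>R F x) - (f v - f x - (v - x) *\<^sub>R F x)"
          using xK uv False by (simp add: algebra_simps)
        then have "norm (?g s) \<le> norm (f u - f x - (u - x) *\<^sub>R F x) + norm (f v - f x - (v - x) *\<^sub>R F x)"
          by (simp only: norm_triangle_ineq4)
        also have "\<dots> \<le> e1 * norm (u - x) + e1 * norm (v - x)" using * by simp
        also have "\<dots> = e1 * (v - u)" using uv by (simp add: algebra_simps)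
        finally show ?thesis using xK uv False by (simp add: q_def)
      qed
    qed
    have "(\<Sum>(x, K)\<in>p. measure lborel K *\<^sub>R ?F x) - (f d - f c) = (\<Sum>s\<in>p. ?g s)"
      unfolding sums(2) by (simp add: sum_subtractf[symmetric] split_def)
    then have "norm ((\<Sum>(x, K)\<in>p. measure lborel K *\<^sub>R ?F x) - (f d - f c))
      \<le> (\<Sum>s\<in>p. (if s \<in> q then cmod (f (Sup (snd s)) - f (Inf (snd s))) else 0) + e1 * (Sup (snd s) - Inf (snd s)))"
      by (simp only:) (rule sum_norm_le[OF term_le])
    also have "\<dots> = (\<Sum>s\<in>q. cmod (f (Sup (snd s)) - f (Inf (snd s)))) + e1 * (d - c)"
    proof -
      have "(\<Sum>s\<in>p. if s \<in> q then cmod (f (Sup (snd s)) - f (Inf (snd s))) else 0) = (\<Sum>s\<in>q. cmod (f (Sup (snd s)) - f (Inf (snd s))))"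
        using qp fp by (simp add: sum.If_cases Int_absorb1)
      then show ?thesis unfolding sums(1) by (simp only: sum.distrib sum_distrib_left[symmetric] split_def)
    qed
    also have "\<dots> < e" using bad e1(2) by simp
    finally show ?thesis .
  qed
  show "\<exists>\<gamma>. gauge \<gamma> \<and> (\<forall>p. p tagged_division_of cbox c d \<and> \<gamma> fine p \<longrightarrow>
      norm ((\<Sum>(x, K)\<in>p. measure lborel K *\<^sub>R ?F x) - (f d - f c)) < e)"
    by (rule exI[of _ \<gamma>], rule conjI[OF gau], intro allI impI, elim conjE, rule main)
qed

text \<open>The gauge integral computed from absolute continuity and the Lebesgue integral of
  \<open>F\<close> are both Henstock-Kurzweil integrals over the same interval, hence equal.\<close>

lemma abs_cont_on_FTC:
  assumes ac: "abs_cont_on c d f" and cd: "c \<le> d"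
    and der: "AE x in lebesgue. x \<in> {c..d} \<longrightarrow> (f has_vector_derivative F x) (at x)"
    and int: "set_integrable lebesgue {c..d} F"
  shows "set_lebesgue_integral lebesgue {c..d} F = f d - f c"
proof -
  obtain Z where Z: "Z \<in> null_sets lebesgue" "\<And>x. x \<notin> Z \<Longrightarrow> x \<in> {c..d} \<longrightarrow> (f has_vector_derivative F x) (at x)"
    using der by (auto elim!: AE_E3)
  then have nZ: "negligible Z" by (simp add: negligible_iff_null_sets)
  have "((\<lambda>x. if x \<in> Z then 0 else F x) has_integral (f d - f c)) {c..d}"
    by (rule abs_cont_on_has_integral[OF ac cd nZ]) (use Z in auto)
  then have "(F has_integral (f d - f c)) {c..d}"
    by (rule has_integral_spike[OF nZ, rotated]) auto
  with has_integral_set_lebesgue[OF int] show ?thesis by (rule has_integral_unique)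
qed

text \<open>Common source of closure under sums, products, reciprocals, conjugation and pointwise
  equality: only an estimate of increments remains to be checked in each case.\<close>

lemma abs_cont_on_dominated:
  assumes f: "abs_cont_on c d f" and g: "abs_cont_on c d g" and C: "0 \<le> C"
    and le: "\<And>x y. c \<le> x \<Longrightarrow> x \<le> y \<Longrightarrow> y \<le> d \<Longrightarrow> cmod (h y - h x) \<le> C * (cmod (f y - f x) + cmod (g y - g x))"
  shows "abs_cont_on c d h"
  unfolding abs_cont_on_iff
proof (intro allI impI)
  fix e :: real assume e: "0 < e"
  define e' where "e' = e / (2 * (C + 1))"
  have e': "0 < e'" and Ce: "2 * C * e' < e" using e C by (auto simp: e'_def field_simps)
  obtain \<delta>1 \<delta>2 where 1: "0 < \<delta>1" "ac_modulus c d f \<delta>1 e'" and 2: "0 < \<delta>2" "ac_modulus c d g \<delta>2 e'"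
    using f g e' unfolding abs_cont_on_iff by meson
  have "ac_modulus c d h (min \<delta>1 \<delta>2) e"
    unfolding ac_modulus_def
  proof (intro allI impI, elim conjE)
    fix n :: nat and xs ys :: "nat \<Rightarrow> real"
    assume A: "\<forall>i<n. c \<le> xs i \<and> xs i \<le> ys i \<and> ys i \<le> d"
      "\<forall>i<n. \<forall>j<n. i \<noteq> j \<longrightarrow> ys i \<le> xs j \<or> ys j \<le> xs i" "(\<Sum>i<n. ys i - xs i) < min \<delta>1 \<delta>2"
    have F: "(\<Sum>i<n. cmod (f (ys i) - f (xs i))) < e'" by (rule ac_modulusD[OF 1(2)]) (use A in auto)
    have G: "(\<Sum>i<n. cmod (g (ys i) - g (xs i))) < e'" by (rule ac_modulusD[OF 2(2)]) (use A in auto)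
    have "(\<Sum>i<n. cmod (h (ys i) - h (xs i))) \<le> (\<Sum>i<n. C * (cmod (f (ys i) - f (xs i)) + cmod (g (ys i) - g (xs i))))"
      using A(1) by (intro sum_mono le) auto
    also have "\<dots> = C * ((\<Sum>i<n. cmod (f (ys i) - f (xs i))) + (\<Sum>i<n. cmod (g (ys i) - g (xs i))))"
      by (simp only: sum_distrib_left[symmetric] sum.distrib)
    also have "\<dots> \<le> C * (e' + e')" by (rule mult_left_mono[OF add_mono[OF less_imp_le[OF F] less_imp_le[OF G]] C])
    also have "\<dots> < e" using Ce by simp
    finally show "(\<Sum>i<n. cmod (h (ys i) - h (xs i))) < e" .
  qed
  with 1(1) 2(1) show "\<exists>\<delta>>0. ac_modulus c d h \<delta> e" by (intro exI[of _ "min \<delta>1 \<delta>2"]) auto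
qed

lemma abs_cont_on_continuous:
  assumes "abs_cont_on c d f" shows "continuous_on {c..d} f"
  unfolding continuous_on_iff
proof (intro ballI allI impI)
  fix x e :: real assume x: "x \<in> {c..d}" and e: "0 < e"
  obtain \<delta> where d: "0 < \<delta>" "ac_modulus c d f \<delta> e"
    using assms e unfolding abs_cont_on_iff by meson
  show "\<exists>\<delta>>0. \<forall>y\<in>{c..d}. dist y x < \<delta> \<longrightarrow> dist (f y) (f x) < e"
  proof (intro exI[of _ \<delta>] conjI ballI impI d(1))
    fix y assume y: "y \<in> {c..d}" "dist y x < \<delta>"
    then show "dist (f y) (f x) < e"
      using ac_modulusD[OF d(2), of "Suc 0" "\<lambda>_. min x y" "\<lambda>_. max x y"] x
      by (cases "x \<le> y") (auto simp: dist_norm norm_minus_commute min_def max_def)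
  qed
qed

lemma abs_cont_on_bounded:
  assumes "abs_cont_on c d f" obtains B where "0 \<le> B" "\<And>x. x \<in> {c..d} \<Longrightarrow> cmod (f x) \<le> B"
proof -
  have "bounded (f ` {c..d})"
    by (intro compact_imp_bounded compact_continuous_image abs_cont_on_continuous assms) auto
  then obtain B where "\<And>x. x \<in> {c..d} \<Longrightarrow> cmod (f x) \<le> B" unfolding bounded_iff by blast
  then show ?thesis by (intro that[of "max 0 B"]) (auto simp: le_max_iff_disj)
qed

lemma abs_cont_on_const: "abs_cont_on c d (\<lambda>_. k)"
  unfolding abs_cont_on_iff ac_modulus_def by (auto intro!: exI[of _ 1])

lemma abs_cont_on_mult:
  assumes f: "abs_cont_on c d f" and g: "abs_cont_on c d g"
  shows "abs_cont_on c d (\<lambda>x. f x * g x)"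
proof -
  obtain A B where A: "0 \<le> A" "\<And>x. x \<in> {c..d} \<Longrightarrow> cmod (f x) \<le> A" and B: "0 \<le> B" "\<And>x. x \<in> {c..d} \<Longrightarrow> cmod (g x) \<le> B"
    using abs_cont_on_bounded[OF f] abs_cont_on_bounded[OF g] by metis
  show ?thesis
  proof (rule abs_cont_on_dominated[OF f g, of "A + B"])
    fix x y assume xy: "c \<le> x" "x \<le> y" "y \<le> d"
    have "f y * g y - f x * g x = (f y - f x) * g y + f x * (g y - g x)" by (simp add: algebra_simps)
    then have "cmod (f y * g y - f x * g x) \<le> cmod (f y - f x) * cmod (g y) + cmod (f x) * cmod (g y - g x)"
      by (metis norm_triangle_ineq norm_mult)
    also have "\<dots> \<le> cmod (f y - f x) * (A + B) + (A + B) * cmod (g y - g x)"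
      using A(1) B(1) A(2)[of x] B(2)[of y] xy by (intro add_mono mult_left_mono mult_right_mono) auto
    finally show "cmod (f y * g y - f x * g x) \<le> (A + B) * (cmod (f y - f x) + cmod (g y - g x))" by (simp add: algebra_simps)
  qed (use A B in auto)
qed

lemma abs_cont_on_add:
  assumes f: "abs_cont_on c d f" and g: "abs_cont_on c d g"
  shows "abs_cont_on c d (\<lambda>x. f x + g x)"
proof (rule abs_cont_on_dominated[OF f g, of 1])
  fix x y
  have "f y + g y - (f x + g x) = (f y - f x) + (g y - g x)" by simp
  then show "cmod (f y + g y - (f x + g x)) \<le> 1 * (cmod (f y - f x) + cmod (g y - g x))" by (metis mult_1 norm_triangle_ineq)
qed auto

lemma abs_cont_on_cmult: "abs_cont_on c d f \<Longrightarrow> abs_cont_on c d (\<lambda>x. k * f x)"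
  by (rule abs_cont_on_mult[OF abs_cont_on_const])

lemma abs_cont_on_diff: "abs_cont_on c d f \<Longrightarrow> abs_cont_on c d g \<Longrightarrow> abs_cont_on c d (\<lambda>x. f x - g x)"
  using abs_cont_on_add[of c d f "\<lambda>x. - 1 * g x"] abs_cont_on_cmult[of c d g "-1"] by simp

lemma abs_cont_on_inverse:
  assumes f: "abs_cont_on c d f" and nz: "\<And>x. x \<in> {c..d} \<Longrightarrow> f x \<noteq> 0"
  shows "abs_cont_on c d (\<lambda>x. inverse (f x))"
proof -
  have "bounded ((\<lambda>x. inverse (f x)) ` {c..d})"
    by (intro compact_imp_bounded compact_continuous_image continuous_on_inverse abs_cont_on_continuous f) (use nz in auto)
  then obtain B where B: "\<And>x. x \<in> {c..d} \<Longrightarrow> cmod (inverse (f x)) \<le> B" unfolding bounded_iff by blast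
  show ?thesis
  proof (rule abs_cont_on_dominated[OF f f, of "B * B"])
    fix x y assume xy: "c \<le> x" "x \<le> y" "y \<le> d"
    then have "f x \<noteq> 0" "f y \<noteq> 0" using nz by auto
    then have "inverse (f y) - inverse (f x) = inverse (f x) * inverse (f y) * (f x - f y)" by (simp add: field_simps)
    then have "cmod (inverse (f y) - inverse (f x)) = cmod (inverse (f x)) * cmod (inverse (f y)) * cmod (f y - f x)"
      by (simp only: norm_mult norm_minus_commute)
    also have "\<dots> \<le> (B * B) * cmod (f y - f x)"
      using B[of x] B[of y] xy by (intro mult_right_mono mult_mono) (auto intro: order_trans[OF norm_ge_zero])
    also have "\<dots> \<le> (B * B) * (cmod (f y - f x) + cmod (f y - f x))" by (intro mult_left_mono) auto
    finally show "cmod (inverse (f y) - inverse (f x)) \<le> (B * B) * (cmod (f y - f x) + cmod (f y - f x))" .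
  qed auto
qed

section \<open>Sturm--Liouville equations\<close>

lemma continuous_AE_eq_on_open:
  fixes f g :: "real \<Rightarrow> complex"
  assumes S: "open S" and f: "continuous_on S f" and g: "continuous_on S g"
    and ae: "AE x in lebesgue. x \<in> S \<longrightarrow> f x = g x" and x: "x \<in> S"
  shows "f x = g x"
proof (rule ccontr)
  assume ne: "f x \<noteq> g x"
  define D where "D = S \<inter> (\<lambda>x. f x - g x) -` (- {0})"
  have "open D" unfolding D_def
    by (rule continuous_open_preimage[OF _ S]) (auto intro!: continuous_intros f g)
  moreover have "x \<in> D" using x ne by (simp add: D_def)
  moreover have "negligible D"
  proof -
    have "AE x in lebesgue. x \<notin> D" using ae by eventually_elim (auto simp: D_def)
    then have "D \<in> null_sets lebesgue" using \<open>open D\<close> by (simp add: AE_iff_null_sets)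
    then show ?thesis by (simp add: negligible_iff_null_sets)
  qed
  ultimately show False using open_not_negligible by blast
qed

lemma AE_neq_point: "AE x in lebesgue. x \<noteq> (c::real)"
  using AE_not_in[of "{c}" lebesgue] negligible_sing[of c] by (simp add: negligible_iff_null_sets)

lemma Ioo_e_interval: "x \<in> Ioo_e a b \<Longrightarrow> y \<in> Ioo_e a b \<Longrightarrow> {x..y} \<subseteq> Ioo_e a b"
  by (auto simp: Ioo_e_def) (meson ereal_less_eq(3) less_le_trans le_less_trans)+

lemma Ioo_e_extend: assumes "x \<in> Ioo_e a b" obtains y z where "y \<in> Ioo_e a b" "z \<in> Ioo_e a b" "y < x" "x < z"
proof -
  obtain e where "e > 0" "cball x e \<subseteq> Ioo_e a b" using open_Ioo_e assms open_contains_cball by blast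
  then show ?thesis by (intro that[of "x - e" "x + e"]) (auto simp: subset_iff dist_real_def)
qed

lemma Ioo_e_nonempty: assumes "a < b" obtains c where "c \<in> Ioo_e a b"
  using ereal_dense2[OF assms] by (auto simp: Ioo_e_def)

lemma at_left_end_neq_bot: "a < b \<Longrightarrow> at_left_end a \<noteq> bot"
  by (cases a) (auto simp: at_left_end_def)

lemma at_right_end_neq_bot: "a < b \<Longrightarrow> at_right_end b \<noteq> bot"
  by (cases b) (auto simp: at_right_end_def)

lemma eventually_at_left_end:
  assumes "n \<in> Ioo_e a b"
  shows "\<forall>\<^sub>F x in at_left_end a. x \<in> Ioo_e a b \<and> x < n"
proof (cases a)
  case (real r)
  with assms have "r < n" by (simp add: Ioo_e_def)
  then have "\<forall>\<^sub>F x in at_right r. x \<in> {r<..<n}" by (rule eventually_at_right_real)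
  then show ?thesis unfolding real at_left_end_def ereal.case
    by (rule eventually_mono) (use assms real in \<open>auto simp: Ioo_e_def intro: less_trans[of _ "ereal n"]\<close>)
next
  case MInf
  have "\<forall>\<^sub>F x in at_bot. x < n" by (rule eventually_gt_at_bot)
  then have "\<forall>\<^sub>F x in at_bot. x \<in> Ioo_e a b \<and> x < n"
    by (rule eventually_mono) (use assms MInf in \<open>auto simp: Ioo_e_def intro: less_trans[of _ "ereal n"]\<close>)
  then show ?thesis using MInf by (simp add: at_left_end_def)
qed (use assms in \<open>auto simp: Ioo_e_def\<close>)

lemma eventually_at_right_end:
  assumes "n \<in> Ioo_e a b"
  shows "\<forall>\<^sub>F x in at_right_end b. x \<in> Ioo_e a b \<and> n < x"
proof (cases b)
  case (real r)
  with assms have "n < r" by (simp add: Ioo_e_def)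
  then have "\<forall>\<^sub>F x in at_left r. x \<in> {n<..<r}" by (rule eventually_at_left_real)
  then show ?thesis unfolding real at_right_end_def ereal.case
    by (rule eventually_mono) (use assms real in \<open>auto simp: Ioo_e_def intro: less_trans[of _ "ereal n"]\<close>)
next
  case PInf
  have "\<forall>\<^sub>F x in at_top. n < x" by (rule eventually_gt_at_top)
  then have "\<forall>\<^sub>F x in at_top. x \<in> Ioo_e a b \<and> n < x"
    by (rule eventually_mono) (use assms PInf in \<open>auto simp: Ioo_e_def intro: less_trans[of _ "ereal n"]\<close>)
  then show ?thesis using PInf by (simp add: at_right_end_def)
qed (use assms in \<open>auto simp: Ioo_e_def\<close>)

text \<open>Dominated convergence along an exhaustion by compact intervals. Stating smallness for
  all sets in the complement treats both endpoints at once, whether finite or infinite.\<close>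

lemma integral_tail_small:
  fixes G :: "real \<Rightarrow> complex"
  assumes ab: "a < b" and G: "set_integrable lebesgue (Ioo_e a b) G" and e: "0 < e"
  obtains m n where "m \<in> Ioo_e a b" "n \<in> Ioo_e a b"
    "\<And>S. S \<in> sets lebesgue \<Longrightarrow> S \<subseteq> Ioo_e a b - {m..n} \<Longrightarrow> cmod (set_lebesgue_integral lebesgue S G) < e"
proof -
  let ?I = "Ioo_e a b"
  have IE: "?I = einterval a b" by (simp add: Ioo_e_def einterval_def)
  obtain u l where ul: "einterval a b = (\<Union>i. {l i .. u i})" "incseq u" "decseq l" "\<And>i. l i < u i"
    "\<And>i. a < ereal (l i)" "\<And>i. ereal (u i) < b" "(\<lambda>i. ereal (l i)) \<longlonglongrightarrow> a" "(\<lambda>i. ereal (u i)) \<longlonglongrightarrow> b"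
    by (rule einterval_Icc_approximation[OF ab], rule that)
  have sub: "{l i..u i} \<subseteq> ?I" for i unfolding IE ul(1) by blast
  have nG: "set_integrable lebesgue ?I (\<lambda>x. cmod (G x))" by (rule set_integrable_norm[OF G])
  have iI: "integrable lebesgue (\<lambda>x. indicator ?I x *\<^sub>R cmod (G x))" using nG by (simp add: set_integrable_def)
  have iA: "set_integrable lebesgue {l i..u i} (\<lambda>x. cmod (G x))" for i
    by (rule set_integrable_subset[OF nG _ sub]) simp
  have "(\<lambda>i. \<integral>x. indicator {l i..u i} x *\<^sub>R cmod (G x) \<partial>lebesgue) \<longlonglongrightarrow> (\<integral>x. indicator ?I x *\<^sub>R cmod (G x) \<partial>lebesgue)"
  proof (rule integral_dominated_convergence[where w="\<lambda>x. indicator ?I x *\<^sub>R cmod (G x)"])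
    show "(\<lambda>x. indicator ?I x *\<^sub>R cmod (G x)) \<in> borel_measurable lebesgue" using iI by (rule borel_measurable_integrable)
    show "(\<lambda>x. indicator {l i..u i} x *\<^sub>R cmod (G x)) \<in> borel_measurable lebesgue" for i
      using iA[of i] by (auto simp: set_integrable_def dest: borel_measurable_integrable)
    show "integrable lebesgue (\<lambda>x. indicator ?I x *\<^sub>R cmod (G x))" by (rule iI)
    show "AE x in lebesgue. (\<lambda>i. indicator {l i..u i} x *\<^sub>R cmod (G x)) \<longlonglongrightarrow> indicator ?I x *\<^sub>R cmod (G x)"
    proof (intro AE_I2)
      fix x
      have inc: "{l i..u i} \<subseteq> {l j..u j}" if "i \<le> j" for i j
        using that ul(2,3) by (auto simp: incseq_def decseq_def intro: order_trans)
      have "\<forall>\<^sub>F i in sequentially. indicator {l i..u i} x = (indicator ?I x :: real)"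
      proof (cases "x \<in> ?I")
        case True
        then obtain i where "x \<in> {l i..u i}" unfolding IE ul(1) by blast
        then have "x \<in> {l j..u j}" if "i \<le> j" for j using inc[OF that] by blast
        with True show ?thesis unfolding eventually_sequentially by (intro exI[of _ i]) (simp add: indicator_def)
      next
        case False
        then have "x \<notin> {l i..u i}" for i using sub by blast
        with False show ?thesis by (simp add: indicator_def)
      qed
      then have "\<forall>\<^sub>F i in sequentially. indicator {l i..u i} x *\<^sub>R cmod (G x) = indicator ?I x *\<^sub>R cmod (G x)"
        by eventually_elim simp
      then show "(\<lambda>i. indicator {l i..u i} x *\<^sub>R cmod (G x)) \<longlonglongrightarrow> indicator ?I x *\<^sub>R cmod (G x)"
        by (rule tendsto_eventually)
    qed
    show "AE x in lebesgue. norm (indicator {l i..u i} x *\<^sub>R cmod (G x)) \<le> indicator ?I x *\<^sub>R cmod (G x)" for i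
      using sub[of i] by (intro AE_I2) (auto simp: indicator_def)
  qed
  from LIMSEQ_D[OF this e] obtain i where
    "norm ((\<integral>x. indicator {l i..u i} x *\<^sub>R cmod (G x) \<partial>lebesgue) - (\<integral>x. indicator ?I x *\<^sub>R cmod (G x) \<partial>lebesgue)) < e" by blast
  then have i: "(\<integral>x. indicator ?I x *\<^sub>R cmod (G x) \<partial>lebesgue) - (\<integral>x. indicator {l i..u i} x *\<^sub>R cmod (G x) \<partial>lebesgue) < e"
    by simp
  show ?thesis
  proof (rule that[of "l i" "u i"])
    show "l i \<in> ?I" "u i \<in> ?I" using sub[of i] ul(4)[of i] by auto
    fix S assume S: "S \<in> sets lebesgue" "S \<subseteq> ?I - {l i..u i}"
    have iS: "set_integrable lebesgue S (\<lambda>x. cmod (G x))" by (rule set_integrable_subset[OF nG S(1)]) (use S in auto)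
    have "cmod (set_lebesgue_integral lebesgue S G) \<le> (\<integral>x. indicator S x *\<^sub>R cmod (G x) \<partial>lebesgue)"
      unfolding set_lebesgue_integral_def
      by (rule order_trans[OF integral_norm_bound]) (simp add: indicator_def if_distrib cong: if_cong)
    also have "\<dots> \<le> (\<integral>x. indicator ?I x *\<^sub>R cmod (G x) - indicator {l i..u i} x *\<^sub>R cmod (G x) \<partial>lebesgue)"
    proof (rule integral_mono)
      show "integrable lebesgue (\<lambda>x. indicator S x *\<^sub>R cmod (G x))" using iS by (simp add: set_integrable_def)
      show "integrable lebesgue (\<lambda>x. indicator ?I x *\<^sub>R cmod (G x) - indicator {l i..u i} x *\<^sub>R cmod (G x))"
        using iI iA[of i] by (intro Bochner_Integration.integrable_diff) (auto simp: set_integrable_def)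
      show "indicator S x *\<^sub>R cmod (G x) \<le> indicator ?I x *\<^sub>R cmod (G x) - indicator {l i..u i} x *\<^sub>R cmod (G x)" for x
        using S(2) sub[of i] by (auto simp: indicator_def)
    qed
    also have "\<dots> < e"
      using i iI iA[of i] by (subst Bochner_Integration.integral_diff) (auto simp: set_integrable_def)
    finally show "cmod (set_lebesgue_integral lebesgue S G) < e" .
  qed
qed

text \<open>A primitive of a function integrable up to the ends has limits there. Applied to
  Wronskians this is the existence of the generalized boundary values.\<close>

lemma end_limits:
  fixes W G :: "real \<Rightarrow> complex"
  assumes ab: "a < b" and G: "set_integrable lebesgue (Ioo_e a b) G"
    and W: "\<And>c d. c \<in> Ioo_e a b \<Longrightarrow> d \<in> Ioo_e a b \<Longrightarrow> c \<le> d \<Longrightarrow> set_lebesgue_integral lebesgue {c..d} G = W d - W c"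
  obtains La Lb where "(W \<longlongrightarrow> La) (at_left_end a)" "(W \<longlongrightarrow> Lb) (at_right_end b)"
    "set_lebesgue_integral lebesgue (Ioo_e a b) G = Lb - La"
proof -
  let ?I = "Ioo_e a b" and ?int = "\<lambda>S. set_lebesgue_integral lebesgue S G"
  obtain c where c: "c \<in> ?I" by (rule Ioo_e_nonempty[OF ab])
  have sI: "set_integrable lebesgue S G" if "S \<in> sets lebesgue" "S \<subseteq> ?I" for S
    by (rule set_integrable_subset[OF G that])
  have split: "?int (A \<union> B) = ?int A + ?int B"
    if "A \<in> sets lebesgue" "B \<in> sets lebesgue" "A \<subseteq> ?I" "B \<subseteq> ?I" "A \<inter> B \<subseteq> {z}" for A B z
  proof (rule set_integral_Un_AE)
    show "AE x in lebesgue. \<not> (x \<in> A \<and> x \<in> B)"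
      using AE_neq_point[of z] by eventually_elim (use that in auto)
  qed (use that sI in auto)
  \<comment> \<open>The limits are the values at an interior point corrected by the integral over
    the remaining half of the interval.\<close>
  define Lb where "Lb = W c + ?int (?I \<inter> {c..})"
  define La where "La = W c - ?int (?I \<inter> {..c})"
  have right: "W x - Lb = - ?int (?I \<inter> {x..})" if x: "x \<in> ?I" "c \<le> x" for x
  proof -
    have "?I \<inter> {c..} = {c..x} \<union> (?I \<inter> {x..})" using Ioo_e_interval[OF c x(1)] x by auto
    then have "?int (?I \<inter> {c..}) = ?int {c..x} + ?int (?I \<inter> {x..})"
      using Ioo_e_interval[OF c x(1)] by (simp only:) (rule split[of _ _ x], auto)
    then show ?thesis using W[OF c x] by (simp add: Lb_def)
  qed
  have left: "W x - La = ?int (?I \<inter> {..x})" if x: "x \<in> ?I" "x \<le> c" for x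
  proof -
    have "?I \<inter> {..c} = (?I \<inter> {..x}) \<union> {x..c}" using Ioo_e_interval[OF x(1) c] x by auto
    then have "?int (?I \<inter> {..c}) = ?int (?I \<inter> {..x}) + ?int {x..c}"
      using Ioo_e_interval[OF x(1) c] by (simp only:) (rule split[of _ _ x], auto)
    then show ?thesis using W[OF x(1) c x(2)] by (simp add: La_def)
  qed
  show ?thesis
  proof (rule that)
    show "(W \<longlongrightarrow> Lb) (at_right_end b)"
    proof (rule tendstoI)
      fix e :: real assume e: "0 < e"
      obtain m n where mn: "m \<in> ?I" "n \<in> ?I"
        and small: "\<And>S. S \<in> sets lebesgue \<Longrightarrow> S \<subseteq> ?I - {m..n} \<Longrightarrow> cmod (?int S) < e"
        by (rule integral_tail_small[OF ab G e], rule that)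
      from eventually_conj[OF eventually_at_right_end[OF mn(2)] eventually_at_right_end[OF c]]
      show "\<forall>\<^sub>F x in at_right_end b. dist (W x) Lb < e"
      proof eventually_elim
        case (elim x)
        then have "cmod (?int (?I \<inter> {x..})) < e" by (intro small) auto
        then show ?case using right[of x] elim by (simp add: dist_norm)
      qed
    qed
    show "(W \<longlongrightarrow> La) (at_left_end a)"
    proof (rule tendstoI)
      fix e :: real assume e: "0 < e"
      obtain m n where mn: "m \<in> ?I" "n \<in> ?I"
        and small: "\<And>S. S \<in> sets lebesgue \<Longrightarrow> S \<subseteq> ?I - {m..n} \<Longrightarrow> cmod (?int S) < e"
        by (rule integral_tail_small[OF ab G e], rule that)
      from eventually_conj[OF eventually_at_left_end[OF mn(1)] eventually_at_left_end[OF c]]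
      show "\<forall>\<^sub>F x in at_left_end a. dist (W x) La < e"
      proof eventually_elim
        case (elim x)
        then have "cmod (?int (?I \<inter> {..x})) < e" by (intro small) auto
        then show ?case using left[of x] elim by (simp add: dist_norm)
      qed
    qed
    have "?I = (?I \<inter> {..c}) \<union> (?I \<inter> {c..})" by auto
    then have "?int ?I = ?int ((?I \<inter> {..c}) \<union> (?I \<inter> {c..}))" by (rule arg_cong)
    also have "\<dots> = ?int (?I \<inter> {..c}) + ?int (?I \<inter> {c..})" by (rule split[of _ _ c]) auto
    finally show "?int ?I = Lb - La" by (simp add: La_def Lb_def)
  qed
qed

lemma AC_locI_continuous:
  assumes "AC_loc a b f" shows "continuous_on (Ioo_e a b) f"
proof -
  have "isCont f x" if x: "x \<in> Ioo_e a b" for x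
  proof -
    obtain y z where yz: "y \<in> Ioo_e a b" "z \<in> Ioo_e a b" "y < x" "x < z" using Ioo_e_extend[OF x] .
    have "continuous_on {y..z} f"
      using assms Ioo_e_interval[OF yz(1,2)] abs_cont_on_continuous by (auto simp: AC_loc_def)
    then show ?thesis using yz by (intro continuous_on_interior) auto
  qed
  then show ?thesis by (simp add: continuous_at_imp_continuous_on)
qed

lemma AC_loc_mult: "AC_loc a b f \<Longrightarrow> AC_loc a b g \<Longrightarrow> AC_loc a b (\<lambda>x. f x * g x)"
  and AC_loc_add: "AC_loc a b f \<Longrightarrow> AC_loc a b g \<Longrightarrow> AC_loc a b (\<lambda>x. f x + g x)"
  and AC_loc_diff: "AC_loc a b f \<Longrightarrow> AC_loc a b g \<Longrightarrow> AC_loc a b (\<lambda>x. f x - g x)"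
  and AC_loc_cmult: "AC_loc a b f \<Longrightarrow> AC_loc a b (\<lambda>x. k * f x)"
  by (auto simp: AC_loc_def intro: abs_cont_on_mult abs_cont_on_add abs_cont_on_diff abs_cont_on_cmult)

lemma abs_cont_on_cong:
  assumes "\<And>x. x \<in> {c..d} \<Longrightarrow> f x = g x" "abs_cont_on c d f" shows "abs_cont_on c d g"
  using assms(2) by (rule abs_cont_on_dominated[OF _ assms(2), where C=1]) (use assms(1) in auto)

lemma AC_loc_cong:
  assumes "\<And>x. x \<in> Ioo_e a b \<Longrightarrow> f x = g x" "AC_loc a b f" shows "AC_loc a b g"
  using assms abs_cont_on_cong[of _ _ f g] unfolding AC_loc_def by blast

section \<open>The maximal operator, Lagrange's identity and Green's formula\<close>

locale SL =
  fixes a b :: ereal and p q r :: "real \<Rightarrow> real"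
  assumes SLs: "SL_setup a b p q r"
begin

lemma ab: "a < b" using SLs by (simp add: SL_setup_def)

sublocale weighted_L2 a b r
  using SLs by unfold_locales (auto simp: SL_setup_def)

lemma p_pos: "AE x in lebesgue. x \<in> I \<longrightarrow> 0 < p x"
  using SLs by (simp add: SL_setup_def)

abbreviation "Q1 \<equiv> qd a b p"

text \<open>The first-order system behind $\tau f = h$, with the quasi-derivative as a free argument: unlike
  \<^const>\<open>qd\<close> it does not involve a definite description.\<close>

definition sys :: "fn \<Rightarrow> fn \<Rightarrow> fn \<Rightarrow> bool" where
  "sys f f1 h \<longleftrightarrow> AC_loc a b f \<and> AC_loc a b f1 \<and> (AE x in lebesgue. x \<in> I \<longrightarrow>
      (f has_vector_derivative (f1 x / complex_of_real (p x))) (at x) \<and>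
      (f1 has_vector_derivative (complex_of_real (q x) * f x - complex_of_real (r x) * h x)) (at x))"

lemma T_max_iff: "(g, h) \<in> T_max a b p q r \<longleftrightarrow> LL g \<and> LL h \<and> sys g (Q1 g) h"
  by (auto simp: T_max_def sys_def)

lemma sol_iff: "is_sol a b p q r 0 u \<longleftrightarrow> sys u (Q1 u) (\<lambda>_. 0)"
  by (simp add: is_sol_def sys_def)

lemma has_vector_derivative_cong_I:
  assumes "\<And>x. x \<in> I \<Longrightarrow> f x = g x" "x \<in> I" "(f has_vector_derivative D) (at x)"
  shows "(g has_vector_derivative D) (at x)"
  using assms(3) by (rule has_vector_derivative_transform_within_open[OF _ open_Ioo_e assms(2)]) (use assms(1) in auto)

text \<open>Discharges the definite description in \<open>qd\<close>. Two candidates agree almost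
  everywhere because \<open>p\<close> is nonzero there, hence everywhere on \<open>I\<close> by
  continuity, and off \<open>I\<close> both are 0 by convention.\<close>

lemma qd_eq:
  assumes s: "sys f f1 h" and x: "x \<in> I" shows "Q1 f x = f1 x"
proof -
  define y where "y t = (if t \<in> I then f1 t else 0)" for t
  let ?P = "\<lambda>y1. AC_loc a b y1 \<and> (\<forall>x. x \<notin> I \<longrightarrow> y1 x = 0) \<and>
      (AE x in lebesgue. x \<in> I \<longrightarrow> (f has_vector_derivative (y1 x / complex_of_real (p x))) (at x))"
  have y: "?P y"
  proof (intro conjI allI impI)
    show "AC_loc a b y" using s by (intro AC_loc_cong[of a b f1 y]) (auto simp: y_def sys_def)
    show "t \<notin> I \<Longrightarrow> y t = 0" for t by (simp add: y_def)
    have "AE x in lebesgue. x \<in> I \<longrightarrow> (f has_vector_derivative (f1 x / complex_of_real (p x))) (at x)"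
      using s unfolding sys_def by (auto elim: eventually_mono)
    then show "AE x in lebesgue. x \<in> I \<longrightarrow> (f has_vector_derivative (y x / complex_of_real (p x))) (at x)"
      by eventually_elim (simp add: y_def)
  qed
  have "z = y" if z: "?P z" for z
  proof
    fix t
    have ae: "AE x in lebesgue. x \<in> I \<longrightarrow> z x = y x"
      using z[THEN conjunct2, THEN conjunct2] y[THEN conjunct2, THEN conjunct2] p_pos
    proof eventually_elim
      case (elim x)
      show ?case
      proof
        assume x: "x \<in> I"
        with elim have "z x / complex_of_real (p x) = y x / complex_of_real (p x)"
          using vector_derivative_unique_at by blast
        then show "z x = y x" using elim x by simp
      qed
    qed
    show "z t = y t"
    proof (cases "t \<in> I")
      case True
      then show ?thesis
        using z y by (intro continuous_AE_eq_on_open[OF open_Ioo_e _ _ ae True] AC_locI_continuous) auto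
    qed (use z y in auto)
  qed
  then have "Q1 f = y" unfolding qd_def using y by (intro the_equality)
  with x show ?thesis by (simp add: y_def)
qed

lemma sys_cong:
  assumes s: "sys f f1 h" and e: "\<And>x. x \<in> I \<Longrightarrow> f x = g x" "\<And>x. x \<in> I \<Longrightarrow> f1 x = g1 x" "eqv h k"
  shows "sys g g1 k"
  unfolding sys_def
proof (intro conjI)
  show "AC_loc a b g" "AC_loc a b g1" using s e AC_loc_cong[of a b f g] AC_loc_cong[of a b f1 g1] unfolding sys_def by blast+
  have "AE x in lebesgue. x \<in> I \<longrightarrow>
      (f has_vector_derivative (f1 x / complex_of_real (p x))) (at x) \<and>
      (f1 has_vector_derivative (complex_of_real (q x) * f x - complex_of_real (r x) * h x)) (at x)"
    using s by (simp add: sys_def)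
  moreover have "AE x in lebesgue. x \<in> I \<longrightarrow> h x = k x" using e(3) by (simp add: ae_eq_def)
  ultimately show "AE x in lebesgue. x \<in> I \<longrightarrow>
      (g has_vector_derivative (g1 x / complex_of_real (p x))) (at x) \<and>
      (g1 has_vector_derivative (complex_of_real (q x) * g x - complex_of_real (r x) * k x)) (at x)"
  proof eventually_elim
    case (elim x)
    then show ?case
      using has_vector_derivative_cong_I[of f g x] has_vector_derivative_cong_I[of f1 g1 x] e by auto
  qed
qed

lemma sys_qd: "sys f f1 h \<Longrightarrow> sys f (Q1 f) h"
  by (rule sys_cong) (auto simp: qd_eq)

lemma sys_lincomb:
  assumes f: "sys f f1 h" and g: "sys g g1 k"
  shows "sys (\<lambda>x. c * f x + d * g x) (\<lambda>x. c * f1 x + d * g1 x) (\<lambda>x. c * h x + d * k x)"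
  unfolding sys_def
proof (intro conjI)
  show "AC_loc a b (\<lambda>x. c * f x + d * g x)" "AC_loc a b (\<lambda>x. c * f1 x + d * g1 x)"
    using f g by (auto simp: sys_def intro!: AC_loc_add AC_loc_cmult)
  show "AE x in lebesgue. x \<in> I \<longrightarrow>
      ((\<lambda>x. c * f x + d * g x) has_vector_derivative ((c * f1 x + d * g1 x) / complex_of_real (p x))) (at x) \<and>
      ((\<lambda>x. c * f1 x + d * g1 x) has_vector_derivative
        (complex_of_real (q x) * (c * f x + d * g x) - complex_of_real (r x) * (c * h x + d * k x))) (at x)"
    using f[unfolded sys_def, THEN conjunct2, THEN conjunct2] g[unfolded sys_def, THEN conjunct2, THEN conjunct2]
  proof eventually_elim
    case (elim x)
    show ?case
    proof (intro impI conjI)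
      assume x: "x \<in> I"
      have "((\<lambda>x. c * f x + d * g x) has_vector_derivative (c * (f1 x / complex_of_real (p x)) + d * (g1 x / complex_of_real (p x)))) (at x)"
        using elim x by (intro has_vector_derivative_add has_vector_derivative_mult_right) auto
      then show "((\<lambda>x. c * f x + d * g x) has_vector_derivative ((c * f1 x + d * g1 x) / complex_of_real (p x))) (at x)"
        by (simp add: add_divide_distrib)
      have "((\<lambda>x. c * f1 x + d * g1 x) has_vector_derivative
        (c * (complex_of_real (q x) * f x - complex_of_real (r x) * h x) + d * (complex_of_real (q x) * g x - complex_of_real (r x) * k x))) (at x)"
        using elim x by (intro has_vector_derivative_add has_vector_derivative_mult_right) auto
      then show "((\<lambda>x. c * f1 x + d * g1 x) has_vector_derivative
        (complex_of_real (q x) * (c * f x + d * g x) - complex_of_real (r x) * (c * h x + d * k x))) (at x)"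
        by (simp add: algebra_simps)
    qed
  qed
qed

lemma T_max_L2: "(g, h) \<in> T_max a b p q r \<Longrightarrow> LL g" "(g, h) \<in> T_max a b p q r \<Longrightarrow> LL h"
  by (auto simp: T_max_iff)

lemma T_max_lincomb:
  assumes "(f, h) \<in> T_max a b p q r" "(g, k) \<in> T_max a b p q r"
  shows "((\<lambda>x. c * f x + d * g x), (\<lambda>x. c * h x + d * k x)) \<in> T_max a b p q r"
  using assms unfolding T_max_iff by (auto intro!: L2_add L2_cmult sys_qd[OF sys_lincomb])

lemma T_max_cong:
  assumes "(f, h) \<in> T_max a b p q r" "\<And>x. x \<in> I \<Longrightarrow> f x = g x" "eqv h k" "LL k" "LL g"
  shows "(g, k) \<in> T_max a b p q r"
  using assms unfolding T_max_iff by (auto intro!: sys_qd[OF sys_cong[of f "Q1 f" h]])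

lemma qd_lincomb:
  assumes "sys f f1 h" "sys g g1 k" "x \<in> I"
  shows "Q1 (\<lambda>x. c * f x + d * g x) x = c * Q1 f x + d * Q1 g x"
  using qd_eq[OF sys_lincomb[OF assms(1,2)] assms(3)] qd_eq[OF assms(1,3)] qd_eq[OF assms(2,3)] by simp

lemma lagrange:
  assumes f: "sys f f1 h" and g: "sys g g1 k"
    and int: "set_integrable lebesgue {c..d} (\<lambda>x. complex_of_real (r x) * (h x * g x - f x * k x))"
    and cd: "c \<in> I" "d \<in> I" "c \<le> d"
  shows "set_lebesgue_integral lebesgue {c..d} (\<lambda>x. complex_of_real (r x) * (h x * g x - f x * k x))
    = (f d * g1 d - f1 d * g d) - (f c * g1 c - f1 c * g c)"
proof -
  have sub: "{c..d} \<subseteq> I" by (rule Ioo_e_interval[OF cd(1,2)])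
  have "AC_loc a b (\<lambda>x. f x * g1 x - f1 x * g x)"
    using f g by (auto simp: sys_def intro!: AC_loc_diff AC_loc_mult)
  then have ac: "abs_cont_on c d (\<lambda>x. f x * g1 x - f1 x * g x)" using sub by (auto simp: AC_loc_def)
  have der: "AE x in lebesgue. x \<in> {c..d} \<longrightarrow>
      ((\<lambda>x. f x * g1 x - f1 x * g x) has_vector_derivative (complex_of_real (r x) * (h x * g x - f x * k x))) (at x)"
    using f[unfolded sys_def, THEN conjunct2, THEN conjunct2] g[unfolded sys_def, THEN conjunct2, THEN conjunct2]
  proof eventually_elim
    case (elim x)
    show ?case
    proof
      assume "x \<in> {c..d}" then have x: "x \<in> I" using sub by auto
      have "((\<lambda>x. f x * g1 x - f1 x * g x) has_vector_derivative
        ((f x * (complex_of_real (q x) * g x - complex_of_real (r x) * k x) + (f1 x / complex_of_real (p x)) * g1 x)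
        - (f1 x * (g1 x / complex_of_real (p x)) + (complex_of_real (q x) * f x - complex_of_real (r x) * h x) * g x))) (at x)"
        using elim x by (intro has_vector_derivative_diff has_vector_derivative_mult) auto
      then show "((\<lambda>x. f x * g1 x - f1 x * g x) has_vector_derivative (complex_of_real (r x) * (h x * g x - f x * k x))) (at x)"
        by (simp add: algebra_simps)
    qed
  qed
  show ?thesis by (rule abs_cont_on_FTC[OF ac cd(3) der int])
qed

lemma T_max_density_integrable:
  assumes "(f, h) \<in> T_max a b p q r" "(g, k) \<in> T_max a b p q r"
  shows "set_integrable lebesgue I (\<lambda>x. complex_of_real (r x) * (h x * g x - f x * k x))"
proof -
  have "set_integrable lebesgue I (\<lambda>x. h x * g x * complex_of_real (r x) - f x * k x * complex_of_real (r x))"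
    using T_max_L2[OF assms(1)] T_max_L2[OF assms(2)] by (intro set_integral_diff L2_mult_integrable)
  then show ?thesis by (simp add: algebra_simps)
qed

lemma T_max_wronskian:
  assumes f: "(f, h) \<in> T_max a b p q r" and g: "(g, k) \<in> T_max a b p q r" and cd: "c \<in> I" "d \<in> I" "c \<le> d"
  shows "set_lebesgue_integral lebesgue {c..d} (\<lambda>x. complex_of_real (r x) * (h x * g x - f x * k x))
    = Wr a b p f g d - Wr a b p f g c"
  unfolding Wr_def using f g Ioo_e_interval[OF cd(1,2)]
  by (intro lagrange[OF _ _ _ cd] set_integrable_subset[OF T_max_density_integrable[OF f g]]) (auto simp: T_max_iff)

lemma T_max_green:
  assumes f: "(f, h) \<in> T_max a b p q r" and g: "(g, k) \<in> T_max a b p q r"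
  shows "(Wr a b p f g \<longlongrightarrow> Lim (at_left_end a) (Wr a b p f g)) (at_left_end a)"
    "(Wr a b p f g \<longlongrightarrow> Lim (at_right_end b) (Wr a b p f g)) (at_right_end b)"
    "set_lebesgue_integral lebesgue I (\<lambda>x. complex_of_real (r x) * (h x * g x - f x * k x))
      = Lim (at_right_end b) (Wr a b p f g) - Lim (at_left_end a) (Wr a b p f g)"
proof -
  obtain La Lb where L: "(Wr a b p f g \<longlongrightarrow> La) (at_left_end a)" "(Wr a b p f g \<longlongrightarrow> Lb) (at_right_end b)"
    "set_lebesgue_integral lebesgue I (\<lambda>x. complex_of_real (r x) * (h x * g x - f x * k x)) = Lb - La"
    by (rule end_limits[OF ab T_max_density_integrable[OF f g], where W="Wr a b p f g"])
      (erule (2) T_max_wronskian[OF f g], rule that)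
  have La: "Lim (at_left_end a) (Wr a b p f g) = La" by (rule tendsto_Lim[OF at_left_end_neq_bot[OF ab] L(1)])
  have Lb: "Lim (at_right_end b) (Wr a b p f g) = Lb" by (rule tendsto_Lim[OF at_right_end_neq_bot[OF ab] L(2)])
  show "(Wr a b p f g \<longlongrightarrow> Lim (at_left_end a) (Wr a b p f g)) (at_left_end a)"
    "(Wr a b p f g \<longlongrightarrow> Lim (at_right_end b) (Wr a b p f g)) (at_right_end b)"
    "set_lebesgue_integral lebesgue I (\<lambda>x. complex_of_real (r x) * (h x * g x - f x * k x))
      = Lim (at_right_end b) (Wr a b p f g) - Lim (at_left_end a) (Wr a b p f g)"
    unfolding La Lb by (rule L)+
qed

text \<open>The Pluecker relation for four functions. With a normalized pair u, v it expresses every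
  boundary Wronskian as a determinant of boundary values.\<close>

lemma Wr_plucker:
  assumes "Wr a b p u v x = 1"
  shows "Wr a b p f g x = Wr a b p u f x * Wr a b p v g x - Wr a b p u g x * Wr a b p v f x"
proof -
  have "Wr a b p f g x * Wr a b p u v x = Wr a b p u f x * Wr a b p v g x - Wr a b p u g x * Wr a b p v f x"
    unfolding Wr_def by (simp add: algebra_simps)
  with assms show ?thesis by simp
qed

lemma Wr_lincomb:
  assumes "(f, h) \<in> T_max a b p q r" "(g, k) \<in> T_max a b p q r" "x \<in> I"
  shows "Wr a b p u (\<lambda>x. c * f x + d * g x) x = c * Wr a b p u f x + d * Wr a b p u g x"
  using assms qd_lincomb[of f "Q1 f" h g "Q1 g" k x c d] by (auto simp: Wr_def T_max_iff algebra_simps)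

lemma eventually_I_left: "\<forall>\<^sub>F x in at_left_end a. x \<in> I"
  and eventually_I_right: "\<forall>\<^sub>F x in at_right_end b. x \<in> I"
proof -
  obtain c where c: "c \<in> I" by (rule Ioo_e_nonempty[OF ab])
  show "\<forall>\<^sub>F x in at_left_end a. x \<in> I" using eventually_at_left_end[OF c] by eventually_elim simp
  show "\<forall>\<^sub>F x in at_right_end b. x \<in> I" using eventually_at_right_end[OF c] by eventually_elim simp
qed

text \<open>The limit circle condition gives integrability near each end and continuity gives it in
  between, so all solutions for z = 0 serve as elements of the maximal domain in Green's
  formula.\<close>

lemma limit_circle_T_max:
  assumes lc: "limit_circle_a a b p q r" "limit_circle_b a b p q r" and u: "is_sol a b p q r 0 u"
  shows "(u, \<lambda>_. 0) \<in> T_max a b p q r"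
proof -
  let ?g = "\<lambda>x. (cmod (u x))\<^sup>2 * r x"
  obtain c where c: "c \<in> I" "set_integrable lebesgue {x \<in> I. x < c} ?g"
    using lc(1) u by (auto simp: limit_circle_a_def)
  obtain d where d: "d \<in> I" "set_integrable lebesgue {x \<in> I. d < x} ?g"
    using lc(2) u by (auto simp: limit_circle_b_def)
  have s: "sys u (Q1 u) (\<lambda>_. 0)" using u by (simp add: sol_iff)
  then have cu: "continuous_on I u" by (auto simp: sys_def intro: AC_locI_continuous)
  have mu: "(\<lambda>x. indicator I x *\<^sub>R u x) \<in> borel_measurable lebesgue"
    using borel_measurable_continuous_on_indicator[OF borel_open[OF open_Ioo_e] cu]
    by (intro measurable_completion) simp
  have mid: "set_integrable lebesgue {c..d} ?g"
  proof -
    have sub: "{c..d} \<subseteq> I" by (rule Ioo_e_interval[OF c(1) d(1)])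
    have ri: "set_integrable lebesgue {c..d} r" using SLs sub by (auto simp: SL_setup_def loc_int_def)
    have "abs_cont_on c d u" using s sub by (auto simp: sys_def AC_loc_def)
    then obtain B where B: "0 \<le> B" "\<And>x. x \<in> {c..d} \<Longrightarrow> cmod (u x) \<le> B" by (rule abs_cont_on_bounded) (rule that)
    show ?thesis
    proof (rule set_integrable_bound)
      show "set_integrable lebesgue {c..d} (\<lambda>x. B\<^sup>2 * r x)" using ri by simp
      have "(\<lambda>x. (cmod (indicator I x *\<^sub>R u x))\<^sup>2 * (indicator {c..d} x * r x)) \<in> borel_measurable lebesgue"
      proof (rule borel_measurable_times[OF borel_measurable_power[OF measurable_compose[OF mu borel_measurable_norm]]])
        show "(\<lambda>x. indicator {c..d} x * r x) \<in> borel_measurable lebesgue"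
          using borel_measurable_integrable[OF ri[unfolded set_integrable_def]] by simp
      qed
      moreover have "(\<lambda>x. (cmod (indicator I x *\<^sub>R u x))\<^sup>2 * (indicator {c..d} x * r x)) = (\<lambda>x. indicator {c..d} x *\<^sub>R ?g x)"
        using sub by (auto simp: fun_eq_iff indicator_def)
      ultimately show "set_borel_measurable lebesgue {c..d} ?g" unfolding set_borel_measurable_def by (simp only:)
      show "AE x in lebesgue. x \<in> {c..d} \<longrightarrow> norm (?g x) \<le> norm (B\<^sup>2 * r x)"
        by (intro AE_I2) (auto simp: abs_mult intro!: mult_right_mono power_mono B(2))
    qed
  qed
  have Isets: "{x \<in> I. x < c} \<in> sets lebesgue" "{x \<in> I. d < x} \<in> sets lebesgue"
  proof -
    have eq: "{x \<in> I. x < c} = I \<inter> {..<c}" "{x \<in> I. d < x} = I \<inter> {d<..}" by auto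
    show "{x \<in> I. x < c} \<in> sets lebesgue" "{x \<in> I. d < x} \<in> sets lebesgue"
      unfolding eq by (rule sets.Int, simp, simp)+
  qed
  \<comment> \<open>If d < c the middle interval is empty and the two outer pieces already cover
    \<open>I\<close>.\<close>
  have "set_integrable lebesgue (({x \<in> I. x < c} \<union> {c..d}) \<union> {x \<in> I. d < x}) ?g"
    using Isets by (intro set_integrable_Un c(2) d(2) mid) auto
  then have "set_integrable lebesgue I ?g" by (rule set_integrable_subset) auto
  then have "LL u" using mu by (simp add: L2_def set_borel_measurable_def)
  with s show ?thesis by (simp add: T_max_iff L2_zero)
qed

end

section \<open>Generalized boundary values\<close>

lemma set_integrable_mult_continuous:
  fixes k :: "real \<Rightarrow> real" and B :: "real \<Rightarrow> complex"
  assumes k: "set_integrable lebesgue {c..d} k" and B: "continuous_on {c..d} B"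
  shows "set_integrable lebesgue {c..d} (\<lambda>x. complex_of_real (k x) * B x)"
proof -
  have "bounded (B ` {c..d})" by (intro compact_imp_bounded compact_continuous_image B) auto
  then obtain C where C: "\<And>x. x \<in> {c..d} \<Longrightarrow> cmod (B x) \<le> C" unfolding bounded_iff by blast
  have mk: "(\<lambda>x. complex_of_real (indicator {c..d} x *\<^sub>R k x)) \<in> borel_measurable lebesgue"
    using borel_measurable_integrable[OF k[unfolded set_integrable_def]] by measurable
  have mB: "(\<lambda>x. indicator {c..d} x *\<^sub>R B x) \<in> borel_measurable lebesgue"
    using borel_measurable_continuous_on_indicator[OF _ B] by (intro measurable_completion) simp
  show ?thesis
  proof (rule set_integrable_bound)
    show "set_integrable lebesgue {c..d} (\<lambda>x. C * k x)" using k by simp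
    have "(\<lambda>x. indicator {c..d} x *\<^sub>R (complex_of_real (k x) * B x))
      = (\<lambda>x. complex_of_real (indicator {c..d} x *\<^sub>R k x) * (indicator {c..d} x *\<^sub>R B x))"
      by (auto simp: fun_eq_iff indicator_def)
    with borel_measurable_times[OF mk mB]
    show "set_borel_measurable lebesgue {c..d} (\<lambda>x. complex_of_real (k x) * B x)"
      unfolding set_borel_measurable_def by (simp only:)
    have "cmod (complex_of_real (k x) * B x) \<le> \<bar>C * k x\<bar>" if "x \<in> {c..d}" for x
    proof -
      have "\<bar>k x\<bar> * cmod (B x) \<le> \<bar>k x\<bar> * \<bar>C\<bar>" using C[OF that] by (intro mult_left_mono) auto
      then show ?thesis by (simp add: norm_mult abs_mult mult.commute)
    qed
    then show "AE x in lebesgue. x \<in> {c..d} \<longrightarrow> norm (complex_of_real (k x) * B x) \<le> norm (C * k x)"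
      by (intro AE_I2) simp
  qed
qed

lemma set_integral_indicator_mult:
  fixes k :: "real \<Rightarrow> real"
  shows "set_lebesgue_integral M A (\<lambda>x. indicator B x * k x) = set_lebesgue_integral M (A \<inter> B) k"
    and "set_integrable M A (\<lambda>x. indicator B x * k x) \<longleftrightarrow> set_integrable M (A \<inter> B) k"
proof -
  have "(\<lambda>x. indicator A x *\<^sub>R (indicator B x * k x)) = (\<lambda>x. indicator (A \<inter> B) x *\<^sub>R k x)"
    by (auto simp: fun_eq_iff indicator_def)
  then show "set_lebesgue_integral M A (\<lambda>x. indicator B x * k x) = set_lebesgue_integral M (A \<inter> B) k"
    "set_integrable M A (\<lambda>x. indicator B x * k x) \<longleftrightarrow> set_integrable M (A \<inter> B) k"
    unfolding set_lebesgue_integral_def set_integrable_def by simp_all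
qed

lemma set_integral_mono_set_real:
  fixes k :: "real \<Rightarrow> real"
  assumes i: "set_integrable lebesgue B k" and AB: "A \<subseteq> B" "A \<in> sets lebesgue"
    and nn: "AE x in lebesgue. x \<in> B \<longrightarrow> 0 \<le> k x"
  shows "set_lebesgue_integral lebesgue A k \<le> set_lebesgue_integral lebesgue B k"
  unfolding set_lebesgue_integral_def
proof (rule integral_mono_AE)
  show "integrable lebesgue (\<lambda>x. indicator B x *\<^sub>R k x)" using i by (simp add: set_integrable_def)
  show "integrable lebesgue (\<lambda>x. indicator A x *\<^sub>R k x)"
    using set_integrable_subset[OF i AB(2,1)] by (simp add: set_integrable_def)
  show "AE x in lebesgue. indicator A x *\<^sub>R k x \<le> indicator B x *\<^sub>R k x"
    using nn by eventually_elim (use AB(1) in \<open>auto simp: indicator_def\<close>)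
qed

lemma set_integral_nonneg_AE_real:
  fixes k :: "real \<Rightarrow> real"
  assumes "AE x in lebesgue. x \<in> A \<longrightarrow> 0 \<le> k x"
  shows "0 \<le> set_lebesgue_integral lebesgue A k"
  unfolding set_lebesgue_integral_def
  by (rule integral_nonneg_AE) (use assms in eventually_elim, auto simp: indicator_def)

lemma set_integral_pos_interval:
  fixes k :: "real \<Rightarrow> real"
  assumes i: "set_integrable lebesgue {u..v} k" and uv: "u < v"
    and pos: "AE x in lebesgue. x \<in> {u..v} \<longrightarrow> 0 < k x"
  shows "0 < set_lebesgue_integral lebesgue {u..v} k"
proof -
  have nn: "0 \<le> set_lebesgue_integral lebesgue {u..v} k"
    by (rule set_integral_nonneg_AE_real) (use pos in eventually_elim, auto)
  have "set_lebesgue_integral lebesgue {u..v} k \<noteq> 0"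
  proof
    assume "set_lebesgue_integral lebesgue {u..v} k = 0"
    then have "AE x in lebesgue. indicator {u..v} x *\<^sub>R k x = 0"
      unfolding set_lebesgue_integral_def
    proof (subst (asm) integral_nonneg_eq_0_iff_AE)
      show "integrable lebesgue (\<lambda>x. indicator {u..v} x *\<^sub>R k x)" using i by (simp add: set_integrable_def)
      show "AE x in lebesgue. 0 \<le> indicator {u..v} x *\<^sub>R k x"
        using pos by eventually_elim (auto simp: indicator_def)
    qed
    with pos have "AE x in lebesgue. x \<notin> {u..v}" by eventually_elim (auto simp: indicator_def)
    then have "{u..v} \<in> null_sets lebesgue" by (simp add: AE_iff_null_sets)
    then have "negligible {u..v}" by (simp add: negligible_iff_null_sets)
    then show False using uv negligible_interval(1)[of u v] by simp
  qed
  with nn show ?thesis by simp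
qed

context SL
begin

lemma r_int: "c \<in> I \<Longrightarrow> d \<in> I \<Longrightarrow> set_integrable lebesgue {c..d} r"
  and p_int: "c \<in> I \<Longrightarrow> d \<in> I \<Longrightarrow> set_integrable lebesgue {c..d} (\<lambda>x. 1 / p x)"
  using SLs Ioo_e_interval[of c a b d] by (auto simp: SL_setup_def loc_int_def)

lemma sys_cnj: assumes "sys f f1 h" shows "sys (\<lambda>x. cnj (f x)) (\<lambda>x. cnj (f1 x)) (\<lambda>x. cnj (h x))"
  unfolding sys_def
proof (intro conjI)
  have "AC_loc a b (\<lambda>x. cnj (g x))" if "AC_loc a b g" for g
    unfolding AC_loc_def
  proof (intro allI impI)
    fix c d assume "{c..d} \<subseteq> I"
    then have g: "abs_cont_on c d g" using that by (auto simp: AC_loc_def)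
    show "abs_cont_on c d (\<lambda>x. cnj (g x))"
      by (rule abs_cont_on_dominated[OF g g, where C=1]) (simp_all flip: complex_cnj_diff)
  qed
  then show "AC_loc a b (\<lambda>x. cnj (f x))" "AC_loc a b (\<lambda>x. cnj (f1 x))" using assms by (auto simp: sys_def)
  show "AE x in lebesgue. x \<in> I \<longrightarrow>
      ((\<lambda>x. cnj (f x)) has_vector_derivative (cnj (f1 x) / complex_of_real (p x))) (at x) \<and>
      ((\<lambda>x. cnj (f1 x)) has_vector_derivative (complex_of_real (q x) * cnj (f x) - complex_of_real (r x) * cnj (h x))) (at x)"
    using assms[unfolded sys_def, THEN conjunct2, THEN conjunct2]
  proof eventually_elim
    case (elim x)
    then show ?case
      using bounded_linear.has_vector_derivative[OF bounded_linear_cnj, of f _ "at x"]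
        bounded_linear.has_vector_derivative[OF bounded_linear_cnj, of f1 _ "at x"] by fastforce
  qed
qed

lemma real_sol_sys: "real_sol a b p q r u \<Longrightarrow> sys u (Q1 u) (\<lambda>_. 0)"
  by (simp add: real_sol_def sol_iff)

lemma real_sol_cnj:
  assumes u: "real_sol a b p q r u" and x: "x \<in> I"
  shows "cnj (u x) = u x" "cnj (Q1 u x) = Q1 u x"
proof -
  have c: "cnj (u y) = u y" if "y \<in> I" for y using u that by (auto simp: real_sol_def Reals_cnj_iff)
  then show "cnj (u x) = u x" using x by simp
  have "sys u (\<lambda>x. cnj (Q1 u x)) (\<lambda>_. 0)"
    by (rule sys_cong[OF sys_cnj[OF real_sol_sys[OF u]]]) (auto simp: c)
  from qd_eq[OF this x] show "cnj (Q1 u x) = Q1 u x" by simp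
qed

lemma Wr_real_sol:
  assumes "real_sol a b p q r u" "real_sol a b p q r v" "x \<in> I"
  shows "cnj (Wr a b p u v x) = Wr a b p u v x"
  using assms by (simp add: Wr_def real_sol_cnj)

lemma Lim_Wr_real:
  assumes u: "real_sol a b p q r u" and v: "real_sol a b p q r v"
    and L: "(Wr a b p u v \<longlongrightarrow> l) F" and F: "F \<noteq> bot" "\<forall>\<^sub>F x in F. x \<in> I"
  shows "cnj l = l"
proof -
  have "((\<lambda>x. cnj (Wr a b p u v x)) \<longlongrightarrow> cnj l) F" by (intro tendsto_cnj L)
  moreover have "\<forall>\<^sub>F x in F. cnj (Wr a b p u v x) = Wr a b p u v x"
    using F(2) by eventually_elim (rule Wr_real_sol[OF u v])
  ultimately have "(Wr a b p u v \<longlongrightarrow> cnj l) F" using tendsto_cong by fastforce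
  with L show ?thesis using tendsto_unique[OF F(1)] by blast
qed

end

locale SL_bc = SL +
  fixes ua uah ub ubh :: fn and \<beta> :: real
  assumes lc_a: "limit_circle_a a b p q r" and lc_b: "limit_circle_b a b p q r"
    and ua: "principal_a a b p q r ua" and uah: "real_sol a b p q r uah"
    and W_a: "\<And>x. x \<in> Ioo_e a b \<Longrightarrow> Wr a b p uah ua x = 1"
    and ub: "real_sol a b p q r ub" and ubh: "real_sol a b p q r ubh"
    and W_b: "\<And>x. x \<in> Ioo_e a b \<Longrightarrow> Wr a b p ubh ub x = 1"
begin

abbreviation "TM \<equiv> T_max a b p q r"
abbreviation "bva \<equiv> bv_a a b p ua"
abbreviation "bvda \<equiv> bvd_a a b p uah"
abbreviation "bvb \<equiv> bv_b a b p ub"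
abbreviation "bvdb \<equiv> bvd_b a b p ubh"

definition bcb :: "fn \<Rightarrow> complex" where
  "bcb g = bvb g * complex_of_real (cos \<beta>) - bvdb g * complex_of_real (sin \<beta>)"

lemma ua_real: "real_sol a b p q r ua" using ua by (simp add: principal_a_def)

lemma sol_TM: "real_sol a b p q r u \<Longrightarrow> (u, \<lambda>_. 0) \<in> TM"
  using limit_circle_T_max[OF lc_a lc_b] by (simp add: real_sol_def)

lemmas ua_TM = sol_TM[OF ua_real] and uah_TM = sol_TM[OF uah] and ub_TM = sol_TM[OF ub] and ubh_TM = sol_TM[OF ubh]

lemma Lim_lincomb:
  assumes "(f, h) \<in> TM" "(g, k) \<in> TM" "(u, m) \<in> TM"
  shows "Lim (at_left_end a) (Wr a b p u (\<lambda>x. c * f x + d * g x))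
      = c * Lim (at_left_end a) (Wr a b p u f) + d * Lim (at_left_end a) (Wr a b p u g)"
    and "Lim (at_right_end b) (Wr a b p u (\<lambda>x. c * f x + d * g x))
      = c * Lim (at_right_end b) (Wr a b p u f) + d * Lim (at_right_end b) (Wr a b p u g)"
proof -
  show "Lim (at_left_end a) (Wr a b p u (\<lambda>x. c * f x + d * g x))
      = c * Lim (at_left_end a) (Wr a b p u f) + d * Lim (at_left_end a) (Wr a b p u g)"
  proof (rule tendsto_Lim[OF at_left_end_neq_bot[OF ab]])
    have "((\<lambda>x. c * Wr a b p u f x + d * Wr a b p u g x) \<longlongrightarrow>
      c * Lim (at_left_end a) (Wr a b p u f) + d * Lim (at_left_end a) (Wr a b p u g)) (at_left_end a)"
      by (intro tendsto_intros T_max_green[OF assms(3,1)] T_max_green[OF assms(3,2)])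
    then show "(Wr a b p u (\<lambda>x. c * f x + d * g x) \<longlongrightarrow>
      c * Lim (at_left_end a) (Wr a b p u f) + d * Lim (at_left_end a) (Wr a b p u g)) (at_left_end a)"
      by (rule Lim_transform_eventually)
        (use eventually_I_left in eventually_elim, simp add: Wr_lincomb[OF assms(1,2)])
  qed
  show "Lim (at_right_end b) (Wr a b p u (\<lambda>x. c * f x + d * g x))
      = c * Lim (at_right_end b) (Wr a b p u f) + d * Lim (at_right_end b) (Wr a b p u g)"
  proof (rule tendsto_Lim[OF at_right_end_neq_bot[OF ab]])
    have "((\<lambda>x. c * Wr a b p u f x + d * Wr a b p u g x) \<longlongrightarrow>
      c * Lim (at_right_end b) (Wr a b p u f) + d * Lim (at_right_end b) (Wr a b p u g)) (at_right_end b)"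
      by (intro tendsto_intros T_max_green[OF assms(3,1)] T_max_green[OF assms(3,2)])
    then show "(Wr a b p u (\<lambda>x. c * f x + d * g x) \<longlongrightarrow>
      c * Lim (at_right_end b) (Wr a b p u f) + d * Lim (at_right_end b) (Wr a b p u g)) (at_right_end b)"
      by (rule Lim_transform_eventually)
        (use eventually_I_right in eventually_elim, simp add: Wr_lincomb[OF assms(1,2)])
  qed
qed

lemma bva_lincomb: "(f, h) \<in> TM \<Longrightarrow> (g, k) \<in> TM \<Longrightarrow> bva (\<lambda>x. c * f x + d * g x) = c * bva f + d * bva g"
  and bvda_lincomb: "(f, h) \<in> TM \<Longrightarrow> (g, k) \<in> TM \<Longrightarrow> bvda (\<lambda>x. c * f x + d * g x) = c * bvda f + d * bvda g"
  and bvb_lincomb: "(f, h) \<in> TM \<Longrightarrow> (g, k) \<in> TM \<Longrightarrow> bvb (\<lambda>x. c * f x + d * g x) = c * bvb f + d * bvb g"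
  and bvdb_lincomb: "(f, h) \<in> TM \<Longrightarrow> (g, k) \<in> TM \<Longrightarrow> bvdb (\<lambda>x. c * f x + d * g x) = c * bvdb f + d * bvdb g"
  by (simp_all add: bv_a_def bvd_a_def bv_b_def bvd_b_def Lim_lincomb(1)[OF _ _ ua_TM] Lim_lincomb(1)[OF _ _ uah_TM]
      Lim_lincomb(2)[OF _ _ ub_TM] Lim_lincomb(2)[OF _ _ ubh_TM])

lemma bcb_lincomb: "(f, h) \<in> TM \<Longrightarrow> (g, k) \<in> TM \<Longrightarrow> bcb (\<lambda>x. c * f x + d * g x) = c * bcb f + d * bcb g"
  by (simp add: bcb_def bvb_lincomb bvdb_lincomb algebra_simps)

lemma Lim_Wr_left:
  assumes f: "(f, h) \<in> TM" and g: "(g, k) \<in> TM"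
  shows "Lim (at_left_end a) (Wr a b p f g) = bva f * bvda g - bvda f * bva g"
proof (rule tendsto_Lim[OF at_left_end_neq_bot[OF ab]])
  have "((\<lambda>x. Wr a b p uah f x * Wr a b p ua g x - Wr a b p uah g x * Wr a b p ua f x) \<longlongrightarrow>
    bvda f * (- bva g) - bvda g * (- bva f)) (at_left_end a)"
    unfolding bv_a_def bvd_a_def minus_minus
    by (intro tendsto_intros T_max_green[OF ua_TM f] T_max_green[OF ua_TM g] T_max_green[OF uah_TM f] T_max_green[OF uah_TM g])
  moreover have "bvda f * (- bva g) - bvda g * (- bva f) = bva f * bvda g - bvda f * bva g" by simp
  ultimately show "(Wr a b p f g \<longlongrightarrow> bva f * bvda g - bvda f * bva g) (at_left_end a)"
    by (simp only:) (rule Lim_transform_eventually, assumption,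
        use eventually_I_left in eventually_elim, rule Wr_plucker[OF W_a, symmetric])
qed

lemma Lim_Wr_right:
  assumes f: "(f, h) \<in> TM" and g: "(g, k) \<in> TM"
  shows "Lim (at_right_end b) (Wr a b p f g) = bvb f * bvdb g - bvdb f * bvb g"
proof (rule tendsto_Lim[OF at_right_end_neq_bot[OF ab]])
  have "((\<lambda>x. Wr a b p ubh f x * Wr a b p ub g x - Wr a b p ubh g x * Wr a b p ub f x) \<longlongrightarrow>
    bvdb f * (- bvb g) - bvdb g * (- bvb f)) (at_right_end b)"
    unfolding bv_b_def bvd_b_def minus_minus
    by (intro tendsto_intros T_max_green[OF ub_TM f] T_max_green[OF ub_TM g] T_max_green[OF ubh_TM f] T_max_green[OF ubh_TM g])
  moreover have "bvdb f * (- bvb g) - bvdb g * (- bvb f) = bvb f * bvdb g - bvdb f * bvb g" by simp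
  ultimately show "(Wr a b p f g \<longlongrightarrow> bvb f * bvdb g - bvdb f * bvb g) (at_right_end b)"
    by (simp only:) (rule Lim_transform_eventually, assumption,
        use eventually_I_right in eventually_elim, rule Wr_plucker[OF W_b, symmetric])
qed

text \<open>The boundary vectors of f and g at \<open>b\<close> are annihilated by the same nonzero
  linear form, as sine and cosine never vanish together. They are therefore proportional and their
  determinant is 0.\<close>

lemma Lim_Wr_right_bcb:
  assumes f: "(f, h) \<in> TM" "bcb f = 0" and g: "(g, k) \<in> TM" "bcb g = 0"
  shows "Lim (at_right_end b) (Wr a b p f g) = 0"
proof -
  let ?c = "complex_of_real (cos \<beta>)" and ?s = "complex_of_real (sin \<beta>)"
  have f': "bvb f * ?c = bvdb f * ?s" and g': "bvb g * ?c = bvdb g * ?s" using f g by (simp_all add: bcb_def)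
  have "(bvb f * bvdb g - bvdb f * bvb g) * ?c = (bvb f * ?c) * bvdb g - bvdb f * (bvb g * ?c)"
    by (simp add: algebra_simps del: of_real_mult)
  then have "(bvb f * bvdb g - bvdb f * bvb g) * ?c = 0" unfolding f' g' by simp
  moreover have "(bvb f * bvdb g - bvdb f * bvb g) * ?s = bvb f * (bvdb g * ?s) - (bvdb f * ?s) * bvb g"
    by (simp add: algebra_simps del: of_real_mult)
  then have "(bvb f * bvdb g - bvdb f * bvb g) * ?s = 0" unfolding f'[symmetric] g'[symmetric] by simp
  moreover have "?c \<noteq> 0 \<or> ?s \<noteq> 0" using sin_zero_abs_cos_one[of \<beta>] by auto
  ultimately show ?thesis using Lim_Wr_right[OF f(1) g(1)] by auto
qed

lemma green_bcb:
  assumes f: "(f, h) \<in> TM" "bcb f = 0" and g: "(g, k) \<in> TM" "bcb g = 0"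
  shows "set_lebesgue_integral lebesgue I (\<lambda>x. complex_of_real (r x) * (h x * g x - f x * k x))
     = bvda f * bva g - bva f * bvda g"
  using T_max_green(3)[OF f(1) g(1)] Lim_Wr_right_bcb[OF assms] Lim_Wr_left[OF f(1) g(1)] by simp

lemma Wr_swap: "Wr a b p f g x = - Wr a b p g f x"
  by (simp add: Wr_def)

lemma Lim_const_Wr:
  assumes "\<And>x. x \<in> I \<Longrightarrow> Wr a b p u v x = c" shows "Lim (at_left_end a) (Wr a b p u v) = c"
proof (rule tendsto_Lim[OF at_left_end_neq_bot[OF ab]])
  show "(Wr a b p u v \<longlongrightarrow> c) (at_left_end a)"
    by (rule tendsto_eventually) (use eventually_I_left in eventually_elim, simp add: assms)
qed

lemma bva_ua: "bva ua = 0" and bvda_ua: "bvda ua = 1" and bva_uah: "bva uah = 1" and bvda_uah: "bvda uah = 0"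
proof -
  have "Lim (at_left_end a) (Wr a b p ua ua) = 0" "Lim (at_left_end a) (Wr a b p uah uah) = 0"
    by (rule Lim_const_Wr, simp add: Wr_def)+
  moreover have "Lim (at_left_end a) (Wr a b p uah ua) = 1" by (rule Lim_const_Wr) (rule W_a)
  moreover have "Lim (at_left_end a) (Wr a b p ua uah) = -1"
    by (rule Lim_const_Wr) (use W_a Wr_swap[of ua uah] in simp)
  ultimately show "bva ua = 0" "bvda ua = 1" "bva uah = 1" "bvda uah = 0" by (simp_all add: bv_a_def bvd_a_def)
qed

text \<open>For this reason the quotient defining Q is a real number and taking its real part
  changes nothing.\<close>

lemma bcb_real: assumes "real_sol a b p q r u" shows "cnj (bcb u) = bcb u"
proof -
  have "cnj (Lim (at_right_end b) (Wr a b p v u)) = Lim (at_right_end b) (Wr a b p v u)" if v: "real_sol a b p q r v" for v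
    by (rule Lim_Wr_real[OF v assms T_max_green(2)[OF sol_TM[OF v] sol_TM[OF assms]] at_right_end_neq_bot[OF ab] eventually_I_right])
  then show ?thesis using ub ubh by (simp add: bcb_def bv_b_def bvd_b_def)
qed

end

section \<open>The principal solution\<close>

context SL_bc
begin

lemma has_vector_derivative_quotient:
  fixes f g :: "real \<Rightarrow> complex"
  assumes f: "(f has_vector_derivative f') (at x)" and g: "(g has_vector_derivative g') (at x)" and nz: "g x \<noteq> 0"
  shows "((\<lambda>x. f x * inverse (g x)) has_vector_derivative ((f' * g x - f x * g') / (g x)\<^sup>2)) (at x)"
proof -
  have "((\<lambda>x. inverse (g x)) has_derivative (\<lambda>h. - (inverse (g x) * (h *\<^sub>R g') * inverse (g x)))) (at x)"
    by (rule Deriv.has_derivative_inverse[OF nz g[unfolded has_vector_derivative_def]])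
  moreover have "(\<lambda>h. - (inverse (g x) * (h *\<^sub>R g') * inverse (g x))) = (\<lambda>h. h *\<^sub>R (- (inverse (g x) * g' * inverse (g x))))"
    by (auto simp: fun_eq_iff)
  ultimately have "((\<lambda>x. inverse (g x)) has_vector_derivative (- (inverse (g x) * g' * inverse (g x)))) (at x)"
    by (simp add: has_vector_derivative_def)
  from has_vector_derivative_mult[OF f this] 
  have "((\<lambda>x. f x * inverse (g x)) has_vector_derivative (f x * (- (inverse (g x) * g' * inverse (g x))) + f' * inverse (g x))) (at x)" .
  moreover have "f x * (- (inverse (g x) * g' * inverse (g x))) + f' * inverse (g x) = (f' * g x - f x * g') / (g x)\<^sup>2"
    using nz by (simp add: field_simps power2_eq_square)
  ultimately show ?thesis by simp
qed

text \<open>The integrand from the definition of a principal solution. It is also the factor by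
  which W(ua, g) must be multiplied to give the derivative of g / ua.\<close>

definition dens :: "real \<Rightarrow> real" where "dens x = 1 / (p x * (Re (ua x))\<^sup>2)"

lemma ua_Re: "x \<in> I \<Longrightarrow> ua x = complex_of_real (Re (ua x))"
  using real_sol_cnj(1)[OF ua_real] by (metis Reals_cnj_iff of_real_Re)

lemma ua_cont: "continuous_on I ua"
  using real_sol_sys[OF ua_real] AC_locI_continuous by (auto simp: sys_def)

lemma dens_integrable:
  assumes cd: "c \<in> I" "d \<in> I" and nz: "\<And>x. x \<in> {c..d} \<Longrightarrow> ua x \<noteq> 0"
  shows "set_integrable lebesgue {c..d} dens"
proof -
  have sub: "{c..d} \<subseteq> I" by (rule Ioo_e_interval[OF cd])
  have nzR: "Re (ua x) \<noteq> 0" if "x \<in> {c..d}" for x using nz[OF that] ua_Re[of x] sub that by force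
  have "continuous_on {c..d} (\<lambda>x. complex_of_real (1 / (Re (ua x))\<^sup>2))"
    using continuous_on_subset[OF ua_cont sub] nzR by (intro continuous_intros) auto
  from set_integrable_mult_continuous[OF p_int[OF cd] this]
  have "set_integrable lebesgue {c..d} (\<lambda>x. complex_of_real (dens x))" by (simp add: dens_def)
  then have "integrable lebesgue (\<lambda>x. complex_of_real (indicator {c..d} x *\<^sub>R dens x))"
    by (simp add: set_integrable_def scaleR_conv_of_real)
  then show ?thesis unfolding set_integrable_def using integrable_Re by fastforce
qed

lemma dens_nonneg: "AE x in lebesgue. x \<in> I \<longrightarrow> 0 \<le> dens x"
  using p_pos by eventually_elim (auto simp: dens_def)

text \<open>Monotone convergence turns divergence of the integral at \<open>a\<close> into
  unboundedness over compact intervals. The point \<open>c0\<close> is taken strictly below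
  \<open>c1\<close> to leave room for the descending flank of the trapezoid.\<close>

lemma principal_unbounded:
  obtains c0 c1 where "c0 \<in> I" "c1 \<in> I" "c0 < c1" "\<And>x. x \<in> I \<Longrightarrow> x \<le> c1 \<Longrightarrow> ua x \<noteq> 0"
    "\<And>M. \<exists>s\<in>I. s < c0 \<and> M < set_lebesgue_integral lebesgue {s..c0} dens"
proof -
  obtain c1 where c1: "c1 \<in> I" "\<And>x. x \<in> I \<Longrightarrow> x \<le> c1 \<Longrightarrow> ua x \<noteq> 0"
    and inf: "(\<integral>\<^sup>+ x. indicator {x \<in> I. x < c1} x * ennreal (dens x) \<partial>lebesgue) = \<infinity>"
    using ua unfolding principal_a_def dens_def by blast
  obtain c0 where c0: "c0 \<in> I" "c0 < c1" using Ioo_e_extend[OF c1(1)] by metis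
  have Pint: "set_integrable lebesgue {s..t} dens" if "s \<in> I" "t \<in> I" "t \<le> c1" for s t
    by (rule dens_integrable[OF that(1,2)]) (use c1(2) Ioo_e_interval[OF that(1,2)] that in auto)
  have IE: "I = einterval a b" by (simp add: Ioo_e_def einterval_def)
  obtain u l where ul: "einterval a b = (\<Union>i. {l i .. u i})" "incseq u" "decseq l" "\<And>i. l i < u i"
    "\<And>i. a < ereal (l i)" "\<And>i. ereal (u i) < b" "(\<lambda>i. ereal (l i)) \<longlonglongrightarrow> a" "(\<lambda>i. ereal (u i)) \<longlonglongrightarrow> b"
    by (rule einterval_Icc_approximation[OF ab], rule that)
  have lI: "l i \<in> I" for i unfolding IE ul(1) using ul(4)[of i] by force
  have "\<exists>s\<in>I. s < c0 \<and> M < set_lebesgue_integral lebesgue {s..c0} dens" for M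
  proof (rule ccontr)
    assume "\<not> ?thesis"
    then have bd: "set_lebesgue_integral lebesgue {s..c0} dens \<le> M" if "s \<in> I" "s < c0" for s using that by force
    \<comment> \<open>Boundedness of the integrals ending at \<open>c0\<close> extends to those
      ending at \<open>c1\<close>, since the integral over [c0, c1] is finite.\<close>
    define K where "K = \<bar>M\<bar> + set_lebesgue_integral lebesgue {c0..c1} dens"
    have nnP: "AE x in lebesgue. x \<in> {s..t} \<longrightarrow> 0 \<le> dens x" if "s \<in> I" "t \<in> I" for s t
      using dens_nonneg by eventually_elim (use Ioo_e_interval[OF that] in auto)
    have bd1: "set_lebesgue_integral lebesgue {s..c1} dens \<le> K" if s: "s \<in> I" for s
    proof (cases "s < c0")
      case True
      have "{s..c1} = {s..c0} \<union> {c0..c1}" using True c0 by auto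
      then have "set_lebesgue_integral lebesgue {s..c1} dens = set_lebesgue_integral lebesgue ({s..c0} \<union> {c0..c1}) dens" by (rule arg_cong)
      also have "\<dots> = set_lebesgue_integral lebesgue {s..c0} dens + set_lebesgue_integral lebesgue {c0..c1} dens"
      proof (rule set_integral_Un_AE)
        show "AE x in lebesgue. \<not> (x \<in> {s..c0} \<and> x \<in> {c0..c1})" using AE_neq_point[of c0] by eventually_elim auto
      qed (use Pint s c0 c1 in auto)
      finally show ?thesis using bd[OF s True] by (simp add: K_def)
    next
      case False
      have "set_lebesgue_integral lebesgue {s..c1} dens \<le> set_lebesgue_integral lebesgue {c0..c1} dens"
        using False by (intro set_integral_mono_set_real Pint c0 c1 nnP) auto
      then show ?thesis by (simp add: K_def)
    qed
    define F where "F i x = indicator {l i..c1} x * ennreal (dens x)" for i x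
    have Fm: "F i \<in> borel_measurable lebesgue" and Fi: "(\<integral>\<^sup>+ x. F i x \<partial>lebesgue) \<le> ennreal K" for i
    proof -
      have int: "integrable lebesgue (\<lambda>x. indicator {l i..c1} x *\<^sub>R dens x)"
        using Pint[OF lI c1(1), of i] by (simp add: set_integrable_def)
      have Feq: "F i = (\<lambda>x. ennreal (indicator {l i..c1} x *\<^sub>R dens x))"
        by (auto simp: F_def fun_eq_iff indicator_def)
      show "F i \<in> borel_measurable lebesgue" unfolding Feq using borel_measurable_integrable[OF int] by measurable
      have "(\<integral>\<^sup>+ x. F i x \<partial>lebesgue) = ennreal (\<integral>x. indicator {l i..c1} x *\<^sub>R dens x \<partial>lebesgue)"
        unfolding Feq
      proof (rule nn_integral_eq_integral[OF int])
        show "AE x in lebesgue. 0 \<le> indicator {l i..c1} x *\<^sub>R dens x"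
          using nnP[OF lI c1(1), of i] by eventually_elim (auto simp: indicator_def)
      qed
      also have "\<dots> \<le> ennreal K" using bd1[OF lI] unfolding set_lebesgue_integral_def by (rule ennreal_leI)
      finally show "(\<integral>\<^sup>+ x. F i x \<partial>lebesgue) \<le> ennreal K" .
    qed
    have "incseq F"
    proof (rule incseq_SucI, rule le_funI)
      fix i x
      have "l (Suc i) \<le> l i" using ul(3) by (simp add: decseq_SucD)
      then show "F i x \<le> F (Suc i) x" by (auto simp: F_def indicator_def)
    qed
    have "(\<integral>\<^sup>+ x. indicator {x \<in> I. x < c1} x * ennreal (dens x) \<partial>lebesgue) \<le> (\<integral>\<^sup>+ x. (SUP i. F i x) \<partial>lebesgue)"
    proof (rule nn_integral_mono)
      fix x
      show "indicator {x \<in> I. x < c1} x * ennreal (dens x) \<le> (SUP i. F i x)"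
      proof (cases "x \<in> I \<and> x < c1")
        case True
        then obtain i where "x \<in> {l i..u i}" unfolding IE ul(1) by blast
        with True have "indicator {x \<in> I. x < c1} x * ennreal (dens x) = F i x" by (simp add: F_def)
        also have "\<dots> \<le> (SUP i. F i x)" by (rule SUP_upper) simp
        finally show ?thesis .
      next
        case False
        then have "indicator {x \<in> I. x < c1} x * ennreal (dens x) = 0" by simp
        then show ?thesis by (simp only: zero_le)
      qed
    qed
    also have "\<dots> = (SUP i. \<integral>\<^sup>+ x. F i x \<partial>lebesgue)"
      by (rule nn_integral_monotone_convergence_SUP[OF \<open>incseq F\<close> Fm])
    also have "\<dots> \<le> ennreal K" by (rule SUP_least) (rule Fi)
    finally show False using inf by (simp add: top_unique)
  qed
  with c0 c1 show ?thesis by (intro that[of c0 c1]) auto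
qed

text \<open>The solution $\psi$ is outside the form domain of $T_{\pi,\beta'}$. The function $h$ is chosen such that
  $-W(u_a, f)$ is a trapezoid $\xi$ of height one; integrating by parts with $\psi/u_a$ and $f/u_a$ gives
  $\langle h, \psi\rangle = \int \xi/(p u_a^2)$ and $\langle h, f\rangle = \int \xi^2/(p u_a^2)$, and the first
  integral is unbounded because $u_a$ is principal.\<close>

lemma friedrichs:
  assumes psi: "(\<psi>, \<lambda>_. 0) \<in> TM" "\<And>x. x \<in> I \<Longrightarrow> Wr a b p ua \<psi> x = -1" and M: "0 \<le> M"
  obtains h where "LL h" "\<And>f. (f, h) \<in> TM \<Longrightarrow> bva f = 0 \<Longrightarrow> M * Re (ip h f) < (cmod (ip h \<psi>))\<^sup>2"
proof -
  obtain c0 c1 where c: "c0 \<in> I" "c1 \<in> I" "c0 < c1" and nz: "\<And>x. x \<in> I \<Longrightarrow> x \<le> c1 \<Longrightarrow> ua x \<noteq> 0"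
    and unb: "\<And>M. \<exists>s\<in>I. s < c0 \<and> M < set_lebesgue_integral lebesgue {s..c0} dens"
    by (rule principal_unbounded, rule that)
  \<comment> \<open>The plateau [s, c0] alone already contributes more than \<open>M\<close> to the
    first integral.\<close>
  obtain s where s: "s \<in> I" "s < c0" "M < set_lebesgue_integral lebesgue {s..c0} dens" using unb by blast
  obtain s' where s': "s' \<in> I" "s' < s" using Ioo_e_extend[OF s(1)] by metis
  define J where "J u v = set_lebesgue_integral lebesgue {u..v} r" for u v
  have rpos: "AE x in lebesgue. x \<in> {u..v} \<longrightarrow> 0 < r x" if "u \<in> I" "v \<in> I" for u v
    using r_pos by eventually_elim (use Ioo_e_interval[OF that] in auto)
  have Jnn: "0 \<le> J u v" if "u \<in> I" "v \<in> I" for u v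
    unfolding J_def by (rule set_integral_nonneg_AE_real) (use rpos[OF that] in eventually_elim, auto)
  have Jmono: "J u v \<le> J u w" if "u \<in> I" "w \<in> I" "v \<le> w" for u v w
    unfolding J_def
  proof (rule set_integral_mono_set_real[OF r_int[OF that(1,2)]])
    show "AE x in lebesgue. x \<in> {u..w} \<longrightarrow> 0 \<le> r x" using rpos[OF that(1,2)] by eventually_elim auto
  qed (use that in auto)
  \<comment> \<open>The flank masses with respect to \<open>r\<close> normalize the trapezoid: it
    climbs to 1 over [s', s] and returns to 0 over [c0, c1]. Both are positive because
    \<open>r\<close> is positive almost everywhere.\<close>
  define R1 where "R1 = J s' s" define R2 where "R2 = J c0 c1"
  have R: "0 < R1" "0 < R2"
    unfolding R1_def R2_def J_def by (intro set_integral_pos_interval r_int rpos s s' c)+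
  define \<rho> where "\<rho> x = indicator {s'..s} x * (1 / R1) - indicator {c0..c1} x * (1 / R2)" for x :: real
  \<comment> \<open>Division by \<open>ua\<close> makes the derivative of W(ua, f) equal to minus
    \<open>r\<close> times \<rho> for every f with image \<open>h\<close>, so this Wronskian is
    known without solving for f.\<close>
  define h where "h x = complex_of_real (\<rho> x) * inverse (ua x)" for x
  have sub: "{s'..c1} \<subseteq> I" by (rule Ioo_e_interval[OF s'(1) c(2)])
  have nz': "ua x \<noteq> 0" if "x \<in> {s'..c1}" for x using nz that sub by auto
  have \<rho>0: "\<rho> x = 0" if "x \<notin> {s'..c1}" for x using that s s' c by (auto simp: \<rho>_def indicator_def)
  have rh: "complex_of_real (r x) * (h x * ua x) = complex_of_real (r x * \<rho> x)" if "x \<in> I" for x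
    using \<rho>0[of x] nz'[of x] by (cases "x \<in> {s'..c1}") (auto simp: h_def)
  have rrho: "(\<lambda>x. r x * \<rho> x) = (\<lambda>x. indicator {s'..s} x * (r x / R1) - indicator {c0..c1} x * (r x / R2))"
    by (auto simp: fun_eq_iff \<rho>_def algebra_simps)
  have rint: "set_integrable lebesgue {u..v} (\<lambda>x. r x * \<rho> x)" 
    and rval: "set_lebesgue_integral lebesgue {u..v} (\<lambda>x. r x * \<rho> x) = J (max u s') (min v s) / R1 - J (max u c0) (min v c1) / R2"
    if "u \<in> I" "v \<in> I" for u v
  proof -
    have i: "set_integrable lebesgue ({u..v} \<inter> {y..z}) (\<lambda>x. r x / R)" for R y z
      by (rule set_integrable_divide, rule set_integrable_subset[OF r_int[OF that]]) auto
    then have j: "set_integrable lebesgue {u..v} (\<lambda>x. indicator {y..z} x * (r x / R))" for R y z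
      by (simp only: set_integral_indicator_mult)
    then show "set_integrable lebesgue {u..v} (\<lambda>x. r x * \<rho> x)" unfolding rrho by (intro set_integral_diff)
    show "set_lebesgue_integral lebesgue {u..v} (\<lambda>x. r x * \<rho> x) = J (max u s') (min v s) / R1 - J (max u c0) (min v c1) / R2"
      unfolding rrho by (subst set_integral_diff(2)[OF j j]) (simp add: set_integral_indicator_mult J_def)
  qed
  have hL: "LL h"
  proof -
    have ci: "continuous_on {s'..c1} (\<lambda>x. inverse (ua x))"
      using continuous_on_subset[OF ua_cont sub] nz' by (intro continuous_intros) auto
    then have mi: "(\<lambda>x. indicator {s'..c1} x *\<^sub>R inverse (ua x)) \<in> borel_measurable lebesgue"
      using borel_measurable_continuous_on_indicator[OF _ ci] by (intro measurable_completion) simp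
    have m\<rho>: "(\<lambda>x. complex_of_real (\<rho> x)) \<in> borel_measurable lebesgue"
    proof -
      have [measurable]: "\<rho> \<in> borel_measurable lebesgue" unfolding \<rho>_def[abs_def]
        by (intro borel_measurable_diff borel_measurable_times borel_measurable_indicator borel_measurable_const) auto
      show ?thesis by measurable
    qed
    have e1: "(\<lambda>x. indicator I x *\<^sub>R h x) = (\<lambda>x. complex_of_real (\<rho> x) * (indicator {s'..c1} x *\<^sub>R inverse (ua x)))"
      using \<rho>0 sub by (auto simp: fun_eq_iff h_def indicator_def)
    have meas: "(\<lambda>x. indicator I x *\<^sub>R h x) \<in> borel_measurable lebesgue"
      unfolding e1 by (rule borel_measurable_times[OF m\<rho> mi])
    have "bounded ((\<lambda>x. inverse (ua x)) ` {s'..c1})" by (intro compact_imp_bounded compact_continuous_image ci) auto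
    then obtain B where B: "\<And>x. x \<in> {s'..c1} \<Longrightarrow> cmod (inverse (ua x)) \<le> B" unfolding bounded_iff by blast
    define K where "K = (1 / R1 + 1 / R2) * B"
    have hK: "cmod (h x) \<le> K" if "x \<in> {s'..c1}" for x
    proof -
      have "\<bar>\<rho> x\<bar> \<le> 1 / R1 + 1 / R2" using R s s' c by (auto simp: \<rho>_def indicator_def)
      then show ?thesis unfolding h_def K_def norm_mult using B[OF that] R by (intro mult_mono) auto
    qed
    have "set_integrable lebesgue I (\<lambda>x. (cmod (h x))\<^sup>2 * r x)"
    proof -
      have "set_integrable lebesgue {s'..c1} (\<lambda>x. (cmod (h x))\<^sup>2 * r x)"
      proof (rule set_integrable_bound)
        show "set_integrable lebesgue {s'..c1} (\<lambda>x. K\<^sup>2 * r x)" using r_int[OF s'(1) c(2)] by simp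
        have "(\<lambda>x. indicator {s'..c1} x *\<^sub>R ((cmod (h x))\<^sup>2 * r x)) = (\<lambda>x. (cmod (indicator I x *\<^sub>R h x))\<^sup>2 * (indicator I x * r x))"
          using \<rho>0 sub by (auto simp: fun_eq_iff h_def indicator_def)
        moreover have "(\<lambda>x. (cmod (indicator I x *\<^sub>R h x))\<^sup>2 * (indicator I x * r x)) \<in> borel_measurable lebesgue"
          by (rule borel_measurable_times[OF borel_measurable_power[OF measurable_compose[OF meas borel_measurable_norm]] r_meas'])
        ultimately show "set_borel_measurable lebesgue {s'..c1} (\<lambda>x. (cmod (h x))\<^sup>2 * r x)"
          unfolding set_borel_measurable_def by (simp only:)
        have "(cmod (h x))\<^sup>2 * \<bar>r x\<bar> \<le> K\<^sup>2 * \<bar>r x\<bar>" if "x \<in> {s'..c1}" for x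
          using hK[OF that] by (intro mult_right_mono power_mono) auto
        then show "AE x in lebesgue. x \<in> {s'..c1} \<longrightarrow> norm ((cmod (h x))\<^sup>2 * r x) \<le> norm (K\<^sup>2 * r x)"
          by (intro AE_I2) (simp add: abs_mult)
      qed
      moreover have "(\<lambda>x. indicator {s'..c1} x *\<^sub>R ((cmod (h x))\<^sup>2 * r x)) = (\<lambda>x. indicator I x *\<^sub>R ((cmod (h x))\<^sup>2 * r x))"
        using \<rho>0 sub by (auto simp: fun_eq_iff h_def indicator_def)
      ultimately show ?thesis by (simp only: set_integrable_def)
    qed
    with meas show ?thesis by (simp add: L2_def set_borel_measurable_def)
  qed
  have ipg: "ip h g = cnj (set_lebesgue_integral lebesgue {s'..c1} (\<lambda>x. complex_of_real (r x * \<rho> x) * (g x * inverse (ua x))))" for g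
  proof -
    have "indicator I x *\<^sub>R (h x * cnj (g x) * complex_of_real (r x))
      = cnj (indicator {s'..c1} x *\<^sub>R (complex_of_real (r x * \<rho> x) * (g x * inverse (ua x))))" for x
    proof (cases "x \<in> {s'..c1}")
      case True
      then have "cnj (ua x) = ua x" using sub real_sol_cnj(1)[OF ua_real] by auto
      with True sub show ?thesis by (auto simp: h_def)
    next
      case False
      then show ?thesis using \<rho>0 by (simp add: h_def)
    qed
    then show ?thesis unfolding inner_L2_def set_lebesgue_integral_def by (simp only: Bochner_Integration.integral_cnj)
  qed
  have Pi: "set_integrable lebesgue {s'..c1} dens" by (rule dens_integrable[OF s'(1) c(2) nz'])
  \<comment> \<open>Boundary terms vanish because \<xi> is 0 at both ends. The function g is kept
    general: it will be \<psi>, whose Wronskian with \<open>ua\<close> is -1, and f, whose Wronskian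
    is -\<xi>.\<close>
  have byparts: "set_lebesgue_integral lebesgue {s'..c1} (\<lambda>x. complex_of_real (r x * \<rho> x) * (g x * inverse (ua x)))
      = - set_lebesgue_integral lebesgue {s'..c1} (\<lambda>x. complex_of_real (dens x) * (complex_of_real (\<xi> x) * Wr a b p ua g x))"
    if g: "(g, k) \<in> TM" and f: "(f, h) \<in> TM" and W: "\<And>x. x \<in> {s'..c1} \<Longrightarrow> Wr a b p ua f x = - complex_of_real (\<xi> x)"
      and W0: "\<xi> s' = 0" "\<xi> c1 = 0" for f g k \<xi>
  proof -
    have sg: "sys g (Q1 g) k" and sf: "sys f (Q1 f) h" and su: "sys ua (Q1 ua) (\<lambda>_. 0)"
      using g f ua_TM by (auto simp: T_max_iff)
    have acW: "abs_cont_on s' c1 (Wr a b p ua v)" if "sys v (Q1 v) m" for v m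
      unfolding Wr_def using su that sub by (intro abs_cont_on_diff abs_cont_on_mult) (auto simp: sys_def AC_loc_def)
    have acu: "abs_cont_on s' c1 (\<lambda>x. inverse (ua x))"
      using su sub nz' by (intro abs_cont_on_inverse) (auto simp: sys_def AC_loc_def)
    have acg: "abs_cont_on s' c1 (\<lambda>x. g x * inverse (ua x))"
      using sg sub by (intro abs_cont_on_mult acu) (auto simp: sys_def AC_loc_def)
    let ?A = "\<lambda>x. complex_of_real (r x * \<rho> x) * (g x * inverse (ua x))"
    let ?B = "\<lambda>x. complex_of_real (dens x) * (Wr a b p ua f x * Wr a b p ua g x)"
    have iA: "set_integrable lebesgue {s'..c1} ?A"
      by (rule set_integrable_mult_continuous[OF rint[OF s'(1) c(2)] abs_cont_on_continuous[OF acg]])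
    have iB: "set_integrable lebesgue {s'..c1} ?B"
      by (rule set_integrable_mult_continuous[OF Pi abs_cont_on_continuous[OF abs_cont_on_mult[OF acW[OF sf] acW[OF sg]]]])
    have der: "AE x in lebesgue. x \<in> {s'..c1} \<longrightarrow>
        ((\<lambda>x. Wr a b p ua f x * (g x * inverse (ua x))) has_vector_derivative (?B x - ?A x)) (at x)"
      using sg[unfolded sys_def, THEN conjunct2, THEN conjunct2] sf[unfolded sys_def, THEN conjunct2, THEN conjunct2]
        su[unfolded sys_def, THEN conjunct2, THEN conjunct2] p_pos
    proof eventually_elim
      case (elim x)
      show ?case
      proof
        assume xs: "x \<in> {s'..c1}"
        then have x: "x \<in> I" using sub by auto
        note nzx = nz'[OF xs]
        have dW: "(Wr a b p ua f has_vector_derivative (- complex_of_real (r x * \<rho> x))) (at x)"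
        proof -
          have "((\<lambda>x. ua x * Q1 f x - Q1 ua x * f x) has_vector_derivative
            ((ua x * (complex_of_real (q x) * f x - complex_of_real (r x) * h x) + (Q1 ua x / complex_of_real (p x)) * Q1 f x)
            - (Q1 ua x * (Q1 f x / complex_of_real (p x)) + (complex_of_real (q x) * ua x - complex_of_real (r x) * 0) * f x))) (at x)"
            using elim x by (intro has_vector_derivative_diff has_vector_derivative_mult) auto
          moreover have "(ua x * (complex_of_real (q x) * f x - complex_of_real (r x) * h x) + (Q1 ua x / complex_of_real (p x)) * Q1 f x)
            - (Q1 ua x * (Q1 f x / complex_of_real (p x)) + (complex_of_real (q x) * ua x - complex_of_real (r x) * 0) * f x)
            = - (complex_of_real (r x) * (h x * ua x))" by (simp add: algebra_simps)
          ultimately show ?thesis using rh[OF x] by (simp add: Wr_def[abs_def])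
        qed
        have dq: "((\<lambda>x. g x * inverse (ua x)) has_vector_derivative
          ((Q1 g x / complex_of_real (p x)) * ua x - g x * (Q1 ua x / complex_of_real (p x))) / (ua x)\<^sup>2) (at x)"
          using elim x nzx by (intro has_vector_derivative_quotient) auto
        have "((Q1 g x / complex_of_real (p x)) * ua x - g x * (Q1 ua x / complex_of_real (p x))) / (ua x)\<^sup>2
          = complex_of_real (dens x) * Wr a b p ua g x"
        proof -
          have Px: "complex_of_real (dens x) = 1 / (complex_of_real (p x) * (ua x)\<^sup>2)"
            by (subst ua_Re[OF x]) (simp add: dens_def)
          have "complex_of_real (p x) \<noteq> 0" using elim x by simp
          then show ?thesis unfolding Px Wr_def using nzx by (simp add: field_simps)
        qed
        with dq have "((\<lambda>x. g x * inverse (ua x)) has_vector_derivative (complex_of_real (dens x) * Wr a b p ua g x)) (at x)" by simp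
        from has_vector_derivative_mult[OF dW this]
        show "((\<lambda>x. Wr a b p ua f x * (g x * inverse (ua x))) has_vector_derivative (?B x - ?A x)) (at x)"
          by (simp add: algebra_simps)
      qed
    qed
    have "set_lebesgue_integral lebesgue {s'..c1} (\<lambda>x. ?B x - ?A x)
      = Wr a b p ua f c1 * (g c1 * inverse (ua c1)) - Wr a b p ua f s' * (g s' * inverse (ua s'))"
      using s s' c by (intro abs_cont_on_FTC[OF abs_cont_on_mult[OF acW[OF sf] acg] _ der] set_integral_diff iA iB) auto
    also have "\<dots> = 0" using W[of c1] W[of s'] W0 s s' c by simp
    finally have "set_lebesgue_integral lebesgue {s'..c1} ?A = set_lebesgue_integral lebesgue {s'..c1} ?B"
      by (simp only: set_integral_diff(2)[OF iB iA]) simp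
    also have "\<dots> = set_lebesgue_integral lebesgue {s'..c1} (\<lambda>x. - (complex_of_real (dens x) * (complex_of_real (\<xi> x) * Wr a b p ua g x)))"
      by (rule set_lebesgue_integral_cong) (auto simp: W)
    also have "\<dots> = - set_lebesgue_integral lebesgue {s'..c1} (\<lambda>x. complex_of_real (dens x) * (complex_of_real (\<xi> x) * Wr a b p ua g x))"
      unfolding set_lebesgue_integral_def by simp
    finally show ?thesis .
  qed
  have main: "M * Re (ip h f) < (cmod (ip h \<psi>))\<^sup>2" if f: "(f, h) \<in> TM" "bva f = 0" for f
  proof -
    define \<xi> where "\<xi> x = J s' (min x s) / R1 - J c0 (min x c1) / R2" for x
    have Wdiff: "Wr a b p ua f d - Wr a b p ua f x = - complex_of_real (J (max x s') (min d s) / R1 - J (max x c0) (min d c1) / R2)"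
      if "x \<in> I" "d \<in> I" "x \<le> d" for x d
    proof -
      have "Wr a b p ua f d - Wr a b p ua f x = set_lebesgue_integral lebesgue {x..d} (\<lambda>x. complex_of_real (r x) * (0 * f x - ua x * h x))"
        by (rule T_max_wronskian[OF ua_TM f(1) that, symmetric])
      also have "\<dots> = set_lebesgue_integral lebesgue {x..d} (\<lambda>x. - complex_of_real (r x * \<rho> x))"
      proof (rule set_lebesgue_integral_cong)
        show "\<forall>y. y \<in> {x..d} \<longrightarrow> complex_of_real (r y) * (0 * f y - ua y * h y) = - complex_of_real (r y * \<rho> y)"
        proof (intro allI impI)
          fix y assume "y \<in> {x..d}"
          then have "y \<in> I" using Ioo_e_interval[OF that(1,2)] by auto
          from rh[OF this] show "complex_of_real (r y) * (0 * f y - ua y * h y) = - complex_of_real (r y * \<rho> y)"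
            by (simp add: mult.commute)
        qed
      qed simp
      also have "\<dots> = - complex_of_real (set_lebesgue_integral lebesgue {x..d} (\<lambda>x. r x * \<rho> x))"
        by (subst set_integral_complex_of_real[symmetric]) (simp add: set_lebesgue_integral_def)
      finally show ?thesis using rval[OF that(1,2)] by simp
    qed
    have J0: "J u v = 0" if "v \<le> u" for u v
    proof -
      have "AE x in lebesgue. indicator {u..v} x *\<^sub>R r x = 0"
        using AE_neq_point[of u] by eventually_elim (use that in \<open>auto simp: indicator_def\<close>)
      then show ?thesis unfolding J_def set_lebesgue_integral_def by (rule integral_eq_zero_AE)
    qed
    \<comment> \<open>To the left of \<open>s'\<close> the function \<open>h\<close> vanishes, so
      the Wronskian is constant there and equals its limit at \<open>a\<close>, which is 0 by the
      boundary condition.\<close>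
    have Ws': "Wr a b p ua f s' = 0"
    proof -
      have "\<forall>\<^sub>F x in at_left_end a. Wr a b p ua f x = Wr a b p ua f s'"
        using eventually_at_left_end[OF s'(1)]
      proof eventually_elim
        case (elim x)
        have "Wr a b p ua f s' - Wr a b p ua f x = 0"
          using Wdiff[of x s'] elim s s' c J0 by (simp add: min_def max_def)
        then show ?case by simp
      qed
      then have "(Wr a b p ua f \<longlongrightarrow> Wr a b p ua f s') (at_left_end a)" by (rule tendsto_eventually)
      from tendsto_Lim[OF at_left_end_neq_bot[OF ab] this] f(2) show ?thesis by (simp add: bv_a_def)
    qed
    have W: "Wr a b p ua f x = - complex_of_real (\<xi> x)" if x: "x \<in> {s'..c1}" for x
    proof -
      have "x \<in> I" using x sub by auto
      from Wdiff[OF s'(1) this] x Ws' s s' c show ?thesis by (simp add: \<xi>_def max_def)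
    qed
    have \<xi>0: "\<xi> s' = 0" "\<xi> c1 = 0" using s s' c R J0 by (auto simp: \<xi>_def min_def R1_def R2_def)
    have \<xi>1: "\<xi> x = 1" if "x \<in> {s..c0}" for x using that s s' c R J0 by (auto simp: \<xi>_def min_def R1_def R2_def)
    have \<xi>b: "0 \<le> \<xi> x \<and> \<xi> x \<le> 1" if x: "x \<in> {s'..c1}" for x
    proof -
      have xI: "x \<in> I" using x sub by auto
      have J1: "0 \<le> J s' (min x s)" "J s' (min x s) \<le> R1" and J2: "0 \<le> J c0 (min x c1)" "J c0 (min x c1) \<le> R2"
        unfolding R1_def R2_def using xI s s' c by (auto intro!: Jnn Jmono simp: min_def)
      then have b: "0 \<le> J s' (min x s) / R1" "J s' (min x s) / R1 \<le> 1" "0 \<le> J c0 (min x c1) / R2" "J c0 (min x c1) / R2 \<le> 1"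
        using R by auto
      show ?thesis
      proof (cases "x \<le> c0")
        case True
        then have "J c0 (min x c1) = 0" by (intro J0) simp
        with b show ?thesis by (simp add: \<xi>_def)
      next
        case False
        then have "J s' (min x s) / R1 = 1" using s R by (simp add: min_def R1_def)
        with b show ?thesis by (simp add: \<xi>_def)
      qed
    qed
    have \<xi>meas: "set_integrable lebesgue {s'..c1} (\<lambda>x. dens x * \<xi> x)" "set_integrable lebesgue {s'..c1} (\<lambda>x. dens x * (\<xi> x)\<^sup>2)"
    proof -
      have sf: "sys f (Q1 f) h" and su: "sys ua (Q1 ua) (\<lambda>_. 0)" using f ua_TM by (auto simp: T_max_iff)
      have "abs_cont_on s' c1 (Wr a b p ua f)"
        unfolding Wr_def using su sf sub by (intro abs_cont_on_diff abs_cont_on_mult) (auto simp: sys_def AC_loc_def)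
      then have cW: "continuous_on {s'..c1} (Wr a b p ua f)" by (rule abs_cont_on_continuous)
      have c1: "continuous_on {s'..c1} (\<lambda>x. complex_of_real (\<xi> x))"
        by (rule continuous_on_eq[OF continuous_on_minus[OF cW]]) (simp add: W)
      then have c2: "continuous_on {s'..c1} (\<lambda>x. complex_of_real ((\<xi> x)\<^sup>2))" by (simp add: continuous_intros)
      have re: "set_integrable lebesgue {s'..c1} g" if "set_integrable lebesgue {s'..c1} (\<lambda>x. complex_of_real (g x))" for g
        using that integrable_Re unfolding set_integrable_def by fastforce
      show "set_integrable lebesgue {s'..c1} (\<lambda>x. dens x * \<xi> x)" "set_integrable lebesgue {s'..c1} (\<lambda>x. dens x * (\<xi> x)\<^sup>2)"
        using set_integrable_mult_continuous[OF Pi c1] set_integrable_mult_continuous[OF Pi c2]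
        by (auto intro!: re)
    qed
    define m where "m = set_lebesgue_integral lebesgue {s'..c1} (\<lambda>x. dens x * \<xi> x)"
    define n where "n = set_lebesgue_integral lebesgue {s'..c1} (\<lambda>x. dens x * (\<xi> x)\<^sup>2)"
    have Pnn: "AE x in lebesgue. x \<in> {s'..c1} \<longrightarrow> 0 \<le> dens x" using dens_nonneg by eventually_elim (use sub in auto)
    have "set_lebesgue_integral lebesgue {s'..c1} (\<lambda>x. complex_of_real (dens x) * (complex_of_real (\<xi> x) * Wr a b p ua \<psi> x))
      = set_lebesgue_integral lebesgue {s'..c1} (\<lambda>x. - complex_of_real (dens x * \<xi> x))"
      by (rule set_lebesgue_integral_cong) (use psi(2) sub in auto)
    also have "\<dots> = - complex_of_real m"
      unfolding m_def by (subst set_integral_complex_of_real[symmetric]) (simp add: set_lebesgue_integral_def)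
    finally have ipm: "ip h \<psi> = complex_of_real m"
      by (simp only: ipg byparts[OF psi(1) f(1) W \<xi>0]) simp
    have "set_lebesgue_integral lebesgue {s'..c1} (\<lambda>x. complex_of_real (dens x) * (complex_of_real (\<xi> x) * Wr a b p ua f x))
      = set_lebesgue_integral lebesgue {s'..c1} (\<lambda>x. - complex_of_real (dens x * (\<xi> x)\<^sup>2))"
      by (rule set_lebesgue_integral_cong) (auto simp: W power2_eq_square)
    also have "\<dots> = - complex_of_real n"
      unfolding n_def by (subst set_integral_complex_of_real[symmetric]) (simp add: set_lebesgue_integral_def)
    finally have ipn: "ip h f = complex_of_real n"
      by (simp only: ipg byparts[OF f(1) f(1) W \<xi>0]) simp
    \<comment> \<open>The trapezoid takes values in [0, 1], so its square lies below it.\<close>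
    have "n \<le> m" unfolding n_def m_def
    proof (rule set_integral_mono_AE[OF \<xi>meas(2,1)])
      show "AE x\<in>{s'..c1} in lebesgue. dens x * (\<xi> x)\<^sup>2 \<le> dens x * \<xi> x"
        using Pnn
      proof eventually_elim
        case (elim x)
        show ?case
        proof
          assume "x \<in> {s'..c1}"
          with elim \<xi>b[of x] show "dens x * (\<xi> x)\<^sup>2 \<le> dens x * \<xi> x"
            by (intro mult_left_mono) (auto simp: power2_eq_square mult_left_le)
        qed
      qed
    qed
    moreover have "M < m"
    proof -
      have "set_lebesgue_integral lebesgue {s..c0} dens = set_lebesgue_integral lebesgue {s..c0} (\<lambda>x. dens x * \<xi> x)"
        by (rule set_lebesgue_integral_cong) (auto simp: \<xi>1)
      also have "\<dots> \<le> m" unfolding m_def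
      proof (rule set_integral_mono_set_real[OF \<xi>meas(1)])
        show "AE x in lebesgue. x \<in> {s'..c1} \<longrightarrow> 0 \<le> dens x * \<xi> x"
          using Pnn by eventually_elim (use \<xi>b in auto)
      qed (use s s' c in auto)
      finally show ?thesis using s(3) by simp
    qed
    \<comment> \<open>The pairings of \<open>h\<close> with \<psi> and with f are m and n, so M n <=
      M m < m^2 is the claim.\<close>
    ultimately have "M * n \<le> M * m" "M * m < m * m" using M by (auto intro: mult_left_mono)
    then show ?thesis by (simp add: ipm ipn power2_eq_square)
  qed
  show ?thesis by (rule that[OF hL]) (rule main)
qed

end

section \<open>Nonnegative extensions\<close>

lemma arctan_cot: assumes "0 < \<alpha>" "\<alpha> < pi" shows "arctan (cos \<alpha> / sin \<alpha>) = pi / 2 - \<alpha>"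
proof -
  have "cos \<alpha> / sin \<alpha> = tan (pi / 2 - \<alpha>)" by (simp add: tan_def sin_diff cos_diff)
  then show ?thesis using assms by (simp add: arctan_tan)
qed

lemma cot_arccot: "0 < arccot x" "arccot x < pi" "cos (arccot x) / sin (arccot x) = x"
proof -
  show b: "0 < arccot x" "arccot x < pi"
    using arctan_bounded[of x] by (auto simp: arccot_def)
  have "arctan (cos (arccot x) / sin (arccot x)) = arctan x"
    unfolding arctan_cot[OF b] by (simp add: arccot_def)
  then show "cos (arccot x) / sin (arccot x) = x" by (simp only: arctan_eq_iff)
qed

lemma arccot_le_iff: assumes "0 < \<alpha>" "\<alpha> < pi" shows "arccot x \<le> \<alpha> \<longleftrightarrow> cos \<alpha> / sin \<alpha> \<le> x"
proof -
  have "arccot x \<le> \<alpha> \<longleftrightarrow> arctan (cos \<alpha> / sin \<alpha>) \<le> arctan x"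
    unfolding arctan_cot[OF assms] by (auto simp: arccot_def)
  then show ?thesis by (simp only: arctan_le_iff)
qed

section \<open>Consequences of the form criterion for coercivity and representatives\<close>

context weighted_L2
begin

text \<open>For the value y of the root at f, symmetry gives |y|^2 as the pairing of f with its
  image. On the operator domain the form thus has its expected value.\<close>

lemma form_bound_self:
  assumes G: "nonneg_sa a b r G" and fh: "(f, h) \<in> G"
  shows "form_bound G f (Re (ip h f))"
proof -
  define S where "S = sqrt_op a b r G"
  have GL: "G \<subseteq> L2_pairs a b r" and nn: "nonneg_op a b r G"
    using G by (auto simp: nonneg_sa_def self_adjoint_op_def single_valued_op_def)
  have L: "LL f" "LL h" using L2_pairsD[OF GL fh] by auto
  have spec: "sqrt_spec G S" unfolding S_def by (rule sqrt_op_properties(1)[OF G])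
  then have "S = adjoint a b r S" by (simp add: sqrt_spec_def)
  then interpret S: closed_sa a b r S by unfold_locales
  have "(f, h) \<in> sat a b r (S O S)" using spec subset_sat[OF GL] fh by (auto simp: sqrt_spec_def)
  then obtain f0 y h0 where 0: "(f0, y) \<in> S" "(y, h0) \<in> S" "eqv f f0" "eqv h h0" unfolding sat_iff by blast
  note L0 = S.H_L2[OF 0(1)] S.H_L2[OF 0(2)]
  have fy: "(f, y) \<in> S" by (rule S.H_eqv[OF 0(1) L(1) L0(2) eqv_sym[OF 0(3)] eqv_refl])
  have "ip y y = ip f0 h0" by (rule S.H_sym[OF 0(1,2)])
  also have "\<dots> = ip f h" using L L0 by (intro ip_cong eqv_sym[OF 0(3)] eqv_sym[OF 0(4)])
  also have "\<dots> = cnj (ip h f)" using L by (rule ip_commute[rotated])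
  finally have "(norm_L2 a b r y)\<^sup>2 = Re (ip h f)"
    using ip_self_nonneg[OF L0(2)] by (simp add: norm_L2_def)
  moreover have "0 \<le> Re (ip h f)" using nn fh by (auto simp: nonneg_op_def)
  ultimately show ?thesis using sqrt_op_properties(2)[OF G L(1), of "Re (ip h f)"] fy unfolding S_def by auto
qed

text \<open>Testing the criterion with f itself gives e^2 |f|^4 <= M e |f|^2. Combined with the form
  value on the operator domain, this converts the hypothesis on the order into an ordinary
  coercivity inequality.\<close>

lemma form_bound_eps:
  assumes e: "0 < e" and f: "LL f" and M: "0 \<le> M" and fb: "form_bound (eps_op a b r e) f M"
  shows "e * Re (ip f f) \<le> M"
proof -
  define t where "t = Re (ip f f)"
  have "(f, \<lambda>x. complex_of_real e * f x) \<in> eps_op a b r e" using f by (auto simp: eps_op_def)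
  with fb have "(cmod (ip f (\<lambda>x. complex_of_real e * f x)))\<^sup>2 \<le> M * Re (ip (\<lambda>x. complex_of_real e * f x) f)"
    by (auto simp: form_bound_def)
  then have "(cmod (complex_of_real e * ip f f))\<^sup>2 \<le> M * (e * Re (ip f f))"
    using f by (simp add: ip_cmult_left ip_cmult_right)
  moreover have "cmod (complex_of_real e * ip f f) = \<bar>e * t\<bar>"
    unfolding norm_mult by (subst ip_self[OF f]) (simp add: t_def abs_mult)
  ultimately have "(e * t) * (e * t) \<le> M * (e * t)" by (simp add: t_def power2_eq_square)
  moreover have "0 \<le> t" unfolding t_def by (rule ip_self_nonneg[OF f])
  ultimately have "e * t \<le> M" using e M by (cases "t = 0") (auto simp: mult_le_cancel_right)
  then show ?thesis by (simp add: t_def)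
qed

lemma nonneg_sa_sat_cong:
  assumes G: "nonneg_sa a b r G" and S: "S \<subseteq> L2_pairs a b r" and eq: "sat a b r S = sat a b r G"
  shows "nonneg_sa a b r S"
proof -
  have GL: "G \<subseteq> L2_pairs a b r" and sv: "single_valued_op a b r G" and nn: "nonneg_op a b r G" and sa: "sat a b r G = adjoint a b r G"
    using G by (auto simp: nonneg_sa_def self_adjoint_op_def single_valued_op_def)
  have rep: "\<exists>f' g'. (f', g') \<in> G \<and> eqv f f' \<and> eqv g g'" if "(f, g) \<in> S" for f g
  proof -
    have "(f, g) \<in> sat a b r G" using subset_sat[OF S] that eq by blast
    then show ?thesis unfolding sat_iff by blast
  qed
  have "sat a b r S = adjoint a b r S"
    using eq sa adjoint_sat[OF S] adjoint_sat[OF GL] by simp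
  moreover have "single_valued_op a b r S" unfolding single_valued_op_def
  proof (intro conjI S, clarify)
    fix f1 g1 f2 g2 assume 1: "(f1, g1) \<in> S" and 2: "(f2, g2) \<in> S" and e: "eqv f1 f2"
    obtain f1' g1' where u1: "(f1', g1') \<in> G" "eqv f1 f1'" "eqv g1 g1'" using rep[OF 1] by blast
    obtain f2' g2' where u2: "(f2', g2') \<in> G" "eqv f2 f2'" "eqv g2 g2'" using rep[OF 2] by blast
    have "eqv f1' f2'" using eqv_trans[OF eqv_sym[OF u1(2)] eqv_trans[OF e u2(2)]] .
    then have "eqv g1' g2'" using sv u1(1) u2(1) by (fastforce simp: single_valued_op_def)
    then show "eqv g1 g2" using eqv_trans[OF u1(3) eqv_trans[OF _ eqv_sym[OF u2(3)]]] by blast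
  qed
  moreover have "nonneg_op a b r S" unfolding nonneg_op_def
  proof clarify
    fix f g assume fg: "(f, g) \<in> S"
    obtain f' g' where *: "(f', g') \<in> G" "eqv f f'" "eqv g g'" using rep[OF fg] by blast
    have "ip g f = ip g' f'" using L2_pairsD[OF S fg] L2_pairsD[OF GL *(1)] * by (intro ip_cong) auto
    then show "ip g f \<in> \<real> \<and> 0 \<le> Re (ip g f)" using nn *(1) by (auto simp: nonneg_op_def)
  qed
  ultimately show ?thesis by (simp add: nonneg_sa_def self_adjoint_op_def)
qed

end

context SL
begin

text \<open>A difference that is 0 almost everywhere is 0 everywhere by continuity, hence so is its
  quasi-derivative. The second equation then leaves \<open>r\<close> times the difference of the
  images equal to 0, and \<open>r\<close> is positive almost everywhere.\<close>

lemma T_max_single_valued: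
  assumes f: "(f, h) \<in> T_max a b p q r" and g: "(g, k) \<in> T_max a b p q r" and e: "eqv f g"
  shows "eqv h k"
proof -
  have d: "((\<lambda>x. 1 * f x + (-1) * g x), (\<lambda>x. 1 * h x + (-1) * k x)) \<in> T_max a b p q r" (is "(?d, ?m) \<in> _")
    by (rule T_max_lincomb[OF f g])
  then have sd: "sys ?d (Q1 ?d) ?m" by (simp add: T_max_iff)
  have d0: "?d x = 0" if x: "x \<in> I" for x
  proof (rule continuous_AE_eq_on_open[OF open_Ioo_e _ _ _ x])
    show "continuous_on I ?d" using sd AC_locI_continuous by (auto simp: sys_def)
    show "AE x in lebesgue. x \<in> I \<longrightarrow> ?d x = 0" using e unfolding ae_eq_def by eventually_elim auto
  qed simp
  have s0: "sys (\<lambda>_. 0) (\<lambda>_. 0) (\<lambda>_. 0)" using sys_lincomb[OF sd sd, of 0 0] by simp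
  have q0: "Q1 ?d x = 0" if x: "x \<in> I" for x
  proof -
    have "sys (\<lambda>_. 0) (Q1 ?d) ?m" by (rule sys_cong[OF sd d0]) auto
    from qd_eq[OF this x] qd_eq[OF s0 x] show ?thesis by simp
  qed
  show ?thesis unfolding ae_eq_def
    using sd[unfolded sys_def, THEN conjunct2, THEN conjunct2] r_pos
  proof eventually_elim
    case (elim x)
    show ?case
    proof
      assume x: "x \<in> I"
      have "((\<lambda>_. 0) has_vector_derivative (complex_of_real (q x) * ?d x - complex_of_real (r x) * ?m x)) (at x)"
        by (rule has_vector_derivative_cong_I[OF q0 x]) (use elim x in auto)
      moreover have "((\<lambda>_. 0) has_vector_derivative (0::complex)) (at x)" by simp
      ultimately have "complex_of_real (q x) * ?d x - complex_of_real (r x) * ?m x = 0"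
        by (rule vector_derivative_unique_at)
      then show "h x = k x" using d0[OF x] elim x by simp
    qed
  qed
qed

end

section \<open>The coercive reference operator with \<alpha> = pi\<close>

locale SL_pos = SL_bc +
  fixes \<epsilon> :: real
  assumes eps: "0 < \<epsilon>"
    and pos: "op_le a b r (eps_op a b r \<epsilon>) (T_ab a b p q r ua uah ub ubh pi \<beta>)"
begin

abbreviation "TT \<alpha> \<equiv> T_ab a b p q r ua uah ub ubh \<alpha> \<beta>"
abbreviation "Tmin \<equiv> T_min_b a b p q r ua uah ub ubh \<beta>"

lemma TT_iff: "(g, h) \<in> TT \<alpha> \<longleftrightarrow> (g, h) \<in> TM \<and> bcb g = 0 \<and>
    bva g * complex_of_real (cos \<alpha>) + bvda g * complex_of_real (sin \<alpha>) = 0"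
  by (auto simp: T_ab_def bcb_def)

lemma Tmin_iff: "(g, h) \<in> Tmin \<longleftrightarrow> (g, h) \<in> TM \<and> bcb g = 0 \<and> bva g = 0 \<and> bvda g = 0"
  by (auto simp: T_min_b_def bcb_def)

lemma Tpi_iff: "(g, h) \<in> TT pi \<longleftrightarrow> (g, h) \<in> TM \<and> bcb g = 0 \<and> bva g = 0"
  by (auto simp: TT_iff)

lemma TT_L2: "TT \<alpha> \<subseteq> L2_pairs a b r"
  using T_max_L2 by (auto simp: TT_iff L2_pairs_def)

lemma Tmin_L2: "Tmin \<subseteq> L2_pairs a b r"
  using T_max_L2 by (auto simp: Tmin_iff L2_pairs_def)

lemma TM_lincomb_eq:
  assumes "(f, h) \<in> TM" "(g, \<lambda>_. 0) \<in> TM"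
  shows "((\<lambda>x. f x + c * g x), h) \<in> TM"
  using T_max_lincomb[OF assms, of 1 c] by simp

lemma Tpi_lincomb:
  assumes "(f, h) \<in> TT pi" "(g, k) \<in> TT pi"
  shows "((\<lambda>x. c * f x + d * g x), (\<lambda>x. c * h x + d * k x)) \<in> TT pi"
proof -
  have f: "(f, h) \<in> TM" "bcb f = 0" "bva f = 0" and g: "(g, k) \<in> TM" "bcb g = 0" "bva g = 0"
    using assms by (auto simp: Tpi_iff)
  have "bcb (\<lambda>x. c * f x + d * g x) = 0" "bva (\<lambda>x. c * f x + d * g x) = 0"
    using bcb_lincomb[OF f(1) g(1)] bva_lincomb[OF f(1) g(1)] f g by simp_all
  with T_max_lincomb[OF f(1) g(1)] show ?thesis unfolding Tpi_iff by blast
qed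

lemma Tpi_cong: "(f, h) \<in> TT pi \<Longrightarrow> eqv h k \<Longrightarrow> LL k \<Longrightarrow> (f, k) \<in> TT pi"
  unfolding Tpi_iff using T_max_cong[of f h f k] T_max_L2[of f h] by auto

lemma Tpi_sa: "nonneg_sa a b r (TT pi)"
  using pos by (simp add: op_le_def)

lemma Tpi_LL: "(f, h) \<in> TT pi \<Longrightarrow> LL f" "(f, h) \<in> TT pi \<Longrightarrow> LL h"
  using T_max_L2 by (auto simp: Tpi_iff)

lemma Tpi_nonneg: "(f, h) \<in> TT pi \<Longrightarrow> 0 \<le> Re (ip h f)" "(f, h) \<in> TT pi \<Longrightarrow> ip h f \<in> \<real>"
  using Tpi_sa by (auto simp: nonneg_sa_def nonneg_op_def)

lemma Tpi_sym: assumes "(f, h) \<in> TT pi" "(f', h') \<in> TT pi" shows "ip h f' = ip f h'"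
proof -
  have "(f', h') \<in> adjoint a b r (TT pi)"
    using subset_sat[OF TT_L2] assms(2) Tpi_sa by (auto simp: nonneg_sa_def self_adjoint_op_def)
  with assms(1) show ?thesis by (auto simp: adjoint_iff)
qed

lemma Tpi_coercive: assumes fh: "(f, h) \<in> TT pi" shows "\<epsilon> * Re (ip f f) \<le> Re (ip h f)"
proof -
  have "form_bound (TT pi) f (Re (ip h f))" by (rule form_bound_self[OF Tpi_sa fh])
  then have "form_bound (eps_op a b r \<epsilon>) f (Re (ip h f))"
    using pos Tpi_LL[OF fh] Tpi_nonneg(1)[OF fh] unfolding op_le_iff by blast
  then show ?thesis by (rule form_bound_eps[OF eps Tpi_LL(1)[OF fh] Tpi_nonneg(1)[OF fh]])
qed

text \<open>Coercivity of the enlarged relation makes it onto. From here any square integrable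
  function may be used as a right-hand side, which replaces domain arguments by statements about
  \<open>h\<close>.\<close>

lemma Tpi_surj: assumes h: "LL h" obtains f where "(f, h) \<in> TT pi"
proof -
  define H where "H = sat a b r (TT pi)"
  have "H = adjoint a b r H"
    using adjoint_sat[OF TT_L2, of pi] Tpi_sa unfolding H_def by (simp add: nonneg_sa_def self_adjoint_op_def)
  then interpret H: closed_sa a b r H by unfold_locales
  interpret A: sa_rel "up H" by unfold_locales (rule H.up_sa)
  have "\<epsilon> * (x \<bullet> x) \<le> y \<bullet> x" if xy: "(x, y) \<in> up H" for x y
  proof -
    obtain f g k where *: "(f, g) \<in> H" "k \<in> range_perp" "x = U f" "y = U g + k" using xy by (rule upE)
    obtain f0 g0 where 0: "(f0, g0) \<in> TT pi" "eqv f f0" "eqv g g0" using *(1) unfolding H_def sat_iff by blast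
    have "U f = U f0" "U g = U g0" using 0 H.H_L2[OF *(1)] Tpi_LL[OF 0(1)] by (simp_all add: U_eq_iff)
    then show ?thesis using Tpi_coercive[OF 0(1)] Tpi_LL[OF 0(1)] range_perp_inner[OF *(2)]
      by (simp add: * Re_ip inner_add_left inner_commute[of k])
  qed
  then obtain x where "(x, U h) \<in> up H" using A.surj_if_coercive[OF eps] by metis
  then obtain f g k where *: "(f, g) \<in> H" "k \<in> range_perp" "U h = U g + k" by (rule upE)
  have Lg: "LL g" using H.H_L2(2)[OF *(1)] .
  have "U h - U g \<in> range_perp" using * by simp
  then have "eqv h g" using h Lg U_range_perp_unique U_eq_iff by blast
  obtain f0 g0 where 0: "(f0, g0) \<in> TT pi" "eqv g g0" using *(1) unfolding H_def sat_iff by blast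
  have "eqv g0 h" using eqv_sym[OF eqv_trans[OF \<open>eqv h g\<close> 0(2)]] .
  from Tpi_cong[OF 0(1) this h] show ?thesis by (rule that)
qed

text \<open>Otherwise \<open>ua\<close> would be a nonzero element of the kernel of a coercive
  operator.\<close>

lemma bcb_ua_nz: "bcb ua \<noteq> 0"
proof
  assume "bcb ua = 0"
  then have m: "(ua, \<lambda>_. 0) \<in> TT pi" using ua_TM by (simp add: Tpi_iff bva_ua)
  have L: "LL ua" by (rule Tpi_LL(1)[OF m])
  have "ip (\<lambda>_. 0) ua = 0" by (simp add: inner_L2_def)
  with Tpi_coercive[OF m] have "\<epsilon> * Re (ip ua ua) \<le> 0" by simp
  then have "Re (ip ua ua) = 0" using eps ip_self_nonneg[OF L] by (simp add: mult_le_0_iff)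
  then have "eqv ua (\<lambda>_. 0)" using ip_self[OF L] ip_self_eq_0[OF L] by simp
  then have ae: "AE x in lebesgue. x \<in> I \<longrightarrow> ua x = 0" by (simp add: ae_eq_def)
  obtain c where c: "c \<in> I" "ua c \<noteq> 0" using ua unfolding principal_a_def by auto
  have "ua c = 0" by (rule continuous_AE_eq_on_open[OF open_Ioo_e ua_cont _ ae c(1)]) simp
  with c(2) show False by simp
qed

section \<open>The solution \<psi> and the parameter of an extension\<close>

definition Q :: real where "Q = Re (bcb uah / bcb ua)"

lemma bcb_uah: "bcb uah = complex_of_real Q * bcb ua"
proof -
  have "cnj (bcb uah / bcb ua) = bcb uah / bcb ua" using bcb_real[OF uah] bcb_real[OF ua_real] by simp
  then have "bcb uah / bcb ua = complex_of_real Q" unfolding Q_def by (metis Reals_cnj_iff of_real_Re)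
  then show ?thesis using bcb_ua_nz by (simp add: field_simps)
qed

text \<open>The multiple of \<open>ua\<close> cancels the boundary form at \<open>b\<close>. It does
  not affect the boundary value 1 at \<open>a\<close>, and Q reappears as minus the boundary
  derivative there.\<close>

definition \<psi> :: fn where "\<psi> x = uah x + (- complex_of_real Q) * ua x"

lemma psi_TM: "(\<psi>, \<lambda>_. 0) \<in> TM"
  unfolding \<psi>_def[abs_def] by (rule TM_lincomb_eq[OF uah_TM ua_TM])

lemma psi_LL: "LL \<psi>" using psi_TM T_max_L2 by blast

lemma psi_bv: "bcb \<psi> = 0" "bva \<psi> = 1" "bvda \<psi> = - complex_of_real Q"
proof -
  have e: "\<psi> = (\<lambda>x. 1 * uah x + (- complex_of_real Q) * ua x)" by (simp add: \<psi>_def fun_eq_iff)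
  show "bcb \<psi> = 0" unfolding e bcb_lincomb[OF uah_TM ua_TM] by (simp add: bcb_uah)
  show "bva \<psi> = 1" unfolding e bva_lincomb[OF uah_TM ua_TM] by (simp add: bva_ua bva_uah)
  show "bvda \<psi> = - complex_of_real Q" unfolding e bvda_lincomb[OF uah_TM ua_TM] by (simp add: bvda_ua bvda_uah)
qed

lemma psi_Wr: assumes x: "x \<in> I" shows "Wr a b p ua \<psi> x = -1"
proof -
  have e: "\<psi> = (\<lambda>x. 1 * uah x + (- complex_of_real Q) * ua x)" by (simp add: \<psi>_def fun_eq_iff)
  have "Wr a b p ua ua x = 0" by (simp add: Wr_def)
  moreover have "Wr a b p ua uah x = -1" using W_a[OF x] Wr_swap[of ua uah x] by simp
  ultimately show ?thesis unfolding e Wr_lincomb[OF uah_TM ua_TM x] by simp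
qed

lemma psi_cnj: "x \<in> I \<Longrightarrow> cnj (\<psi> x) = \<psi> x"
  using real_sol_cnj(1)[OF uah] real_sol_cnj(1)[OF ua_real] by (simp add: \<psi>_def)

text \<open>\<psi> is real and solves the homogeneous equation, and both functions satisfy the
  condition at \<open>b\<close>, so Green's formula leaves only the boundary term at
  \<open>a\<close>.\<close>

lemma ip_psi: assumes f: "(f, h) \<in> TM" "bcb f = 0" shows "ip h \<psi> = bvda f + complex_of_real Q * bva f"
proof -
  have "ip h \<psi> = set_lebesgue_integral lebesgue I (\<lambda>x. complex_of_real (r x) * (h x * \<psi> x - f x * 0))"
    unfolding inner_L2_def by (rule set_lebesgue_integral_cong) (auto simp: psi_cnj)
  also have "\<dots> = bvda f + complex_of_real Q * bva f"
    unfolding green_bcb[OF f psi_TM psi_bv(1)] by (simp add: psi_bv)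
  finally show ?thesis .
qed

lemma TM_bcb_split:
  assumes "(g, h) \<in> TM" "bcb g = 0"
  shows "((\<lambda>x. g x + (- bva g) * \<psi> x), h) \<in> TT pi"
proof -
  have e: "(\<lambda>x. g x + (- bva g) * \<psi> x) = (\<lambda>x. 1 * g x + (- bva g) * \<psi> x)" by simp
  show ?thesis unfolding Tpi_iff
  proof (intro conjI)
    show "((\<lambda>x. g x + (- bva g) * \<psi> x), h) \<in> TM" by (rule TM_lincomb_eq[OF assms(1) psi_TM])
    show "bcb (\<lambda>x. g x + (- bva g) * \<psi> x) = 0" unfolding e bcb_lincomb[OF assms(1) psi_TM] by (simp add: assms psi_bv)
    show "bva (\<lambda>x. g x + (- bva g) * \<psi> x) = 0" unfolding e bva_lincomb[OF assms(1) psi_TM] by (simp add: psi_bv)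
  qed
qed

lemma Tpi_add_psi:
  assumes "(f, h) \<in> TT pi"
  shows "((\<lambda>x. f x + c * \<psi> x), h) \<in> TM" "bcb (\<lambda>x. f x + c * \<psi> x) = 0" "bva (\<lambda>x. f x + c * \<psi> x) = c"
proof -
  have e: "(\<lambda>x. f x + c * \<psi> x) = (\<lambda>x. 1 * f x + c * \<psi> x)" by simp
  have f: "(f, h) \<in> TM" "bcb f = 0" "bva f = 0" using assms by (auto simp: Tpi_iff)
  show "((\<lambda>x. f x + c * \<psi> x), h) \<in> TM" by (rule TM_lincomb_eq[OF f(1) psi_TM])
  show "bcb (\<lambda>x. f x + c * \<psi> x) = 0" unfolding e bcb_lincomb[OF f(1) psi_TM] by (simp add: f psi_bv)
  show "bva (\<lambda>x. f x + c * \<psi> x) = c" unfolding e bva_lincomb[OF f(1) psi_TM] by (simp add: f psi_bv)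
qed

definition \<theta> :: "real \<Rightarrow> real" where "\<theta> \<alpha> = Q - cos \<alpha> / sin \<alpha>"

text \<open>Since sin \<alpha> is nonzero, the condition at \<open>a\<close> can be solved for the
  boundary derivative and substituted into the formula for the pairing with \<psi>.\<close>

lemma TT_iff_theta:
  assumes "0 < \<alpha>" "\<alpha> < pi"
  shows "(g, h) \<in> TT \<alpha> \<longleftrightarrow> (g, h) \<in> TM \<and> bcb g = 0 \<and> ip h \<psi> = bva g * complex_of_real (\<theta> \<alpha>)"
proof -
  have s: "complex_of_real (sin \<alpha>) \<noteq> 0" using sin_gt_zero[OF assms] by simp
  have "bva g * complex_of_real (cos \<alpha>) + bvda g * complex_of_real (sin \<alpha>) = 0 \<longleftrightarrow> ip h \<psi> = bva g * complex_of_real (\<theta> \<alpha>)"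
    if "(g, h) \<in> TM" "bcb g = 0"
    unfolding ip_psi[OF that] using s by (auto simp: \<theta>_def field_simps eq_neg_iff_add_eq_0)
  then show ?thesis by (auto simp: TT_iff)
qed

text \<open>The extension with parameter $t = Q - \cot\alpha$; $\alpha = \pi$ corresponds to $t = \infty$, that is $c = 0$.\<close>

definition Ext :: "real \<Rightarrow> graph" where
  "Ext t = {(g, h). LL g \<and> LL h \<and> (\<exists>f c. (f, h) \<in> TT pi \<and> eqv g (\<lambda>x. f x + c * \<psi> x) \<and> ip h \<psi> = c * complex_of_real t)}"

lemma Ext_iff: "(g, h) \<in> Ext t \<longleftrightarrow> LL g \<and> LL h \<and>
    (\<exists>f c. (f, h) \<in> TT pi \<and> eqv g (\<lambda>x. f x + c * \<psi> x) \<and> ip h \<psi> = c * complex_of_real t)"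
  by (simp add: Ext_def)

lemma sat_TT: assumes "0 < \<alpha>" "\<alpha> < pi" shows "sat a b r (TT \<alpha>) = Ext (\<theta> \<alpha>)"
proof (intro set_eqI iffI; clarify)
  fix u v assume "(u, v) \<in> sat a b r (TT \<alpha>)"
  then obtain g h where L: "LL u" "LL v" and gh: "(g, h) \<in> TT \<alpha>" and e: "eqv u g" "eqv v h" unfolding sat_iff by blast
  have g: "(g, h) \<in> TM" "bcb g = 0" "ip h \<psi> = bva g * complex_of_real (\<theta> \<alpha>)" using gh by (auto simp: TT_iff_theta[OF assms])
  have 1: "((\<lambda>x. g x + (- bva g) * \<psi> x), v) \<in> TT pi" by (rule Tpi_cong[OF TM_bcb_split[OF g(1,2)] eqv_sym[OF e(2)] L(2)])
  have 2: "eqv u (\<lambda>x. (g x + (- bva g) * \<psi> x) + bva g * \<psi> x)" using e(1) by simp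
  have 3: "ip v \<psi> = bva g * complex_of_real (\<theta> \<alpha>)"
    using ip_cong[OF L(2) T_max_L2(2)[OF g(1)] e(2) psi_LL psi_LL eqv_refl] g(3) by simp
  from L 1 2 3 show "(u, v) \<in> Ext (\<theta> \<alpha>)" unfolding Ext_iff by blast
next
  fix u v assume "(u, v) \<in> Ext (\<theta> \<alpha>)"
  then obtain f c where *: "LL u" "LL v" "(f, v) \<in> TT pi" "eqv u (\<lambda>x. f x + c * \<psi> x)" "ip v \<psi> = c * complex_of_real (\<theta> \<alpha>)"
    unfolding Ext_iff by blast
  have "((\<lambda>x. f x + c * \<psi> x), v) \<in> TT \<alpha>"
    unfolding TT_iff_theta[OF assms] using Tpi_add_psi[OF *(3), of c] *(5) by simp
  with * show "(u, v) \<in> sat a b r (TT \<alpha>)" unfolding sat_iff using eqv_refl by blast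
qed

lemma sat_Tpi_iff: "(u, v) \<in> sat a b r (TT pi) \<longleftrightarrow> LL u \<and> LL v \<and> (\<exists>f. (f, v) \<in> TT pi \<and> eqv u f)"
proof
  assume "(u, v) \<in> sat a b r (TT pi)"
  then obtain f g where "LL u" "LL v" and fg: "(f, g) \<in> TT pi" "eqv u f" "eqv v g" unfolding sat_iff by blast
  with Tpi_cong[OF fg(1) eqv_sym[OF fg(3)]] show "LL u \<and> LL v \<and> (\<exists>f. (f, v) \<in> TT pi \<and> eqv u f)" by blast
next
  assume "LL u \<and> LL v \<and> (\<exists>f. (f, v) \<in> TT pi \<and> eqv u f)"
  then show "(u, v) \<in> sat a b r (TT pi)" unfolding sat_iff using eqv_refl[of v] by blast
qed

text \<open>When the boundary value at \<open>a\<close> is 0, the pairing with \<psi> is the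
  boundary derivative. The minimal operator is thereby described through orthogonality of right-hand
  sides.\<close>

lemma Tmin_iff_psi: "(f, h) \<in> Tmin \<longleftrightarrow> (f, h) \<in> TT pi \<and> ip h \<psi> = 0"
  unfolding Tmin_iff Tpi_iff using ip_psi[of f h] by auto

text \<open>The quotient estimate for the form is solved by surjectivity and normalized by a scalar,
  so the pairing with \<psi> can be prescribed while the form stays as small as desired.\<close>

lemma friedrichs_scaled:
  assumes d: "0 < \<delta>" and t: "t \<noteq> 0"
  obtains f h where "(f, h) \<in> TT pi" "ip h \<psi> = t" "Re (ip h f) < \<delta>"
proof -
  \<comment> \<open>Scaling the pairing to t turns the form value into |t|^2 times the quotient of
    form and squared pairing, a quotient below 1 / M.\<close>
  define M where "M = (cmod t)\<^sup>2 / \<delta>"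
  have M: "0 \<le> M" using d by (simp add: M_def)
  obtain h where h: "LL h" "\<And>f. (f, h) \<in> TM \<Longrightarrow> bva f = 0 \<Longrightarrow> M * Re (ip h f) < (cmod (ip h \<psi>))\<^sup>2"
    by (rule friedrichs[OF psi_TM psi_Wr M], assumption, rule that)
  obtain f where f: "(f, h) \<in> TT pi" by (rule Tpi_surj[OF h(1)])
  have lt: "M * Re (ip h f) < (cmod (ip h \<psi>))\<^sup>2" using f by (intro h(2)) (auto simp: Tpi_iff)
  have "0 \<le> M * Re (ip h f)" using M Tpi_nonneg(1)[OF f] by simp
  with lt have nz: "ip h \<psi> \<noteq> 0" by auto
  define k where "k = t / ip h \<psi>"
  have m: "((\<lambda>x. k * f x), (\<lambda>x. k * h x)) \<in> TT pi" using Tpi_lincomb[OF f f, of k 0] by simp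
  have "ip (\<lambda>x. k * h x) \<psi> = t" unfolding ip_cmult_left[OF h(1) psi_LL] using nz by (simp add: k_def)
  moreover have "Re (ip (\<lambda>x. k * h x) (\<lambda>x. k * f x)) < \<delta>"
  proof -
    have "ip (\<lambda>x. k * h x) (\<lambda>x. k * f x) = (k * cnj k) * ip h f"
      using Tpi_LL[OF f] by (simp add: ip_cmult_left ip_cmult_right L2_cmult)
    also have "k * cnj k = complex_of_real ((cmod k)\<^sup>2)" by (rule complex_norm_square[symmetric])
    finally have "Re (ip (\<lambda>x. k * h x) (\<lambda>x. k * f x)) = (cmod k)\<^sup>2 * Re (ip h f)" by simp
    also have "\<dots> = (cmod t)\<^sup>2 * Re (ip h f) / (cmod (ip h \<psi>))\<^sup>2" by (simp add: k_def norm_divide power_divide)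
    also have "\<dots> < \<delta>" using lt nz d by (simp add: M_def field_simps)
    finally show ?thesis .
  qed
  ultimately show ?thesis using m by (intro that)
qed

lemma psi_norm_nz: "ip \<psi> \<psi> \<noteq> 0"
proof
  assume "ip \<psi> \<psi> = 0"
  then have e: "eqv \<psi> (\<lambda>_. 0)" using ip_self_eq_0[OF psi_LL] by simp
  obtain f h where fh: "(f, h) \<in> TT pi" "ip h \<psi> = 1" by (rule friedrichs_scaled[of 1 1]) auto
  have "ip h \<psi> = ip h (\<lambda>_. 0)" by (intro ip_cong Tpi_LL(2)[OF fh(1)] psi_LL L2_zero e eqv_refl)
  with fh(2) show False by (simp add: inner_L2_def)
qed

text \<open>Take f with image v. By symmetry u - f is orthogonal to every \<open>h\<close> with zero
  pairing with \<psi>, because each such \<open>h\<close> is the image of an element of the minimal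
  operator. Hence u - f is a multiple of \<psi>.\<close>

lemma adjoint_Tmin_form:
  assumes uv: "(u, v) \<in> adjoint a b r Tmin"
  obtains f c where "(f, v) \<in> TT pi" "eqv u (\<lambda>x. f x + c * \<psi> x)"
proof -
  have L: "LL u" "LL v" using uv by (auto simp: adjoint_iff)
  obtain f where f: "(f, v) \<in> TT pi" by (rule Tpi_surj[OF L(2)])
  note Lf = Tpi_LL(1)[OF f]
  have key: "ip h u = ip h f" if h: "LL h" "ip h \<psi> = 0" for h
  proof -
    obtain k where k: "(k, h) \<in> TT pi" by (rule Tpi_surj[OF h(1)])
    then have "(k, h) \<in> Tmin" using h(2) by (simp add: Tmin_iff_psi)
    then have "ip h u = ip k v" using uv by (auto simp: adjoint_iff)
    also have "\<dots> = ip h f" by (rule Tpi_sym[OF k f, symmetric])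
    finally show ?thesis .
  qed
  \<comment> \<open>With the projection coefficient c the remainder d is orthogonal to \<psi>, so d
    is itself an admissible right-hand side to test against, and |d|^2 = 0 follows.\<close>
  define c where "c = ip (\<lambda>x. u x - f x) \<psi> / ip \<psi> \<psi>"
  define d where "d = (\<lambda>x. (u x - f x) + (- c) * \<psi> x)"
  have Ld: "LL d" unfolding d_def by (intro L2_add L2_diff L2_cmult L Lf psi_LL)
  have dp: "ip d \<psi> = 0" unfolding d_def
    by (simp only: ip_add_left[OF L2_diff[OF L(1) Lf] L2_cmult[OF psi_LL] psi_LL] ip_cmult_left[OF psi_LL psi_LL])
      (simp add: c_def psi_norm_nz)
  have "ip d (\<lambda>x. u x - f x) = ip d u - ip d f"
    using ip_add_right[OF L(1) L2_cmult[OF Lf, of "-1"] Ld] ip_cmult_right[OF Lf Ld, of "-1"] by simp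
  then have "ip d (\<lambda>x. u x - f x) = 0" using key[OF Ld dp] by simp
  moreover have "ip d d = ip d (\<lambda>x. u x - f x) + cnj (- c) * ip d \<psi>"
    by (subst (2) d_def) (simp only: ip_add_right[OF L2_diff[OF L(1) Lf] L2_cmult[OF psi_LL] Ld] ip_cmult_right[OF psi_LL Ld])
  ultimately have "ip d d = 0" using dp by simp
  then have "eqv d (\<lambda>_. 0)" using ip_self_eq_0[OF Ld] by simp
  then have "eqv u (\<lambda>x. f x + c * \<psi> x)" unfolding ae_eq_def d_def by eventually_elim (auto simp: algebra_simps)
  with f show ?thesis by (rule that)
qed

lemma ip_ext_right:
  assumes "LL h" "LL g" "LL f" "eqv g (\<lambda>x. f x + c * \<psi> x)"
  shows "ip h g = ip h f + cnj c * ip h \<psi>"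
proof -
  have "ip h g = ip h (\<lambda>x. f x + c * \<psi> x)"
    using assms psi_LL by (intro ip_cong L2_add L2_cmult eqv_refl)
  also have "\<dots> = ip h f + cnj c * ip h \<psi>" using assms psi_LL by (simp add: ip_add_right ip_cmult_right L2_cmult)
  finally show ?thesis .
qed

lemma ip_ext_left:
  assumes "LL h" "LL g" "LL f" "eqv g (\<lambda>x. f x + c * \<psi> x)"
  shows "ip g h = ip f h + c * cnj (ip h \<psi>)"
  using ip_ext_right[OF assms] ip_commute[OF assms(1,2)] ip_commute[OF assms(1,3)] by simp

section \<open>Self-adjointness, nonnegativity and classification of the extensions\<close>

lemma Tmin_subset_Ext: "Tmin \<subseteq> Ext t"
proof clarify
  fix f h assume "(f, h) \<in> Tmin"
  then have f: "(f, h) \<in> TT pi" "ip h \<psi> = 0" by (auto simp: Tmin_iff_psi)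
  then show "(f, h) \<in> Ext t" unfolding Ext_iff using Tpi_LL[OF f(1)] by (intro conjI exI[of _ f] exI[of _ 0]) auto
qed

text \<open>Reality of t makes the \<psi> contributions on both sides agree. An adjoint pair already
  has the form f + c \<psi>, since it is adjoint to the minimal operator, and pairing with a single
  element of coefficient 1 fixes its remaining relation.\<close>

lemma Ext_self_adjoint: "Ext t = adjoint a b r (Ext t)"
proof (intro set_eqI iffI; clarify)
  fix u v assume "(u, v) \<in> Ext t"
  then obtain f c where *: "LL u" "LL v" "(f, v) \<in> TT pi" "eqv u (\<lambda>x. f x + c * \<psi> x)" "ip v \<psi> = c * complex_of_real t"
    unfolding Ext_iff by blast
  show "(u, v) \<in> adjoint a b r (Ext t)" unfolding adjoint_iff
  proof (intro conjI * allI impI)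
    fix g h assume "(g, h) \<in> Ext t"
    then obtain f' c' where g: "LL g" "LL h" "(f', h) \<in> TT pi" "eqv g (\<lambda>x. f' x + c' * \<psi> x)" "ip h \<psi> = c' * complex_of_real t"
      unfolding Ext_iff by blast
    show "ip h u = ip g v"
      using ip_ext_right[OF g(2) *(1) Tpi_LL(1)[OF *(3)] *(4)] ip_ext_left[OF *(2) g(1) Tpi_LL(1)[OF g(3)] g(4)]
        Tpi_sym[OF g(3) *(3)] g(5) *(5) by simp
  qed
next
  fix u v assume uv: "(u, v) \<in> adjoint a b r (Ext t)"
  then have L: "LL u" "LL v" by (auto simp: adjoint_iff)
  have "(u, v) \<in> adjoint a b r Tmin" using adjoint_antimono[OF Tmin_subset_Ext] uv by blast
  then obtain f c where f: "(f, v) \<in> TT pi" "eqv u (\<lambda>x. f x + c * \<psi> x)" by (rule adjoint_Tmin_form)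
  \<comment> \<open>A multiple of \<psi> realizes the pairing t, as required for an element of
    coefficient 1; this also works for t = 0.\<close>
  define h where "h = (\<lambda>x. (complex_of_real t / ip \<psi> \<psi>) * \<psi> x)"
  have Lh: "LL h" unfolding h_def by (rule L2_cmult[OF psi_LL])
  have hp: "ip h \<psi> = complex_of_real t" unfolding h_def ip_cmult_left[OF psi_LL psi_LL] using psi_norm_nz by simp
  obtain k where k: "(k, h) \<in> TT pi" by (rule Tpi_surj[OF Lh])
  define g where "g = (\<lambda>x. k x + 1 * \<psi> x)"
  have Lg: "LL g" unfolding g_def by (intro L2_add L2_cmult psi_LL Tpi_LL(1)[OF k])
  have eg: "eqv g (\<lambda>x. k x + 1 * \<psi> x)" by (simp add: g_def)
  have "(g, h) \<in> Ext t" unfolding Ext_iff using Lg Lh k eg hp by (intro conjI exI[of _ k] exI[of _ 1]) auto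
  then have "ip h u = ip g v" using uv by (auto simp: adjoint_iff)
  then have "cnj c * complex_of_real t = cnj (ip v \<psi>)"
    using ip_ext_right[OF Lh L(1) Tpi_LL(1)[OF f(1)] f(2)] ip_ext_left[OF L(2) Lg Tpi_LL(1)[OF k] eg]
      Tpi_sym[OF k f(1)] hp by simp
  then have "ip v \<psi> = c * complex_of_real t" by (metis complex_cnj_cnj complex_cnj_complex_of_real complex_cnj_mult)
  with L f show "(u, v) \<in> Ext t" unfolding Ext_iff by blast
qed

lemma Ext_ip:
  assumes "LL g" "(f, h) \<in> TT pi" "eqv g (\<lambda>x. f x + c * \<psi> x)" "ip h \<psi> = c * complex_of_real t"
  shows "ip h g = ip h f + complex_of_real (t * (cmod c)\<^sup>2)"
proof -
  have "ip h g = ip h f + cnj c * (c * complex_of_real t)"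
    using ip_ext_right[OF Tpi_LL(2)[OF assms(2)] assms(1) Tpi_LL(1)[OF assms(2)] assms(3)] assms(4) by simp
  also have "cnj c * (c * complex_of_real t) = complex_of_real (t * (cmod c)\<^sup>2)"
    using complex_norm_square[of c] by (simp add: mult.commute mult.left_commute)
  finally show ?thesis .
qed

lemma Ext_nonneg: assumes t: "0 \<le> t" and gh: "(g, h) \<in> Ext t" shows "ip h g \<in> \<real>" "0 \<le> Re (ip h g)"
proof -
  obtain f c where *: "LL g" "(f, h) \<in> TT pi" "eqv g (\<lambda>x. f x + c * \<psi> x)" "ip h \<psi> = c * complex_of_real t"
    using gh unfolding Ext_iff by blast
  show "ip h g \<in> \<real>" "0 \<le> Re (ip h g)" using Tpi_nonneg[OF *(2)] t unfolding Ext_ip[OF *] by auto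
qed

text \<open>If t < 0, an element of coefficient 1 with reference form value below -t has negative
  total form, and small reference values are available.\<close>

lemma Ext_nonneg_imp:
  assumes "\<And>g h. (g, h) \<in> Ext t \<Longrightarrow> 0 \<le> Re (ip h g)"
  shows "0 \<le> t"
proof (rule ccontr)
  assume "\<not> 0 \<le> t"
  then have t: "0 < - t" "complex_of_real t \<noteq> 0" by auto
  obtain f h where f: "(f, h) \<in> TT pi" "ip h \<psi> = complex_of_real t" "Re (ip h f) < - t"
    using friedrichs_scaled[OF t] by metis
  define g where "g = (\<lambda>x. f x + 1 * \<psi> x)"
  have Lg: "LL g" unfolding g_def by (intro L2_add L2_cmult psi_LL Tpi_LL(1)[OF f(1)])
  have eg: "eqv g (\<lambda>x. f x + 1 * \<psi> x)" by (simp add: g_def)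
  have hp: "ip h \<psi> = 1 * complex_of_real t" using f(2) by simp
  have "(g, h) \<in> Ext t" unfolding Ext_iff using Lg Tpi_LL(2)[OF f(1)] f(1) eg hp by blast
  from assms[OF this] f(3) show False unfolding Ext_ip[OF Lg f(1) eg hp] by simp
qed

lemma TT_self_adjoint: assumes "0 < \<alpha>" "\<alpha> < pi" shows "self_adjoint_op a b r (TT \<alpha>)"
  unfolding self_adjoint_op_def single_valued_op_def
proof (intro conjI TT_L2)
  show "\<forall>(f1, g1)\<in>TT \<alpha>. \<forall>(f2, g2)\<in>TT \<alpha>. eqv f1 f2 \<longrightarrow> eqv g1 g2"
    using T_max_single_valued by (fastforce simp: TT_iff)
  show "sat a b r (TT \<alpha>) = adjoint a b r (TT \<alpha>)"
    using sat_TT[OF assms] Ext_self_adjoint adjoint_sat[OF TT_L2, of \<alpha>] by simp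
qed

lemma nonneg_sa_TT_iff: assumes \<alpha>: "0 < \<alpha>" "\<alpha> \<le> pi" shows "nonneg_sa a b r (TT \<alpha>) \<longleftrightarrow> arccot Q \<le> \<alpha>"
proof (cases "\<alpha> = pi")
  case True
  then show ?thesis using Tpi_sa cot_arccot(2)[of Q] by simp
next
  case False
  with \<alpha> have lt: "\<alpha> < pi" by simp
  have "nonneg_sa a b r (TT \<alpha>) \<longleftrightarrow> 0 \<le> \<theta> \<alpha>"
  proof
    assume n: "nonneg_sa a b r (TT \<alpha>)"
    show "0 \<le> \<theta> \<alpha>"
    proof (rule Ext_nonneg_imp)
      fix g h assume "(g, h) \<in> Ext (\<theta> \<alpha>)"
      then have "(g, h) \<in> sat a b r (TT \<alpha>)" by (simp add: sat_TT[OF \<alpha>(1) lt])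
      then obtain g' h' where *: "LL g" "LL h" "(g', h') \<in> TT \<alpha>" "eqv g g'" "eqv h h'" unfolding sat_iff by blast
      have "ip h g = ip h' g'" using L2_pairsD[OF TT_L2 *(3)] * by (intro ip_cong) auto
      then show "0 \<le> Re (ip h g)" using n *(3) by (auto simp: nonneg_sa_def nonneg_op_def)
    qed
  next
    assume t: "0 \<le> \<theta> \<alpha>"
    have "TT \<alpha> \<subseteq> Ext (\<theta> \<alpha>)" using subset_sat[OF TT_L2] sat_TT[OF \<alpha>(1) lt] by blast
    then have "nonneg_op a b r (TT \<alpha>)" unfolding nonneg_op_def using Ext_nonneg[OF t] by blast
    then show "nonneg_sa a b r (TT \<alpha>)" using TT_self_adjoint[OF \<alpha>(1) lt] by (simp add: nonneg_sa_def)
  qed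
  also have "\<dots> \<longleftrightarrow> arccot Q \<le> \<alpha>" unfolding arccot_le_iff[OF \<alpha>(1) lt] by (simp add: \<theta>_def)
  finally show ?thesis .
qed

lemma Tmin_subset_TT: assumes "0 < \<alpha>" "\<alpha> \<le> pi" shows "Tmin \<subseteq> TT \<alpha>"
  by (auto simp: TT_iff Tmin_iff)

lemma sat_mono: "G \<subseteq> G' \<Longrightarrow> sat a b r G \<subseteq> sat a b r G'"
  by (auto simp: sat_def)

text \<open>A self-adjoint extension either has only zero coefficients, and is then the reference
  operator, or contains an element with nonzero coefficient. Symmetry against that element
  determines the parameter, and maximality turns inclusion into equality.\<close>

lemma nonneg_extensions:
  assumes SL2: "S \<subseteq> L2_pairs a b r"
  shows "(nonneg_sa a b r S \<and> sat a b r Tmin \<subseteq> sat a b r S) \<longleftrightarrow>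
    (\<exists>\<alpha>. arccot Q \<le> \<alpha> \<and> \<alpha> \<le> pi \<and> sat a b r S = sat a b r (TT \<alpha>))"
proof
  assume "\<exists>\<alpha>. arccot Q \<le> \<alpha> \<and> \<alpha> \<le> pi \<and> sat a b r S = sat a b r (TT \<alpha>)"
  then obtain \<alpha> where \<alpha>: "arccot Q \<le> \<alpha>" "\<alpha> \<le> pi" "sat a b r S = sat a b r (TT \<alpha>)" by blast
  have a0: "0 < \<alpha>" using \<alpha>(1) cot_arccot(1)[of Q] by simp
  have "nonneg_sa a b r (TT \<alpha>)" using nonneg_sa_TT_iff[OF a0 \<alpha>(2)] \<alpha>(1) by simp
  then show "nonneg_sa a b r S \<and> sat a b r Tmin \<subseteq> sat a b r S"
    using nonneg_sa_sat_cong[OF _ SL2 \<alpha>(3)] sat_mono[OF Tmin_subset_TT[OF a0 \<alpha>(2)]] \<alpha>(3) by simp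
next
  assume S: "nonneg_sa a b r S \<and> sat a b r Tmin \<subseteq> sat a b r S"
  define H where "H = sat a b r S"
  have Hadj: "H = adjoint a b r H"
    using S adjoint_sat[OF SL2] unfolding H_def by (simp add: nonneg_sa_def self_adjoint_op_def)
  then interpret H: closed_sa a b r H by unfold_locales
  have HTmin: "Tmin \<subseteq> H" using S subset_sat[OF Tmin_L2] by (auto simp: H_def)
  have form: "\<exists>f c. (f, v) \<in> TT pi \<and> eqv u (\<lambda>x. f x + c * \<psi> x)" if uv: "(u, v) \<in> H" for u v
  proof -
    have "(u, v) \<in> adjoint a b r Tmin" using uv Hadj adjoint_antimono[OF HTmin] by blast
    then show ?thesis by (rule adjoint_Tmin_form) blast
  qed
  \<comment> \<open>Taking adjoints reverses the inclusion, so a self-adjoint graph has no proper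
    self-adjoint extension.\<close>
  have maximal: "H = E" if "H \<subseteq> E" "E = adjoint a b r E" for E
    using that adjoint_antimono[OF that(1)] Hadj by auto
  show "\<exists>\<alpha>. arccot Q \<le> \<alpha> \<and> \<alpha> \<le> pi \<and> sat a b r S = sat a b r (TT \<alpha>)"
  proof (cases "\<forall>u v. (u, v) \<in> H \<longrightarrow> (u, v) \<in> sat a b r (TT pi)")
    case True
    have "sat a b r (TT pi) = adjoint a b r (sat a b r (TT pi))"
      using Tpi_sa adjoint_sat[OF TT_L2, of pi] by (simp add: nonneg_sa_def self_adjoint_op_def)
    then have "H = sat a b r (TT pi)" using True by (intro maximal) auto
    then show ?thesis using cot_arccot(2)[of Q] by (intro exI[of _ pi]) (simp add: H_def)
  next
    case False
    then obtain u0 v0 where 0: "(u0, v0) \<in> H" "(u0, v0) \<notin> sat a b r (TT pi)" by blast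
    obtain f0 c0 where f0: "(f0, v0) \<in> TT pi" "eqv u0 (\<lambda>x. f0 x + c0 * \<psi> x)" using form[OF 0(1)] by blast
    have L0: "LL u0" "LL v0" using H.H_L2[OF 0(1)] by auto
    have c0: "c0 \<noteq> 0"
    proof
      assume "c0 = 0"
      then have "eqv u0 f0" using f0(2) by simp
      then show False using 0(2) f0(1) L0 by (auto simp: sat_Tpi_iff)
    qed
    define t where "t = Re (ip v0 \<psi> / c0)"
    \<comment> \<open>In the symmetry identity with the fixed element the reference parts cancel and
      only the \<psi> terms remain. Applied to the fixed element itself, the identity shows that its
      ratio is real.\<close>
    have gen: "cnj c0 * ip v \<psi> = c * cnj (ip v0 \<psi>)"
      if uv: "(u, v) \<in> H" and f: "(f, v) \<in> TT pi" "eqv u (\<lambda>x. f x + c * \<psi> x)" for u v f c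
    proof -
      have L: "LL u" "LL v" using H.H_L2[OF uv] by auto
      have "ip v u0 = ip u v0" by (rule H.H_sym[OF uv 0(1)])
      then show ?thesis
        using ip_ext_right[OF L(2) L0(1) Tpi_LL(1)[OF f0(1)] f0(2)] ip_ext_left[OF L0(2) L(1) Tpi_LL(1)[OF f(1)] f(2)]
          Tpi_sym[OF f(1) f0(1)] by simp
    qed
    have "cnj (ip v0 \<psi> / c0) = ip v0 \<psi> / c0"
      using gen[OF 0(1) f0] c0 by (simp add: field_simps)
    then have "ip v0 \<psi> / c0 = complex_of_real t" unfolding t_def by (metis Reals_cnj_iff of_real_Re)
    then have d0: "ip v0 \<psi> = c0 * complex_of_real t" using c0 by (simp add: field_simps)
    have "H \<subseteq> Ext t"
    proof clarify
      fix u v assume uv: "(u, v) \<in> H"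
      obtain f c where f: "(f, v) \<in> TT pi" "eqv u (\<lambda>x. f x + c * \<psi> x)" using form[OF uv] by blast
      have "cnj c0 * ip v \<psi> = cnj c0 * (c * complex_of_real t)" using gen[OF uv f] d0 by simp
      then have "ip v \<psi> = c * complex_of_real t" using c0 by simp
      then show "(u, v) \<in> Ext t" unfolding Ext_iff using H.H_L2[OF uv] f by blast
    qed
    then have HE: "H = Ext t" by (rule maximal) (rule Ext_self_adjoint)
    have t0: "0 \<le> t"
    proof (rule Ext_nonneg_imp)
      fix g h assume "(g, h) \<in> Ext t"
      then have "(g, h) \<in> sat a b r S" using HE by (simp add: H_def)
      then obtain g' h' where *: "LL g" "LL h" "(g', h') \<in> S" "eqv g g'" "eqv h h'" unfolding sat_iff by blast
      have "ip h g = ip h' g'" using L2_pairsD[OF SL2 *(3)] * by (intro ip_cong) auto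
      then show "0 \<le> Re (ip h g)" using S *(3) by (auto simp: nonneg_sa_def nonneg_op_def)
    qed
    \<comment> \<open>This angle solves \<open>\<theta> \<alpha> = t\<close>.\<close>
    define \<alpha> where "\<alpha> = arccot (Q - t)"
    have \<alpha>: "0 < \<alpha>" "\<alpha> < pi" "cos \<alpha> / sin \<alpha> = Q - t" unfolding \<alpha>_def by (rule cot_arccot)+
    have "sat a b r S = sat a b r (TT \<alpha>)"
      unfolding sat_TT[OF \<alpha>(1,2)] using HE \<alpha>(3) by (simp add: H_def \<theta>_def)
    moreover have "arccot Q \<le> \<alpha>" unfolding arccot_le_iff[OF \<alpha>(1,2)] using \<alpha>(3) t0 by simp
    ultimately show ?thesis using \<alpha>(2) by (intro exI[of _ \<alpha>]) auto
  qed
qed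

text \<open>Each condition is rewritten over pairs of the reference operator with a coefficient c,
  so criteria for different angles can be tested on identical pairs although the operator domains
  differ.\<close>

lemma form_bound_TT:
  assumes \<alpha>: "0 < \<alpha>" "\<alpha> < pi"
  shows "form_bound (TT \<alpha>) f M \<longleftrightarrow> (\<forall>k h c. (k, h) \<in> TT pi \<longrightarrow> ip h \<psi> = c * complex_of_real (\<theta> \<alpha>) \<longrightarrow>
    (cmod (ip f h))\<^sup>2 \<le> M * (Re (ip h k) + \<theta> \<alpha> * (cmod c)\<^sup>2))"
proof
  assume fb: "form_bound (TT \<alpha>) f M"
  show "\<forall>k h c. (k, h) \<in> TT pi \<longrightarrow> ip h \<psi> = c * complex_of_real (\<theta> \<alpha>) \<longrightarrow>
    (cmod (ip f h))\<^sup>2 \<le> M * (Re (ip h k) + \<theta> \<alpha> * (cmod c)\<^sup>2)"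
  proof (intro allI impI)
    fix k h c assume k: "(k, h) \<in> TT pi" "ip h \<psi> = c * complex_of_real (\<theta> \<alpha>)"
    have m: "((\<lambda>x. k x + c * \<psi> x), h) \<in> TT \<alpha>" unfolding TT_iff_theta[OF \<alpha>] using Tpi_add_psi[OF k(1), of c] k(2) by simp
    have L: "LL (\<lambda>x. k x + c * \<psi> x)" using L2_pairsD[OF TT_L2 m] by simp
    have "Re (ip h (\<lambda>x. k x + c * \<psi> x)) = Re (ip h k) + \<theta> \<alpha> * (cmod c)\<^sup>2"
      using Ext_ip[OF L k(1) eqv_refl k(2)] by simp
    then show "(cmod (ip f h))\<^sup>2 \<le> M * (Re (ip h k) + \<theta> \<alpha> * (cmod c)\<^sup>2)"
      using fb m unfolding form_bound_def by fastforce
  qed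
next
  assume *: "\<forall>k h c. (k, h) \<in> TT pi \<longrightarrow> ip h \<psi> = c * complex_of_real (\<theta> \<alpha>) \<longrightarrow>
    (cmod (ip f h))\<^sup>2 \<le> M * (Re (ip h k) + \<theta> \<alpha> * (cmod c)\<^sup>2)"
  show "form_bound (TT \<alpha>) f M" unfolding form_bound_def
  proof clarify
    fix g h assume gh: "(g, h) \<in> TT \<alpha>"
    then have g: "(g, h) \<in> TM" "bcb g = 0" "ip h \<psi> = bva g * complex_of_real (\<theta> \<alpha>)" by (auto simp: TT_iff_theta[OF \<alpha>])
    have k: "((\<lambda>x. g x + (- bva g) * \<psi> x), h) \<in> TT pi" (is "(?k, h) \<in> _") by (rule TM_bcb_split[OF g(1,2)])
    have e: "eqv g (\<lambda>x. ?k x + bva g * \<psi> x)" by simp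
    have "Re (ip h g) = Re (ip h ?k) + \<theta> \<alpha> * (cmod (bva g))\<^sup>2"
      using Ext_ip[OF T_max_L2(1)[OF g(1)] k e g(3)] by simp
    then show "(cmod (ip f h))\<^sup>2 \<le> M * Re (ip h g)" using *[rule_format, OF k g(3)] by simp
  qed
qed

text \<open>For fixed (k, h) with nonzero parameter the extra term is |<h, \<psi>>|^2 divided by the
  parameter, hence decreasing in it. The converse uses \<psi>, whose form value in an extension is
  its parameter, against pairs with nearly no reference form.\<close>

lemma op_le_TT_iff:
  assumes \<alpha>1: "0 < \<alpha>1" "\<alpha>1 \<le> pi" and \<alpha>2: "0 < \<alpha>2" "\<alpha>2 \<le> pi"
  shows "(arccot Q \<le> \<alpha>1 \<and> \<alpha>1 \<le> \<alpha>2) \<longleftrightarrow> op_le a b r (TT \<alpha>1) (TT \<alpha>2)"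
proof
  assume le: "arccot Q \<le> \<alpha>1 \<and> \<alpha>1 \<le> \<alpha>2"
  have imp: "form_bound (TT \<alpha>1) f M" if M: "0 \<le> M" and fb: "form_bound (TT \<alpha>2) f M" for f M
  proof (cases "\<alpha>1 = \<alpha>2")
    case True
    with fb show ?thesis by simp
  next
    case False
    with le \<alpha>2 have lt: "\<alpha>1 < \<alpha>2" "\<alpha>1 < pi" by auto
    have t1: "0 \<le> \<theta> \<alpha>1" using le arccot_le_iff[OF \<alpha>1(1) lt(2), of Q] by (simp add: \<theta>_def)
    show ?thesis unfolding form_bound_TT[OF \<alpha>1(1) lt(2)]
    proof (intro allI impI)
      fix k h c assume k: "(k, h) \<in> TT pi" and hp: "ip h \<psi> = c * complex_of_real (\<theta> \<alpha>1)"
      show "(cmod (ip f h))\<^sup>2 \<le> M * (Re (ip h k) + \<theta> \<alpha>1 * (cmod c)\<^sup>2)"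
      proof (cases "\<alpha>2 = pi")
        case True
        have "(cmod (ip f h))\<^sup>2 \<le> M * Re (ip h k)" using fb k True by (auto simp: form_bound_def)
        also have "\<dots> \<le> M * (Re (ip h k) + \<theta> \<alpha>1 * (cmod c)\<^sup>2)" using M t1 by (intro mult_left_mono) auto
        finally show ?thesis .
      next
        case False
        with \<alpha>2 have lt2: "\<alpha>2 < pi" by simp
        have "cos \<alpha>2 / sin \<alpha>2 < cos \<alpha>1 / sin \<alpha>1"
        proof -
          have "arctan (cos \<alpha>2 / sin \<alpha>2) < arctan (cos \<alpha>1 / sin \<alpha>1)"
            unfolding arctan_cot[OF \<alpha>2(1) lt2] arctan_cot[OF \<alpha>1(1) lt(2)] using lt by simp
          then show ?thesis by (simp only: arctan_less_iff)
        qed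
        then have t2: "\<theta> \<alpha>1 < \<theta> \<alpha>2" by (simp add: \<theta>_def)
        \<comment> \<open>The same pair belongs to the second extension with this coefficient, whose
          extra term is smaller by the factor
          \<open>\<theta> \<alpha>1 / \<theta> \<alpha>2\<close>.\<close>
        define c' where "c' = c * complex_of_real (\<theta> \<alpha>1 / \<theta> \<alpha>2)"
        have "ip h \<psi> = c' * complex_of_real (\<theta> \<alpha>2)" using hp t1 t2 by (simp add: c'_def)
        with fb k have "(cmod (ip f h))\<^sup>2 \<le> M * (Re (ip h k) + \<theta> \<alpha>2 * (cmod c')\<^sup>2)"
          unfolding form_bound_TT[OF \<alpha>2(1) lt2] by blast
        also have "\<theta> \<alpha>2 * (cmod c')\<^sup>2 = (\<theta> \<alpha>1 / \<theta> \<alpha>2) * (\<theta> \<alpha>1 * (cmod c)\<^sup>2)"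
          using t1 t2 by (simp add: c'_def norm_mult norm_divide power_mult_distrib power2_eq_square field_simps)
        also have "M * (Re (ip h k) + (\<theta> \<alpha>1 / \<theta> \<alpha>2) * (\<theta> \<alpha>1 * (cmod c)\<^sup>2)) \<le> M * (Re (ip h k) + 1 * (\<theta> \<alpha>1 * (cmod c)\<^sup>2))"
          using M t1 t2 by (intro mult_left_mono add_left_mono mult_right_mono) auto
        finally show ?thesis by simp
      qed
    qed
  qed
  show "op_le a b r (TT \<alpha>1) (TT \<alpha>2)" unfolding op_le_iff
    using le imp nonneg_sa_TT_iff[OF \<alpha>1] nonneg_sa_TT_iff[OF \<alpha>2] by auto
next
  assume op: "op_le a b r (TT \<alpha>1) (TT \<alpha>2)"
  then have n: "nonneg_sa a b r (TT \<alpha>1)" "nonneg_sa a b r (TT \<alpha>2)"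
    and imp: "\<And>f M. LL f \<Longrightarrow> 0 \<le> M \<Longrightarrow> form_bound (TT \<alpha>2) f M \<Longrightarrow> form_bound (TT \<alpha>1) f M"
    unfolding op_le_iff by auto
  have q: "arccot Q \<le> \<alpha>1" "arccot Q \<le> \<alpha>2" using n nonneg_sa_TT_iff[OF \<alpha>1] nonneg_sa_TT_iff[OF \<alpha>2] by auto
  have "\<alpha>1 \<le> \<alpha>2"
  proof (rule ccontr)
    assume "\<not> \<alpha>1 \<le> \<alpha>2"
    then have lt: "\<alpha>2 < \<alpha>1" "\<alpha>2 < pi" using \<alpha>1 by auto
    have t2: "0 \<le> \<theta> \<alpha>2" using q(2) arccot_le_iff[OF \<alpha>2(1) lt(2), of Q] by (simp add: \<theta>_def)
    have "form_bound (TT \<alpha>2) \<psi> (\<theta> \<alpha>2)" unfolding form_bound_TT[OF \<alpha>2(1) lt(2)]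
    proof (intro allI impI)
      fix k h c assume k: "(k, h) \<in> TT pi" and hp: "ip h \<psi> = c * complex_of_real (\<theta> \<alpha>2)"
      have "cmod (ip \<psi> h) = cmod (ip h \<psi>)" using ip_commute[OF Tpi_LL(2)[OF k] psi_LL] by simp
      then have "(cmod (ip \<psi> h))\<^sup>2 = \<theta> \<alpha>2 * (\<theta> \<alpha>2 * (cmod c)\<^sup>2)" by (simp add: hp norm_mult power2_eq_square)
      also have "\<dots> \<le> \<theta> \<alpha>2 * (Re (ip h k) + \<theta> \<alpha>2 * (cmod c)\<^sup>2)"
        using t2 Tpi_nonneg(1)[OF k] by (intro mult_left_mono) auto
      finally show "(cmod (ip \<psi> h))\<^sup>2 \<le> \<theta> \<alpha>2 * (Re (ip h k) + \<theta> \<alpha>2 * (cmod c)\<^sup>2)" .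
    qed
    then have fb: "form_bound (TT \<alpha>1) \<psi> (\<theta> \<alpha>2)" by (rule imp[OF psi_LL t2])
    show False
    proof (cases "\<alpha>1 = pi")
      case True
      \<comment> \<open>A finite form bound for \<psi> in the reference operator would give 1 <=
        \<theta> / (\<theta> + 1) with \<theta> the second parameter; the summand 1 also covers
        parameter 0.\<close>
      have d: "0 < 1 / (\<theta> \<alpha>2 + 1)" using t2 by simp
      obtain k h where k: "(k, h) \<in> TT pi" "ip h \<psi> = 1" "Re (ip h k) < 1 / (\<theta> \<alpha>2 + 1)"
        using friedrichs_scaled[OF d, of 1] by (metis zero_neq_one)
      have "(cmod (ip \<psi> h))\<^sup>2 \<le> \<theta> \<alpha>2 * Re (ip h k)" using fb k(1) True by (auto simp: form_bound_def)
      moreover have "cmod (ip \<psi> h) = 1" using ip_commute[OF Tpi_LL(2)[OF k(1)] psi_LL] k(2) by simp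
      moreover have "\<theta> \<alpha>2 * Re (ip h k) \<le> \<theta> \<alpha>2 * (1 / (\<theta> \<alpha>2 + 1))" using k(3) t2 by (intro mult_left_mono) auto
      ultimately have "1 \<le> \<theta> \<alpha>2 / (\<theta> \<alpha>2 + 1)" by simp
      then show False using t2 by (simp add: field_simps)
    next
      case False
      with \<alpha>1 have lt1: "\<alpha>1 < pi" by simp
      have "cos \<alpha>1 / sin \<alpha>1 < cos \<alpha>2 / sin \<alpha>2"
      proof -
        have "arctan (cos \<alpha>1 / sin \<alpha>1) < arctan (cos \<alpha>2 / sin \<alpha>2)"
          unfolding arctan_cot[OF \<alpha>2(1) lt(2)] arctan_cot[OF \<alpha>1(1) lt1] using lt by simp
        then show ?thesis by (simp only: arctan_less_iff)
      qed
      then have t12: "\<theta> \<alpha>2 < \<theta> \<alpha>1" by (simp add: \<theta>_def)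
      \<comment> \<open>For coefficient 1 the bound would give \<open>\<theta> \<alpha>1 * (\<theta>
        \<alpha>1 - \<theta> \<alpha>2) \<le> \<theta> \<alpha>2 * \<delta>\<close>, while this
        \<delta> makes the left side equal to
        \<open>(\<theta> \<alpha>2 + 1) * \<delta>\<close>.\<close>
      define \<delta> where "\<delta> = \<theta> \<alpha>1 * (\<theta> \<alpha>1 - \<theta> \<alpha>2) / (\<theta> \<alpha>2 + 1)"
      have d: "0 < \<delta>" "complex_of_real (\<theta> \<alpha>1) \<noteq> 0" using t2 t12 by (auto simp: \<delta>_def)
      obtain k h where k: "(k, h) \<in> TT pi" "ip h \<psi> = complex_of_real (\<theta> \<alpha>1)" "Re (ip h k) < \<delta>"
        using friedrichs_scaled[OF d] by metis
      have "(cmod (ip \<psi> h))\<^sup>2 \<le> \<theta> \<alpha>2 * (Re (ip h k) + \<theta> \<alpha>1 * (cmod 1)\<^sup>2)"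
        using fb k(1,2) unfolding form_bound_TT[OF \<alpha>1(1) lt1] by (metis mult_1)
      moreover have "cmod (ip \<psi> h) = \<theta> \<alpha>1" using ip_commute[OF Tpi_LL(2)[OF k(1)] psi_LL] k(2) t2 t12 by simp
      ultimately have "\<theta> \<alpha>1 * \<theta> \<alpha>1 \<le> \<theta> \<alpha>2 * Re (ip h k) + \<theta> \<alpha>2 * \<theta> \<alpha>1" by (simp add: power2_eq_square algebra_simps)
      moreover have "\<theta> \<alpha>2 * Re (ip h k) \<le> \<theta> \<alpha>2 * \<delta>" using k(3) t2 by (intro mult_left_mono) auto
      moreover have "\<theta> \<alpha>2 * \<delta> < (\<theta> \<alpha>2 + 1) * \<delta>" using d by simp
      moreover have "(\<theta> \<alpha>2 + 1) * \<delta> = \<theta> \<alpha>1 * (\<theta> \<alpha>1 - \<theta> \<alpha>2)" using t2 by (simp add: \<delta>_def)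
      ultimately show False by (simp add: right_diff_distrib mult.commute)
    qed
  qed
  with q show "arccot Q \<le> \<alpha>1 \<and> \<alpha>1 \<le> \<alpha>2" by simp
qed

end

theorem theorem3p9:
  fixes a b :: ereal and p q r :: "real \<Rightarrow> real"
    and ua uah ub ubh :: "real \<Rightarrow> complex" and \<beta>' \<epsilon> :: real
  assumes hSL: "SL_setup a b p q r"
    and lc_a: "limit_circle_a a b p q r" and lc_b: "limit_circle_b a b p q r"
    and ua: "principal_a a b p q r ua"
    and uah: "real_sol a b p q r uah" "lin_indep a b ua uah"
    and W_a: "\<forall>x\<in>Ioo_e a b. Wr a b p uah ua x = 1"
    and ub: "principal_b a b p q r ub"
    and ubh: "real_sol a b p q r ubh" "lin_indep a b ub ubh"
    and W_b: "\<forall>x\<in>Ioo_e a b. Wr a b p ubh ub x = 1"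
    and beta: "0 < \<beta>'" "\<beta>' \<le> pi"
    and eps: "0 < \<epsilon>"
    and pos: "op_le a b r (eps_op a b r \<epsilon>) (T_ab a b p q r ua uah ub ubh pi \<beta>')"
  shows "Q_den a b p ua ub ubh \<beta>' \<noteq> 0 \<and>
    (let Q = Re (Q_num a b p uah ub ubh \<beta>' / Q_den a b p ua ub ubh \<beta>') in
      (\<forall>S. S \<subseteq> L2_pairs a b r \<longrightarrow>
         ((nonneg_sa a b r S \<and>
           sat a b r (T_min_b a b p q r ua uah ub ubh \<beta>') \<subseteq> sat a b r S) \<longleftrightarrow>
          (\<exists>\<alpha>. arccot Q \<le> \<alpha> \<and> \<alpha> \<le> pi \<and>
             sat a b r S = sat a b r (T_ab a b p q r ua uah ub ubh \<alpha> \<beta>')))) \<and>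
      (\<forall>\<alpha>1 \<alpha>2. 0 < \<alpha>1 \<longrightarrow> \<alpha>1 \<le> pi \<longrightarrow> 0 < \<alpha>2 \<longrightarrow> \<alpha>2 \<le> pi \<longrightarrow>
         ((arccot Q \<le> \<alpha>1 \<and> \<alpha>1 \<le> \<alpha>2) \<longleftrightarrow>
          op_le a b r (T_ab a b p q r ua uah ub ubh \<alpha>1 \<beta>') (T_ab a b p q r ua uah ub ubh \<alpha>2 \<beta>'))))"
proof -
  interpret SL_pos a b p q r ua uah ub ubh \<beta>' \<epsilon>
    using assms by unfold_locales (auto simp: principal_b_def)
  have num: "Q_num a b p uah ub ubh \<beta>' = bcb uah" and den: "Q_den a b p ua ub ubh \<beta>' = bcb ua"
    by (simp_all add: Q_num_def Q_den_def bcb_def mult.commute cos_of_real sin_of_real)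
  show ?thesis unfolding num den Let_def Q_def[symmetric]
    using bcb_ua_nz nonneg_extensions op_le_TT_iff by blast
qed

end
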